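(* There is an open and dense subset $\mathcal{U}$ of $\mathcal{E}^{2}(\mathbb{T})$ (with the $C^2$ topology) such that every $T\in\mathcal{U}$ has a unique Lyapunov minimizing measure, and this measure is supported on a periodic orbit of $T$ (i.e. it equals $\delta_\Gamma=\frac{1}{\#\Gamma}\sum_{x\in\Gamma}\delta_x$ for some periodic orbit $\Gamma$ of $T$).
   Context: $\mathbb{T}=\mathbb{R}/\mathbb{Z}$ is the circle with its standard metric $d$. A $C^1$ map $T:\mathbb{T}\to\mathbb{T}$ is expanding if there are $C>0$ and $\lambda>1$ with $|DT^n(x)|\ge C\lambda^n$ for all $x\in\mathbb{T}$, $n\ge1$. For $k\ge1$, $\mathcal{E}^k(\mathbb{T})$ denotes the space of $C^k$ expanding self-maps of $\mathbb{T}$ with the $C^k$ distance $d_{C^k}(S,T)=\sum_{i=0}^k d_{C^0}(D^iS,D^iT)$. For a $T$-invariant Borel probability measure $\mu$, its Lyapunov exponent is $\lambda_T(\mu)=\int\log|DT|\,d\mu$. Let $\alpha(T)=\inf\{\lambda_T(\nu):\nu$ a $T$-invariant Borel probability measure$\}$. An invariant measure $\mu$ is a Lyapunov minimizing measure if $\lambda_T(\mu)=\alpha(T)$. *)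

theory Defs
  imports "HOL-Probability.Probability"
begin

text \<open>A self-map of the circle R/Z is represented by a lift F : real => real with
  F(x+1) = F x + d for an integer d (the degree). The circle is identified with [0,1).\<close>

definition C2_lift :: "(real \<Rightarrow> real) \<Rightarrow> bool" where
  "C2_lift F \<longleftrightarrow> (\<forall>x. F differentiable at x) \<and> (\<forall>x. deriv F differentiable at x)
     \<and> continuous_on UNIV (deriv (deriv F)) \<and> (\<exists>d::int. \<forall>x. F (x + 1) = F x + of_int d)"

definition expanding_lift :: "(real \<Rightarrow> real) \<Rightarrow> bool" where
  "expanding_lift F \<longleftrightarrow> (\<exists>C>0. \<exists>l>1. \<forall>x. \<forall>n\<ge>1. \<bar>deriv (F ^^ n) x\<bar> \<ge> C * l ^ n)"

definition E2 :: "(real \<Rightarrow> real) set" where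
  "E2 = {F. C2_lift F \<and> expanding_lift F}"

definition circ_map :: "(real \<Rightarrow> real) \<Rightarrow> real \<Rightarrow> real" where
  "circ_map F x = frac (F x)"

definition cdist :: "real \<Rightarrow> real \<Rightarrow> real" where
  "cdist a b = \<bar>(a - b) - of_int (round (a - b))\<bar>"

definition dC2 :: "(real \<Rightarrow> real) \<Rightarrow> (real \<Rightarrow> real) \<Rightarrow> real" where
  "dC2 S T = (SUP x. cdist (S x) (T x)) + (SUP x. \<bar>deriv S x - deriv T x\<bar>)
     + (SUP x. \<bar>deriv (deriv S) x - deriv (deriv T) x\<bar>)"

text \<open>Borel probability measures on the circle = Borel probability measures on R concentrated on [0,1).\<close>
definition invariant_measure :: "(real \<Rightarrow> real) \<Rightarrow> real measure \<Rightarrow> bool" where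
  "invariant_measure F \<mu> \<longleftrightarrow> sets \<mu> = sets borel \<and> prob_space \<mu> \<and> emeasure \<mu> {0..<1} = 1
     \<and> distr \<mu> borel (circ_map F) = \<mu>"

definition lyap :: "(real \<Rightarrow> real) \<Rightarrow> real measure \<Rightarrow> real" where
  "lyap F \<mu> = (\<integral>x. ln \<bar>deriv F x\<bar> \<partial>\<mu>)"

definition alpha :: "(real \<Rightarrow> real) \<Rightarrow> real" where
  "alpha F = Inf (lyap F ` {\<mu>. invariant_measure F \<mu>})"

definition lyap_minimizing :: "(real \<Rightarrow> real) \<Rightarrow> real measure \<Rightarrow> bool" where
  "lyap_minimizing F \<mu> \<longleftrightarrow> invariant_measure F \<mu> \<and> lyap F \<mu> = alpha F"

definition periodic_orbit :: "(real \<Rightarrow> real) \<Rightarrow> real set \<Rightarrow> bool" where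
  "periodic_orbit F \<Gamma> \<longleftrightarrow> (\<exists>x\<in>{0..<1}. (\<exists>p\<ge>1. (circ_map F ^^ p) x = x)
       \<and> \<Gamma> = range (\<lambda>k. (circ_map F ^^ k) x))"

definition is_orbit_measure :: "real set \<Rightarrow> real measure \<Rightarrow> bool" where
  "is_orbit_measure \<Gamma> \<mu> \<longleftrightarrow> sets \<mu> = sets borel
     \<and> (\<forall>A\<in>sets borel. emeasure \<mu> A = ennreal (real (card (\<Gamma> \<inter> A)) / real (card \<Gamma>)))"

end

theory Submission
  imports Defs
begin

text \<open>Lift everything to the line, where an expanding map is a diffeomorphism, and write
  \<open>\<phi> = ln |DT|\<close>.  The infimum of \<open>\<phi>\<close>-sums along backward orbits is a Lipschitz function \<open>u\<close> with
  \<open>\<phi> - \<alpha> - u \<circ> T + u \<ge> 0\<close>, and the closed invariant set \<open>Z\<close> on which this function vanishes along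
  whole orbits is nonempty.

  For every \<open>\<epsilon>\<close> there is a periodic orbit whose total distance to \<open>Z\<close> is at most \<open>\<epsilon>\<close> times the
  smallest gap between its points.  Indeed, periodic orbits of period \<open>n\<close> approximate \<open>Z\<close> faster than
  any power of \<open>n\<close> (Bressaud and Quas): a transition graph on \<open>M\<close> words without cycles of length
  at most \<open>2 n\<close> has at most \<open>M^n / n!\<close> paths of \<open>n\<close> words, fewer than the entropy of \<open>Z\<close>
  requires.  If such an orbit has two points that are too close, cutting it there and closing up the
  shorter half at least halves the period at the cost of a constant factor in the distance, so an
  orbit of least period among the good approximations has the required gap.

  Finally, precompose \<open>T\<close> with a diffeomorphism that fixes this orbit and contracts slightly near its
  points.  An orbit of the new map, or of any map close to it, gains whenever it is away from the
  periodic orbit; while it shadows the periodic orbit it loses at most a small multiple of the gap,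
  and that is repaid when it escapes.\<close>

section \<open>Closing pseudo-orbits on the line\<close>

text \<open>The gap \<open>D\<close> of the orbit sets the scale. Bumps around its points need
  disjoint supports, hence a width \<open>s\<close> proportional to \<open>D\<close>, and a
  displacement of width \<open>s\<close> whose second derivative is of order
  \<open>\<epsilon>\<close> changes the first derivative only by order
  \<open>\<epsilon> * s\<close>. The gain of a C2-small perturbation is therefore linear in
  \<open>D\<close>, and the deficit of the orbit, at most a constant times its total distance to
  \<open>Z\<close>, has to stay below it. The cost of shadowing within radius
  \<open>\<theta> * D\<close> is linear in \<open>D\<close> as well, so \<open>\<theta>\<close> can
  be fixed before the orbit is known.

  The function \<open>u\<close> of the unperturbed map is kept for all nearby maps. At relative
  distance \<open>y\<close> from the orbit, evaluating it at a displaced point costs at most order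
  \<open>\<epsilon> * s\<^sup>2 * y\<close>, against a gain of order
  \<open>\<epsilon> * s * y\<^sup>2\<close>; for small \<open>s\<close> the gain wins as soon as
  \<open>y\<close> is at least \<open>\<theta>\<close>.

  On the line the expansion of distances is global: pseudo-orbits with jumps of any size can be
  closed, and the intermediate value theorem yields a periodic point with any prescribed
  translation.\<close>

lemma shift_of_int:
  fixes f :: "real \<Rightarrow> real"
  assumes "\<And>x. f (x + 1) = f x + c"
  shows "f (x + of_int k) = f x + of_int k * c"
proof (induction k rule: int_induct[where k = 0])
  case base
  then show ?case by simp
next
  case (step1 i)
  have "f (x + of_int (i + 1)) = f (x + of_int i + 1)" by (simp add: add.assoc)
  also have "\<dots> = f (x + of_int i) + c" by (rule assms)
  finally show ?case using step1 by (simp add: algebra_simps)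
next
  case (step2 i)
  have "f (x + of_int (i - 1) + 1) = f (x + of_int i)" by (simp add: algebra_simps)
  then have "f (x + of_int (i - 1)) + c = f (x + of_int i)" using assms by metis
  then show ?case using step2 by (simp add: algebra_simps)
qed

lemma sum_shift_periodic:
  fixes f :: "nat \<Rightarrow> real"
  assumes "f n = f 0"
  shows "(\<Sum>t<n. f (Suc t)) = (\<Sum>t<n. f t)"
proof -
  have "(\<Sum>t<n. f (Suc t)) - (\<Sum>t<n. f t) = f n - f 0"
    by (simp add: sum_subtractf[symmetric] sum_lessThan_telescope)
  then show ?thesis using assms by simp
qed

lemma translate_surj:
  fixes f :: "real \<Rightarrow> real" and m :: int
  assumes cf: "continuous_on UNIV f" and pf: "\<And>x. f (x + 1) = f x + of_int m" and "m \<noteq> 0"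
  shows "\<exists>x. f x = y"
proof -
  obtain K :: nat where K: "real K > \<bar>y - f 0\<bar>" using reals_Archimedean2 by blast
  have "f (of_int j) = f 0 + of_int j * of_int m" for j
    using shift_of_int[of f "of_int m" 0 j, OF pf] by simp
  note fj = this
  have m1: "\<bar>real_of_int m\<bar> \<ge> 1" using \<open>m \<noteq> 0\<close> by linarith
  have le: "real K \<le> real K * \<bar>real_of_int m\<bar>"
    using m1 mult_left_mono[OF m1, of "real K"] by simp
  have 1: "f (of_int (int K * sgn m)) \<ge> y"
    using fj[of "int K * sgn m"] K le by (cases "m > 0") (auto simp: sgn_if)
  have 2: "f (of_int (- int K * sgn m)) \<le> y"
    using fj[of "- int K * sgn m"] K le by (cases "m > 0") (auto simp: sgn_if)
  have "connected (f ` UNIV)" using cf by (intro connected_continuous_image) auto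
  then have "y \<in> f ` UNIV" using 1 2
    by (meson connected_contains_Icc UNIV_I atLeastAtMost_iff imageI subsetD)
  then show ?thesis by auto
qed

text \<open>Increments of \<open>H\<close> measure length in an adapted metric, in which
  \<open>lam\<close> is a one-step expansion factor. The inequality \<open>expand\<close> is for all
  pairs of points on the line, which is available because the lift is monotone.
  \<open>H_lower\<close> normalises the metric to dominate the Euclidean one, and \<open>c\<close>
  is, up to sign, the length of the circle.\<close>

locale adapted_lift =
  fixes F H :: "real \<Rightarrow> real" and d :: int and lam W c :: real
  assumes cont: "continuous_on UNIV F"
    and per: "F (x + 1) = F x + of_int d"
    and lam: "lam > 1"
    and H_lower: "\<bar>x - y\<bar> \<le> \<bar>H x - H y\<bar>"
    and H_upper: "\<bar>H x - H y\<bar> \<le> W * \<bar>x - y\<bar>"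
    and H_per: "H (x + 1) = H x + c"
    and expand: "lam * \<bar>H x - H y\<bar> \<le> \<bar>H (F x) - H (F y)\<bar>"
begin

lemma W_ge_1: "W \<ge> 1"
  using H_lower[of 1 0] H_upper[of 1 0] by simp

lemma H_int: "H (x + of_int k) = H x + of_int k * c"
  by (rule shift_of_int) (rule H_per)

lemma c_ge_1: "\<bar>c\<bar> \<ge> 1"
  using H_lower[of "0 + 1" 0] H_per[of 0] by simp

lemma H_int_diff: "\<bar>H (x + of_int k) - H (y + of_int k)\<bar> = \<bar>H x - H y\<bar>"
  by (simp add: H_int)

lemma F_int: "F (x + of_int k) = F x + of_int (d * k)"
  using shift_of_int[of F "of_int d", OF per] by (simp add: mult.commute)

lemma Fn_int: "(F ^^ n) (x + of_int k) = (F ^^ n) x + of_int (d ^ n * k)"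
proof (induction n)
  case (Suc n)
  have "(F ^^ Suc n) (x + of_int k) = F ((F ^^ n) x + of_int (d ^ n * k))" using Suc by simp
  also have "\<dots> = (F ^^ Suc n) x + of_int (d ^ Suc n * k)" by (simp only: F_int) simp
  finally show ?case .
qed simp

lemma Fn_cont: "continuous_on UNIV (F ^^ n)"
proof (induction n)
  case (Suc n)
  then show ?case
    using continuous_on_compose2[OF cont Suc] by (simp add: o_def)
qed (simp add: id_def)

lemma expand_iter: "lam ^ n * \<bar>H x - H y\<bar> \<le> \<bar>H ((F ^^ n) x) - H ((F ^^ n) y)\<bar>"
proof (induction n)
  case (Suc n)
  have "lam ^ Suc n * \<bar>H x - H y\<bar> = lam * (lam ^ n * \<bar>H x - H y\<bar>)" by simp
  also have "\<dots> \<le> lam * \<bar>H ((F ^^ n) x) - H ((F ^^ n) y)\<bar>"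
    using Suc lam by (intro mult_left_mono) auto
  also have "\<dots> \<le> \<bar>H ((F ^^ Suc n) x) - H ((F ^^ Suc n) y)\<bar>"
    using expand by simp
  finally show ?case .
qed simp

text \<open>A fundamental interval has length \<open>|c|\<close> and its image
  \<open>|d * c|\<close>, so \<open>lam \<le> |d|\<close>. This makes the translations of
  \<open>F ^^ n\<close> and of \<open>F ^^ n\<close> minus the identity nonzero, as the intermediate
  value argument needs.\<close>

lemma degree_ge_2: "\<bar>d\<bar> \<ge> 2"
proof -
  have "lam * \<bar>c\<bar> \<le> \<bar>of_int d * c\<bar>"
    using expand[of "0 + 1" 0] by (simp only: per H_per H_int) simp
  then have "lam * \<bar>c\<bar> \<le> \<bar>of_int d\<bar> * \<bar>c\<bar>" by (simp add: abs_mult)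
  moreover have "\<bar>c\<bar> > 0" using c_ge_1 by linarith
  ultimately have "lam \<le> of_int \<bar>d\<bar>" by (simp add: mult_le_cancel_right)
  then have "1 < real_of_int \<bar>d\<bar>" using lam by linarith
  then show ?thesis by linarith
qed

lemma H_inj: "H x = H y \<Longrightarrow> x = y"
  using H_lower[of x y] by simp

lemma Fn_surj: "\<exists>x. (F ^^ n) x = y"
proof (rule translate_surj[OF Fn_cont, where m = "d ^ n"])
  show "(F ^^ n) (x + 1) = (F ^^ n) x + of_int (d ^ n)" for x
    using Fn_int[of n x 1] by simp
  show "d ^ n \<noteq> 0" using degree_ge_2 by auto
qed

lemma periodic_point_exists:
  assumes "n \<ge> 1"
  shows "\<exists>q. (F ^^ n) q = q + of_int l"
proof -
  have "\<exists>q. (\<lambda>x. (F ^^ n) x - x) q = of_int l"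
  proof (rule translate_surj[where m = "d ^ n - 1"])
    show "continuous_on UNIV (\<lambda>x. (F ^^ n) x - x)"
      by (intro continuous_intros Fn_cont)
    show "(F ^^ n) (x + 1) - (x + 1) = (F ^^ n) x - x + of_int (d ^ n - 1)" for x
      using Fn_int[of n x 1] by simp
    have "\<bar>d ^ n\<bar> \<ge> 2"
      using degree_ge_2 assms self_le_power[of "\<bar>d\<bar>" n] by (simp add: power_abs)
    then show "d ^ n - 1 \<noteq> 0" by auto
  qed
  then show ?thesis by (auto simp: algebra_simps)
qed

text \<open>If \<open>q\<close> has the same total translation as the pseudo-orbit, its distances
  \<open>\<delta> t\<close> to it are periodic in \<open>t\<close> and satisfy
  \<open>lam * \<delta> t \<le> \<delta> (Suc t) + e t\<close>; summing over a period absorbs the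
  shifted sum. Bounding the sum instead of the maximum makes Birkhoff sums of Lipschitz functions
  comparable with constants independent of \<open>n\<close>.\<close>

lemma closing:
  fixes x :: "nat \<Rightarrow> real" and k :: "nat \<Rightarrow> int"
  assumes n: "n \<ge> 1" and xn: "x n = x 0"
    and jump: "\<And>t. t < n \<Longrightarrow> \<bar>H (F (x t) + of_int (k t)) - H (x (Suc t))\<bar> \<le> e t"
  shows "\<exists>q l a. (F ^^ n) q = q + of_int l \<and>
    (lam - 1) * (\<Sum>t<n. \<bar>H ((F ^^ t) q) - H (x t + of_int (a t))\<bar>) \<le> (\<Sum>t<n. e t)"
proof -
  \<comment> \<open>\<open>a t\<close> is the sheet on which \<open>x t\<close> is read:
    \<open>F (x t + a t) = F (x t) + d * a t\<close>, and the jump leads from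
    \<open>F (x t) + k t\<close> to \<open>x (Suc t)\<close>.\<close>
  define a :: "nat \<Rightarrow> int" where "a = rec_nat 0 (\<lambda>t v. d * v - k t)"
  have a0: "a 0 = 0" and aS: "a (Suc t) = d * a t - k t" for t by (simp_all add: a_def)
  obtain q where q: "(F ^^ n) q = q + of_int (a n)" using periodic_point_exists[OF n] by blast
  define \<delta> where "\<delta> t = \<bar>H ((F ^^ t) q) - H (x t + of_int (a t))\<bar>" for t
  have "\<delta> n = \<delta> 0" by (simp add: \<delta>_def q xn a0 H_int)
  have step: "lam * \<delta> t \<le> \<delta> (Suc t) + e t" if "t < n" for t
  proof -
    have Fx: "F (x t + of_int (a t)) = F (x t) + of_int (k t) + of_int (a (Suc t))"
      by (simp add: F_int aS)
    have "lam * \<delta> t \<le> \<bar>H ((F ^^ Suc t) q) - H (F (x t + of_int (a t)))\<bar>"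
      unfolding \<delta>_def using expand by simp
    also have "\<dots> \<le> \<delta> (Suc t) + \<bar>H (x (Suc t) + of_int (a (Suc t))) - H (F (x t + of_int (a t)))\<bar>"
      unfolding \<delta>_def by linarith
    also have "\<bar>H (x (Suc t) + of_int (a (Suc t))) - H (F (x t + of_int (a t)))\<bar> \<le> e t"
      unfolding Fx H_int_diff using jump[OF that] by linarith
    finally show ?thesis by simp
  qed
  have "lam * (\<Sum>t<n. \<delta> t) \<le> (\<Sum>t<n. \<delta> (Suc t) + e t)"
    unfolding sum_distrib_left using step by (intro sum_mono) auto
  also have "\<dots> = (\<Sum>t<n. \<delta> t) + (\<Sum>t<n. e t)"
    using sum_shift_periodic[OF \<open>\<delta> n = \<delta> 0\<close>] by (simp add: sum.distrib)
  finally have "(lam - 1) * (\<Sum>t<n. \<delta> t) \<le> (\<Sum>t<n. e t)" by (simp add: algebra_simps)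
  then show ?thesis using q unfolding \<delta>_def by blast
qed

end

section \<open>Sub-actions\<close>

lemma periodic_of_int:
  fixes g :: "real \<Rightarrow> real"
  assumes "\<And>x. g (x + 1) = g x"
  shows "g (x + of_int k) = g x"
  using shift_of_int[of g 0 x k] assms by simp

lemma periodic_frac:
  fixes g :: "real \<Rightarrow> real"
  assumes "\<And>x. g (x + 1) = g x"
  shows "g (frac x) = g x"
  using periodic_of_int[of g "frac x" "\<lfloor>x\<rfloor>", OF assms] by (simp add: frac_def)

context adapted_lift
begin

text \<open>\<open>lam - 1\<close> times a distance is at most its increase in one step, and the
  increases telescope. So orbit segments with close ends are close in total, whatever their
  length.\<close>

lemma expand_sum:
  "(lam - 1) * (\<Sum>i<n. \<bar>H ((F ^^ i) x) - H ((F ^^ i) y)\<bar>) \<le> \<bar>H ((F ^^ n) x) - H ((F ^^ n) y)\<bar>"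
proof (induction n)
  case (Suc n)
  have "lam * \<bar>H ((F ^^ n) x) - H ((F ^^ n) y)\<bar> \<le> \<bar>H ((F ^^ Suc n) x) - H ((F ^^ Suc n) y)\<bar>"
    using expand by simp
  then show ?case using Suc by (simp add: algebra_simps)
qed simp

lemma closing_segment:
  assumes n: "n \<ge> 1"
  shows "\<exists>q l a. (F ^^ n) q = q + of_int l \<and>
    (lam - 1) * (\<Sum>t<n. \<bar>H ((F ^^ t) q) - H ((F ^^ t) x + of_int (a t))\<bar>)
      \<le> \<bar>H ((F ^^ n) x + of_int k) - H x\<bar>"
proof -
  define y where "y t = (if t < n then (F ^^ t) x else x)" for t
  define j where "j t = (if Suc t = n then k else 0)" for t
  define e where "e t = (if Suc t = n then \<bar>H ((F ^^ n) x + of_int k) - H x\<bar> else 0)" for t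
  have "\<bar>H (F (y t) + of_int (j t)) - H (y (Suc t))\<bar> \<le> e t" if "t < n" for t
    using that by (cases "Suc t = n") (auto simp: y_def j_def e_def)
  note jump = this
  have "y n = y 0" using n by (simp add: y_def)
  from closing[of n y j e, OF n this jump]
  obtain q l a where q: "(F ^^ n) q = q + of_int l" and
    le: "(lam - 1) * (\<Sum>t<n. \<bar>H ((F ^^ t) q) - H (y t + of_int (a t))\<bar>) \<le> (\<Sum>t<n. e t)"
    by blast
  obtain m where m: "n = Suc m" using n by (cases n) auto
  have "(\<Sum>t<m. e t) = 0" unfolding e_def by (rule sum.neutral) (simp add: m)
  then have "(\<Sum>t<n. e t) = \<bar>H ((F ^^ n) x + of_int k) - H x\<bar>"
    unfolding m sum.lessThan_Suc by (simp add: e_def m)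
  moreover have "(\<Sum>t<n. \<bar>H ((F ^^ t) q) - H (y t + of_int (a t))\<bar>)
      = (\<Sum>t<n. \<bar>H ((F ^^ t) q) - H ((F ^^ t) x + of_int (a t))\<bar>)"
    by (intro sum.cong) (auto simp: y_def)
  ultimately have "(lam - 1) * (\<Sum>t<n. \<bar>H ((F ^^ t) q) - H ((F ^^ t) x + of_int (a t))\<bar>)
      \<le> \<bar>H ((F ^^ n) x + of_int k) - H x\<bar>"
    using le by simp
  then show ?thesis using q by blast
qed

lemma periodic_iter_mult:
  fixes g :: "real \<Rightarrow> real"
  assumes "\<And>x. g (x + 1) = g x" and "(F ^^ n) q = q + of_int l"
  shows "g ((F ^^ (i + n)) q) = g ((F ^^ i) q)"
proof -
  have "(F ^^ (i + n)) q = (F ^^ i) q + of_int (d ^ i * l)"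
    unfolding funpow_add o_apply assms(2) by (rule Fn_int)
  then show ?thesis by (simp only: periodic_of_int[of g, OF assms(1)])
qed

lemma periodic_sum_shift:
  fixes g :: "real \<Rightarrow> real"
  assumes g: "\<And>x. g (x + 1) = g x" and q: "(F ^^ n) q = q + of_int l"
  shows "(\<Sum>j<n. g ((F ^^ (i + j)) q)) = (\<Sum>j<n. g ((F ^^ j) q))"
proof (induction i)
  case (Suc i)
  have "(\<Sum>j<n. g ((F ^^ (Suc i + j)) q)) = (\<Sum>j<n. g ((F ^^ (i + Suc j)) q))" by simp
  also have "\<dots> = (\<Sum>j<n. g ((F ^^ (i + j)) q))"
    using sum_shift_periodic[of "\<lambda>j. g ((F ^^ (i + j)) q)" n]
      periodic_iter_mult[of g n q l i, OF g q] by simp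
  finally show ?case using Suc by simp
qed simp

end

locale adapted_potential = adapted_lift +
  fixes \<phi> :: "real \<Rightarrow> real" and M L :: real
  assumes \<phi>_per: "\<phi> (x + 1) = \<phi> x"
    and \<phi>_lip: "\<bar>\<phi> x - \<phi> y\<bar> \<le> M * \<bar>H x - H y\<bar>"
    and F_lip: "\<bar>H (F x) - H (F y)\<bar> \<le> L * \<bar>H x - H y\<bar>"
begin

lemma H_pos: "\<bar>H 1 - H 0\<bar> > 0" using H_lower[of 1 0] by linarith

lemma M_nonneg: "M \<ge> 0"
  using \<phi>_lip[of 1 0] H_pos by (smt (verit) mult_neg_pos)

lemma L_nonneg: "L \<ge> 0"
  using F_lip[of 1 0] H_pos by (smt (verit) mult_neg_pos)

definition bsum :: "nat \<Rightarrow> real \<Rightarrow> real" where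
  "bsum n x = (\<Sum>i<n. \<phi> ((F ^^ i) x))"

definition per_means :: "real set" where
  "per_means = {bsum n q / real n | n q. n \<ge> 1 \<and> (\<exists>l::int. (F ^^ n) q = q + of_int l)}"

definition \<alpha> :: real where "\<alpha> = Inf per_means"

lemma \<phi>_ge: "\<phi> x \<ge> \<phi> 0 - M * W"
proof -
  have "\<phi> x = \<phi> (frac x)"
    by (rule periodic_frac[of \<phi>, OF \<phi>_per, symmetric])
  moreover have "\<bar>\<phi> (frac x) - \<phi> 0\<bar> \<le> M * W"
  proof -
    have "\<bar>H (frac x) - H 0\<bar> \<le> W * \<bar>frac x - 0\<bar>" by (rule H_upper)
    also have "\<dots> \<le> W * 1" using W_ge_1 frac_lt_1[of x] frac_ge_0[of x]
      by (intro mult_left_mono) auto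
    finally have "M * \<bar>H (frac x) - H 0\<bar> \<le> M * W" using M_nonneg by (simp add: mult_left_mono)
    then show ?thesis using \<phi>_lip[of "frac x" 0] by linarith
  qed
  ultimately show ?thesis by linarith
qed

lemma per_means_nonempty: "per_means \<noteq> {}"
  using periodic_point_exists[of 1 0] unfolding per_means_def by fastforce

lemma per_means_bdd: "bdd_below per_means"
proof (rule bdd_belowI)
  fix v assume "v \<in> per_means"
  then obtain n q where nq: "n \<ge> 1" "v = bsum n q / real n" unfolding per_means_def by auto
  have "real n * (\<phi> 0 - M * W) \<le> bsum n q"
    unfolding bsum_def using sum_mono[of "{..<n}" "\<lambda>_. \<phi> 0 - M * W" "\<lambda>i. \<phi> ((F ^^ i) q)"] \<phi>_ge by simp
  then show "\<phi> 0 - M * W \<le> v" using nq by (simp add: pos_le_divide_eq mult.commute)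
qed

lemma bsum_periodic_ge:
  assumes "(F ^^ n) q = q + of_int l"
  shows "bsum n q \<ge> real n * \<alpha>"
proof (cases "n = 0")
  case False
  then have "bsum n q / real n \<in> per_means" unfolding per_means_def using assms by force
  then have "\<alpha> \<le> bsum n q / real n" unfolding \<alpha>_def using per_means_bdd by (rule cInf_lower)
  then show ?thesis using False by (simp add: field_simps)
qed (simp add: bsum_def)

definition K :: real where "K = M * W / (lam - 1)"

text \<open>Closing the segment takes a jump of Euclidean length at most 1 and costs at most
  \<open>K\<close>, whatever \<open>n\<close> is; the periodic orbit obtained has average at least
  \<open>\<alpha>\<close>.\<close>

lemma bsum_ge: "bsum n x \<ge> real n * \<alpha> - K"
proof (cases "n = 0")
  case True
  then show ?thesis using M_nonneg W_ge_1 lam by (simp add: bsum_def K_def)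
next
  case False
  define k where "k = - \<lfloor>(F ^^ n) x - x\<rfloor>"
  obtain q l a where q: "(F ^^ n) q = q + of_int l" and
    le: "(lam - 1) * (\<Sum>t<n. \<bar>H ((F ^^ t) q) - H ((F ^^ t) x + of_int (a t))\<bar>)
      \<le> \<bar>H ((F ^^ n) x + of_int k) - H x\<bar>"
    using closing_segment[of n x k] False by auto
  have "\<bar>(F ^^ n) x + of_int k - x\<bar> \<le> 1" unfolding k_def by linarith
  then have "\<bar>H ((F ^^ n) x + of_int k) - H x\<bar> \<le> W"
    using H_upper[of "(F ^^ n) x + of_int k" x] W_ge_1
    by (smt (verit) mult_left_le)
  with le have S: "(\<Sum>t<n. \<bar>H ((F ^^ t) q) - H ((F ^^ t) x + of_int (a t))\<bar>) \<le> W / (lam - 1)"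
    using lam by (simp add: field_simps)
  have "bsum n q - bsum n x = (\<Sum>t<n. \<phi> ((F ^^ t) q) - \<phi> ((F ^^ t) x + of_int (a t)))"
    by (simp add: bsum_def sum_subtractf periodic_of_int[of \<phi>, OF \<phi>_per])
  also have "\<dots> \<le> (\<Sum>t<n. M * \<bar>H ((F ^^ t) q) - H ((F ^^ t) x + of_int (a t))\<bar>)"
    by (intro sum_mono order_trans[OF abs_ge_self \<phi>_lip])
  also have "\<dots> \<le> M * (W / (lam - 1))"
    unfolding sum_distrib_left[symmetric] by (intro mult_left_mono S M_nonneg)
  finally show ?thesis using bsum_periodic_ge[OF q] unfolding K_def by simp
qed

text \<open>Landing on any integer translate of \<open>x\<close> lets all preimages on the circle
  compete, which makes \<open>u\<close> periodic. One more step turns a backward orbit of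
  \<open>x\<close> into one of \<open>F x\<close>; this is the reason for
  \<open>u_sub\<close>.\<close>

definition backward_sums :: "real \<Rightarrow> real set" where
  "backward_sums x = {bsum n y - real n * \<alpha> | n y. \<exists>m::int. (F ^^ n) y = x + of_int m}"

definition u :: "real \<Rightarrow> real" where "u x = Inf (backward_sums x)"

lemma backward_sums_nonempty: "backward_sums x \<noteq> {}"
proof -
  have "bsum 0 x - real 0 * \<alpha> \<in> backward_sums x" unfolding backward_sums_def
    by (rule CollectI, rule exI[of _ 0], rule exI[of _ x]) (auto intro: exI[of _ 0])
  then show ?thesis by blast
qed

lemma backward_sums_bdd: "bdd_below (backward_sums x)"
proof (rule bdd_belowI[of _ "- K"])
  fix v assume "v \<in> backward_sums x"
  then obtain n y where "v = bsum n y - real n * \<alpha>" unfolding backward_sums_def by blast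
  then show "- K \<le> v" using bsum_ge[of n y] by linarith
qed

lemma u_per: "u (x + 1) = u x"
proof -
  have "(\<exists>m::int. z = x + 1 + of_int m) \<longleftrightarrow> (\<exists>m::int. z = x + of_int m)" for z
  proof
    assume "\<exists>m::int. z = x + 1 + of_int m"
    then obtain m :: int where "z = x + 1 + of_int m" by blast
    then have "z = x + of_int (m + 1)" by simp
    then show "\<exists>m::int. z = x + of_int m" by blast
  next
    assume "\<exists>m::int. z = x + of_int m"
    then obtain m :: int where "z = x + of_int m" by blast
    then have "z = x + 1 + of_int (m - 1)" by simp
    then show "\<exists>m::int. z = x + 1 + of_int m" by blast
  qed
  then show ?thesis unfolding u_def backward_sums_def by simp
qed

text \<open>A backward orbit of \<open>x\<close> is matched with the one of \<open>x'\<close> on the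
  same inverse branch. By \<open>expand_sum\<close> their total distance is at most the distance of
  the endpoints divided by \<open>lam - 1\<close>, for every length.\<close>

lemma u_lip1: "u x' \<le> u x + M / (lam - 1) * \<bar>H x - H x'\<bar>"
proof -
  have "u x' - M / (lam - 1) * \<bar>H x - H x'\<bar> \<le> v" if vin: "v \<in> backward_sums x" for v
  proof -
    obtain n y m where v: "v = bsum n y - real n * \<alpha>" and y: "(F ^^ n) y = x + of_int m"
      using vin unfolding backward_sums_def by blast
    obtain y' where y': "(F ^^ n) y' = x' + of_int m" using Fn_surj by blast
    have "(lam - 1) * (\<Sum>i<n. \<bar>H ((F ^^ i) y') - H ((F ^^ i) y)\<bar>) \<le> \<bar>H x - H x'\<bar>"
      using expand_sum[where n = n and x = y' and y = y] by (simp add: y y' H_int abs_minus_commute)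
    then have S: "(\<Sum>i<n. \<bar>H ((F ^^ i) y') - H ((F ^^ i) y)\<bar>) \<le> \<bar>H x - H x'\<bar> / (lam - 1)"
      using lam by (simp add: field_simps)
    have "bsum n y' - bsum n y = (\<Sum>i<n. \<phi> ((F ^^ i) y') - \<phi> ((F ^^ i) y))"
      by (simp add: bsum_def sum_subtractf)
    also have "\<dots> \<le> (\<Sum>i<n. M * \<bar>H ((F ^^ i) y') - H ((F ^^ i) y)\<bar>)"
      by (intro sum_mono order_trans[OF abs_ge_self \<phi>_lip])
    also have "\<dots> \<le> M * (\<bar>H x - H x'\<bar> / (lam - 1))"
      unfolding sum_distrib_left[symmetric] by (intro mult_left_mono S M_nonneg)
    finally have "bsum n y' - real n * \<alpha> \<le> v + M / (lam - 1) * \<bar>H x - H x'\<bar>" by (simp add: v)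
    moreover have "u x' \<le> bsum n y' - real n * \<alpha>"
      unfolding u_def by (rule cInf_lower[OF _ backward_sums_bdd])
        (use y' in \<open>auto simp: backward_sums_def\<close>)
    ultimately show ?thesis by linarith
  qed
  then have "u x' - M / (lam - 1) * \<bar>H x - H x'\<bar> \<le> u x"
    unfolding u_def[of x] by (intro cInf_greatest backward_sums_nonempty)
  then show ?thesis by linarith
qed

lemma u_lip: "\<bar>u x - u y\<bar> \<le> M / (lam - 1) * \<bar>H x - H y\<bar>"
  using u_lip1[of x y] u_lip1[of y x] by (simp add: abs_minus_commute abs_le_iff)

lemma u_sub: "u (F x) \<le> u x + \<phi> x - \<alpha>"
proof -
  have "u (F x) - \<phi> x + \<alpha> \<le> v" if vin: "v \<in> backward_sums x" for v
  proof -
    obtain n y m where v: "v = bsum n y - real n * \<alpha>" and y: "(F ^^ n) y = x + of_int m"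
      using vin unfolding backward_sums_def by blast
    have "(F ^^ Suc n) y = F x + of_int (d * m)" using y F_int by simp
    then have "bsum (Suc n) y - real (Suc n) * \<alpha> \<in> backward_sums (F x)"
      unfolding backward_sums_def by blast
    then have "u (F x) \<le> bsum (Suc n) y - real (Suc n) * \<alpha>"
      unfolding u_def by (rule cInf_lower[OF _ backward_sums_bdd])
    also have "bsum (Suc n) y = bsum n y + \<phi> x"
      by (simp add: bsum_def y periodic_of_int[of \<phi>, OF \<phi>_per])
    finally show ?thesis by (simp add: v algebra_simps)
  qed
  then have "u (F x) - \<phi> x + \<alpha> \<le> u x"
    unfolding u_def[of x] by (intro cInf_greatest backward_sums_nonempty)
  then show ?thesis by linarith
qed

definition fbar :: "real \<Rightarrow> real" where "fbar x = \<phi> x - \<alpha> - u (F x) + u x"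

lemma fbar_nonneg: "fbar x \<ge> 0"
  using u_sub[of x] by (simp add: fbar_def)

lemma fbar_per: "fbar (x + 1) = fbar x"
  using periodic_of_int[of u "F x" d, OF u_per] by (simp add: fbar_def \<phi>_per u_per per)

definition M0 :: real where "M0 = M + M / (lam - 1) * L + M / (lam - 1)"

lemma fbar_lip: "\<bar>fbar x - fbar y\<bar> \<le> M0 * \<bar>H x - H y\<bar>"
proof -
  have "\<bar>u (F x) - u (F y)\<bar> \<le> M / (lam - 1) * (L * \<bar>H x - H y\<bar>)"
    using M_nonneg lam by (intro order_trans[OF u_lip] mult_left_mono F_lip) simp
  moreover have "M0 * h = M * h + M / (lam - 1) * (L * h) + M / (lam - 1) * h" for h
    unfolding M0_def by (simp add: distrib_right)
  ultimately show ?thesis using \<phi>_lip[of x y] u_lip[of x y]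
    unfolding fbar_def by (smt (verit))
qed

lemma M0_nonneg: "M0 \<ge> 0"
  using M_nonneg L_nonneg lam unfolding M0_def by simp

lemma fbar_cont: "continuous_on UNIV fbar"
proof -
  have "(M0 * W)-lipschitz_on UNIV fbar"
  proof (rule lipschitz_onI)
    show "dist (fbar x) (fbar y) \<le> M0 * W * dist x y" for x y
      using fbar_lip[of x y] mult_left_mono[OF H_upper[of x y] M0_nonneg]
      by (simp add: dist_real_def mult.assoc)
  qed (use M0_nonneg W_ge_1 in simp)
  then show ?thesis by (rule lipschitz_on_continuous_on)
qed

lemma fbar_bsum: "(\<Sum>i<n. fbar ((F ^^ i) x)) = bsum n x - real n * \<alpha> - u ((F ^^ n) x) + u x"
  by (induction n) (simp_all add: bsum_def fbar_def algebra_simps)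

lemma fbar_periodic_sum:
  assumes "(F ^^ n) q = q + of_int l"
  shows "(\<Sum>i<n. fbar ((F ^^ i) q)) = bsum n q - real n * \<alpha>"
  by (simp add: fbar_bsum assms periodic_of_int[of u, OF u_per])

definition Z :: "real set" where "Z = {x. \<forall>i. fbar ((F ^^ i) x) = 0}"

lemma Z_per: "x \<in> Z \<Longrightarrow> x + of_int k \<in> Z"
  unfolding Z_def by (simp only: Fn_int periodic_of_int[of fbar, OF fbar_per] mem_Collect_eq) simp

lemma Z_forward: "x \<in> Z \<Longrightarrow> F x \<in> Z"
proof -
  assume x: "x \<in> Z"
  have "(F ^^ i) (F x) = (F ^^ Suc i) x" for i
    by (simp only: funpow_Suc_right o_apply)
  then show ?thesis using x unfolding Z_def by (simp del: funpow.simps)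
qed

text \<open>If no orbit stayed in the zero set of \<open>fbar\<close>, compactness would give a time
  \<open>n\<close> within which every orbit collects at least a fixed \<open>e > 0\<close>. Every
  periodic average would then exceed \<open>\<alpha>\<close> by \<open>e / n\<close>, although
  \<open>\<alpha>\<close> is their infimum.\<close>

lemma Z_nonempty: "Z \<noteq> {}"
proof (rule ccontr)
  assume empty: "\<not> Z \<noteq> {}"
  define g where "g n x = (\<Sum>i<n. fbar ((F ^^ i) x))" for n x
  have gcont: "continuous_on A (g n)" for n A
    unfolding g_def using continuous_on_subset[OF continuous_on_compose2[OF fbar_cont Fn_cont]]
    by (intro continuous_intros) auto
  have gper: "g n (x + 1) = g n x" for n x
  proof -
    have "fbar ((F ^^ i) (x + 1)) = fbar ((F ^^ i) x)" for i
      using Fn_int[of i x 1] periodic_of_int[of fbar "(F ^^ i) x" "d ^ i", OF fbar_per] by simp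
    then show ?thesis unfolding g_def by simp
  qed
  define C where "C n = {x \<in> {0..1}. g n x \<le> 0}" for n
  have "\<exists>n. C n = {}"
  proof (rule ccontr)
    assume ne: "\<nexists>n. C n = {}"
    have "(\<Inter>n. C n) \<noteq> {}"
    proof (rule compact_nest)
      show "compact (C n)" for n
      proof -
        have "C n = {0..1} \<inter> g n -` {..0}" unfolding C_def by auto
        then have "closed (C n)"
          using continuous_closed_preimage[OF gcont[of "{0..1}" n], of "{..0}"] by simp
        moreover have "bounded (C n)" unfolding C_def
          by (rule bounded_subset[of "{0..1::real}"]) auto
        ultimately show ?thesis by (simp add: compact_eq_bounded_closed)
      qed
      show "C n \<noteq> {}" for n using ne by blast
      show "C n \<subseteq> C m" if "m \<le> n" for m n
      proof -
        have "g m x \<le> g n x" for x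
          unfolding g_def using that fbar_nonneg by (intro sum_mono2) auto
        then show ?thesis unfolding C_def by (auto intro: order_trans)
      qed
    qed
    then obtain x where x: "\<And>n. g n x \<le> 0" unfolding C_def by auto
    have "fbar ((F ^^ i) x) = 0" for i
    proof -
      have "g (Suc i) x = g i x + fbar ((F ^^ i) x)" by (simp add: g_def)
      moreover have "g i x \<ge> 0" unfolding g_def by (simp add: sum_nonneg fbar_nonneg)
      ultimately show ?thesis using x[of "Suc i"] fbar_nonneg[of "(F ^^ i) x"] by linarith
    qed
    then show False using empty unfolding Z_def by blast
  qed
  then obtain n where n: "C n = {}" by blast
  then have "n \<noteq> 0" unfolding C_def g_def by (cases n) auto
  obtain x0 where x0: "x0 \<in> {0..1}" and min: "\<And>x. x \<in> {0..1} \<Longrightarrow> g n x0 \<le> g n x"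
    using continuous_attains_inf[of "{0..1::real}" "g n"] gcont by fastforce
  define e where "e = g n x0"
  have e: "e > 0" using n x0 unfolding C_def e_def by fastforce
  have ge: "e \<le> g n x" for x
  proof -
    have "g n x = g n (frac x)"
      by (rule periodic_frac[of "g n", OF gper, symmetric])
    then show ?thesis using min[of "frac x"] frac_lt_1[of x] frac_ge_0[of x]
      unfolding e_def by (simp add: less_imp_le)
  qed
  have "\<alpha> + e / real n \<le> v" if vin: "v \<in> per_means" for v
  proof -
    obtain p q l where p: "p \<ge> 1" "v = bsum p q / real p" and q: "(F ^^ p) q = q + of_int l"
      using vin unfolding per_means_def by blast
    \<comment> \<open>Summed over a period, \<open>g n\<close> counts each value of
      \<open>fbar\<close> along the orbit exactly \<open>n\<close> times.\<close>
    have "real p * e \<le> (\<Sum>j<p. g n ((F ^^ j) q))"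
      using sum_mono[of "{..<p}" "\<lambda>_. e" "\<lambda>j. g n ((F ^^ j) q)"] ge by simp
    also have "\<dots> = (\<Sum>j<p. \<Sum>i<n. fbar ((F ^^ (i + j)) q))"
      unfolding g_def by (simp add: funpow_add)
    also have "\<dots> = (\<Sum>i<n. \<Sum>j<p. fbar ((F ^^ (i + j)) q))" by (rule sum.swap)
    also have "\<dots> = (\<Sum>i<n. \<Sum>j<p. fbar ((F ^^ j) q))"
      using periodic_sum_shift[of fbar, OF fbar_per q] by simp
    also have "\<dots> = real n * (bsum p q - real p * \<alpha>)" using fbar_periodic_sum[OF q] by simp
    finally have "real p * e \<le> real n * (bsum p q - real p * \<alpha>)" .
    moreover have "bsum p q = real p * v" using p by simp
    ultimately have "real p * e \<le> real p * (real n * (v - \<alpha>))" by (simp add: algebra_simps)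
    then have "e \<le> real n * (v - \<alpha>)" using p by (simp add: mult_le_cancel_left)
    then show ?thesis using \<open>n \<noteq> 0\<close> by (simp add: field_simps)
  qed
  then have "\<alpha> + e / real n \<le> \<alpha>"
    unfolding \<alpha>_def[symmetric] using cInf_greatest[OF per_means_nonempty, of "\<alpha> + e / real n"]
    by (simp add: \<alpha>_def)
  then show False using e \<open>n \<noteq> 0\<close> by (simp add: field_simps)
qed

end

section \<open>Periodic orbits close to an invariant set\<close>

lemma path_relpowp:
  assumes path: "\<And>i. Suc i < length xs \<Longrightarrow> E (xs ! i) (xs ! Suc i)"
    and "i \<le> j" "j < length xs"
  shows "(E ^^ (j - i)) (xs ! i) (xs ! j)"
  unfolding relpowp_fun_conv
  by (rule exI[of _ "\<lambda>t. xs ! (i + t)"]) (use assms in auto)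

lemma path_distinct:
  assumes path: "\<And>i. Suc i < length xs \<Longrightarrow> E (xs ! i) (xs ! Suc i)"
    and acyc: "\<And>l a. 1 \<le> l \<Longrightarrow> l \<le> 2 * length xs \<Longrightarrow> \<not> (E ^^ l) a a"
  shows "distinct xs"
proof -
  have "xs ! i \<noteq> xs ! j" if ij: "i < j" "j < length xs" for i j
  proof
    assume "xs ! i = xs ! j"
    then have "(E ^^ (j - i)) (xs ! j) (xs ! j)" using path_relpowp[of xs E i j, OF path] ij by auto
    moreover have "1 \<le> j - i" "j - i \<le> 2 * length xs" using ij by auto
    ultimately show False using acyc by blast
  qed
  then show ?thesis unfolding distinct_conv_nth by (metis linorder_neqE_nat)
qed

text \<open>Two paths visiting the same vertices in different orders would concatenate to a short cycle.\<close>

lemma path_determined_by_set: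
  assumes xs: "\<And>i. Suc i < length xs \<Longrightarrow> E (xs ! i) (xs ! Suc i)" and lx: "length xs = n"
    and ys: "\<And>i. Suc i < length ys \<Longrightarrow> E (ys ! i) (ys ! Suc i)" and ly: "length ys = n"
    and acyc: "\<And>l a. 1 \<le> l \<Longrightarrow> l \<le> 2 * n \<Longrightarrow> \<not> (E ^^ l) a a"
    and set: "set xs = set ys"
  shows "xs = ys"
proof (rule ccontr)
  assume "xs \<noteq> ys"
  then have "\<exists>i. i < n \<and> xs ! i \<noteq> ys ! i" using lx ly by (auto simp: list_eq_iff_nth_eq)
  define i where "i = (LEAST i. i < n \<and> xs ! i \<noteq> ys ! i)"
  have i: "i < n" "xs ! i \<noteq> ys ! i"
    using LeastI_ex[OF \<open>\<exists>i. i < n \<and> xs ! i \<noteq> ys ! i\<close>] unfolding i_def by auto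
  have below: "xs ! t = ys ! t" if "t < i" for t
    using not_less_Least[of t "\<lambda>i. i < n \<and> xs ! i \<noteq> ys ! i"] that i(1) unfolding i_def by auto
  have dx: "distinct xs" using path_distinct[of xs E, OF xs] acyc lx by blast
  have dy: "distinct ys" using path_distinct[of ys E, OF ys] acyc ly by blast
  have "xs ! i \<in> set ys" using i(1) lx set nth_mem by metis
  then obtain j where j: "j < n" "ys ! j = xs ! i" using ly by (metis in_set_conv_nth)
  have "ys ! i \<in> set xs" using i(1) ly set nth_mem by metis
  then obtain j' where j': "j' < n" "xs ! j' = ys ! i" using lx by (metis in_set_conv_nth)
  \<comment> \<open>The paths agree before \<open>i\<close> and have no repetitions, so the vertex
    of each at \<open>i\<close> occurs in the other only after \<open>i\<close>. The two segments
    found in this way run in opposite directions between the same vertices.\<close>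
  have "i < j"
  proof (rule ccontr)
    assume "\<not> i < j"
    then have "j < i" using i j by (cases "j = i") auto
    then have "xs ! j = xs ! i" using below j by simp
    then show False using dx \<open>j < i\<close> i(1) lx by (simp add: nth_eq_iff_index_eq)
  qed
  have "i < j'"
  proof (rule ccontr)
    assume "\<not> i < j'"
    then have "j' < i" using i j' by (cases "j' = i") auto
    then have "ys ! j' = ys ! i" using below j' by simp
    then show False using dy \<open>j' < i\<close> i(1) ly by (simp add: nth_eq_iff_index_eq)
  qed
  have "(E ^^ (j - i)) (ys ! i) (xs ! i)"
    using path_relpowp[of ys E i j, OF ys] j \<open>i < j\<close> ly by simp
  moreover have "(E ^^ (j' - i)) (xs ! i) (ys ! i)"
    using path_relpowp[of xs E i j', OF xs] j' \<open>i < j'\<close> lx by simp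
  ultimately have "(E ^^ ((j - i) + (j' - i))) (ys ! i) (ys ! i)"
    by (auto simp: relpowp_add)
  then show False using acyc[of "(j - i) + (j' - i)" "ys ! i"] \<open>i < j\<close> j j' by linarith
qed

text \<open>Paths are determined by their vertex sets, so there are at most
  \<open>card V choose n\<close> of them. The factor \<open>fact n\<close> gained over the trivial
  count is what contradicts the entropy bound later.\<close>

lemma path_count:
  assumes fin: "finite V" and P: "\<And>xs. xs \<in> P \<Longrightarrow> set xs \<subseteq> V \<and> length xs = n"
    and path: "\<And>xs i. xs \<in> P \<Longrightarrow> Suc i < length xs \<Longrightarrow> E (xs ! i) (xs ! Suc i)"
    and acyc: "\<And>l a. 1 \<le> l \<Longrightarrow> l \<le> 2 * n \<Longrightarrow> \<not> (E ^^ l) a a"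
  shows "card P * fact n \<le> card V ^ n"
proof -
  have "inj_on set P"
  proof (rule inj_onI)
    fix xs ys assume *: "xs \<in> P" "ys \<in> P" "set xs = set ys"
    show "xs = ys"
      by (rule path_determined_by_set[of xs E n ys]) (use * P path acyc in auto)
  qed
  then have "card P = card (set ` P)" by (simp add: card_image)
  also have "\<dots> \<le> card {B. B \<subseteq> V \<and> card B = n}"
  proof (rule card_mono)
    show "finite {B. B \<subseteq> V \<and> card B = n}" using fin by simp
    show "set ` P \<subseteq> {B. B \<subseteq> V \<and> card B = n}"
    proof
      fix B assume "B \<in> set ` P"
      then obtain xs where xs: "xs \<in> P" "B = set xs" by auto
      have "distinct xs" by (rule path_distinct[of xs E]) (use xs P path acyc in auto)
      then show "B \<in> {B. B \<subseteq> V \<and> card B = n}" using P xs by (auto simp: distinct_card)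
    qed
  qed
  also have "\<dots> = card V choose n" using n_subsets[OF fin] by simp
  finally have "card P * fact n \<le> (card V choose n) * fact n" by simp
  also have "\<dots> \<le> card V ^ n"
    using binomial_fact_pow[of "card V" n] by simp
  finally show ?thesis .
qed

lemma pow_le_fact_exp: "real n ^ n \<le> fact n * exp (real n)"
proof -
  have "real n ^ n / fact n \<le> exp (real n)"
    using exp_ge_one_plus_x_over_n_power_n
      sum_le_suminf[OF summable_exp_generic[of "real n"], of "{n}"]
    by (auto simp: exp_def divide_inverse mult.commute)
  then show ?thesis by (simp add: field_simps)
qed

lemma poly_times_exp_decay:
  fixes a c0 :: real
  assumes "a > 0" "c0 > 0"
  shows "\<exists>m1::nat. \<forall>m\<ge>m1. real m ^ k * exp (- (a * real m)) \<le> c0"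
proof -
  have "filterlim (\<lambda>m::nat. a * real m) at_top sequentially"
    using assms by (intro filterlim_tendsto_pos_mult_at_top[OF tendsto_const] filterlim_real_sequentially) auto
  then have "((\<lambda>m::nat. (a * real m) ^ k / exp (a * real m)) \<longlongrightarrow> 0) sequentially"
    by (rule filterlim_compose[OF tendsto_power_div_exp_0])
  then have "\<forall>\<^sub>F m in sequentially. (a * real m) ^ k / exp (a * real m) < c0 * a ^ k"
    using assms by (intro order_tendstoD) auto
  then obtain m1 where m1: "\<And>m. m \<ge> m1 \<Longrightarrow> (a * real m) ^ k / exp (a * real m) < c0 * a ^ k"
    unfolding eventually_sequentially by auto
  have "real m ^ k * exp (- (a * real m)) \<le> c0" if "m \<ge> m1" for m
  proof -
    have "a ^ k * (real m ^ k * exp (- (a * real m))) < a ^ k * c0"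
      using m1[OF that] by (simp add: power_mult_distrib exp_minus divide_inverse mult_ac)
    then show ?thesis using assms by simp
  qed
  then show ?thesis by blast
qed

lemma circ_map_iter:
  assumes "\<And>x. F (x + 1) = F x + of_int d"
  shows "(circ_map F ^^ n) (frac x) = frac ((F ^^ n) x)"
proof (induction n)
  case (Suc n)
  have "frac (F (frac y)) = frac (F y)" for y
  proof -
    have "F y = F (frac y) + of_int (\<lfloor>y\<rfloor> * d)"
      using shift_of_int[of F "of_int d" "frac y" "\<lfloor>y\<rfloor>", OF assms] by (simp add: frac_def)
    then show ?thesis by (simp only: frac_add_of_int_right) 
  qed
  then show ?case using Suc by (simp add: circ_map_def)
qed simp

section \<open>Closing lemmas relative to an invariant set\<close>

locale adapted_set = adapted_lift +
  fixes A :: "real set"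
  assumes A_per: "x \<in> A \<Longrightarrow> x + of_int k \<in> A"
    and A_forward: "x \<in> A \<Longrightarrow> F x \<in> A"
    and A_nonempty: "A \<noteq> {}"
begin

definition DA :: "real \<Rightarrow> real" where "DA x = infdist (H x) (H ` A)"

lemma DA_nonneg: "DA x \<ge> 0" by (simp add: DA_def infdist_nonneg)

lemma DA_in: "x \<in> A \<Longrightarrow> DA x = 0" by (simp add: DA_def)

lemma DA_lip: "DA x \<le> DA y + \<bar>H x - H y\<bar>"
  unfolding DA_def using infdist_triangle[of "H x" "H ` A" "H y"] by (simp add: dist_real_def)

lemma DA_int: "DA (x + of_int k) = DA x"
proof -
  have le: "DA (x + of_int k) \<le> DA x" for x k
  proof -
    have "DA (x + of_int k) \<le> dist (H x) b" if b: "b \<in> H ` A" for b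
    proof -
      obtain a where a: "a \<in> A" "b = H a" using b by auto
      have "DA (x + of_int k) \<le> dist (H (x + of_int k)) (H (a + of_int k))"
        unfolding DA_def using A_per[OF a(1)] by (intro infdist_le) auto
      then show ?thesis by (simp add: a H_int dist_real_def)
    qed
    then show ?thesis unfolding DA_def[of x] using A_nonempty
      by (auto simp: infdist_notempty intro!: cINF_greatest)
  qed
  show ?thesis using le[of x k] le[of "x + of_int k" "- k"] by simp
qed

lemma DA_per: "DA (x + 1) = DA x" using DA_int[of x 1] by simp

lemma closing_DA:
  fixes x :: "nat \<Rightarrow> real" and k :: "nat \<Rightarrow> int"
  assumes n: "n \<ge> 1" and xn: "x n = x 0"
    and jump: "\<And>t. t < n \<Longrightarrow> \<bar>H (F (x t) + of_int (k t)) - H (x (Suc t))\<bar> \<le> e t"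
  shows "\<exists>q l. (F ^^ n) q = q + of_int l \<and>
    (\<Sum>t<n. DA ((F ^^ t) q)) \<le> (\<Sum>t<n. DA (x t)) + (\<Sum>t<n. e t) / (lam - 1)"
proof -
  obtain q l a where q: "(F ^^ n) q = q + of_int l" and
    le: "(lam - 1) * (\<Sum>t<n. \<bar>H ((F ^^ t) q) - H (x t + of_int (a t))\<bar>) \<le> (\<Sum>t<n. e t)"
    using closing[of n x k e, OF assms] by blast
  have "(\<Sum>t<n. DA ((F ^^ t) q)) \<le> (\<Sum>t<n. DA (x t) + \<bar>H ((F ^^ t) q) - H (x t + of_int (a t))\<bar>)"
    by (intro sum_mono) (metis DA_lip DA_int)
  also have "\<dots> \<le> (\<Sum>t<n. DA (x t)) + (\<Sum>t<n. e t) / (lam - 1)"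
    using le lam by (simp add: sum.distrib field_simps)
  finally show ?thesis using q by blast
qed

lemma closing_segment_DA:
  assumes n: "n \<ge> 1"
  shows "\<exists>q l. (F ^^ n) q = q + of_int l \<and>
    (\<Sum>t<n. DA ((F ^^ t) q)) \<le> (\<Sum>t<n. DA ((F ^^ t) x)) + \<bar>H ((F ^^ n) x + of_int k) - H x\<bar> / (lam - 1)"
proof -
  obtain q l a where q: "(F ^^ n) q = q + of_int l" and
    le: "(lam - 1) * (\<Sum>t<n. \<bar>H ((F ^^ t) q) - H ((F ^^ t) x + of_int (a t))\<bar>)
      \<le> \<bar>H ((F ^^ n) x + of_int k) - H x\<bar>"
    using closing_segment[of n x k, OF assms] by blast
  have "(\<Sum>t<n. DA ((F ^^ t) q)) \<le> (\<Sum>t<n. DA ((F ^^ t) x) + \<bar>H ((F ^^ t) q) - H ((F ^^ t) x + of_int (a t))\<bar>)"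
    by (intro sum_mono) (metis DA_lip DA_int)
  also have "\<dots> \<le> (\<Sum>t<n. DA ((F ^^ t) x)) + \<bar>H ((F ^^ n) x + of_int k) - H x\<bar> / (lam - 1)"
    using le lam by (simp add: sum.distrib field_simps)
  finally show ?thesis using q by blast
qed

text \<open>Cutting at the times \<open>i\<close> and \<open>j\<close> leaves pieces of lengths
  \<open>j - i\<close> and \<open>N - (j - i)\<close>, one of which is at most half the period.
  Closing that piece takes a single jump, between the two points at which the orbit was cut.\<close>

lemma split_orbit:
  assumes q: "(F ^^ N) q = q + of_int l" and ij: "i < j" "j < N"
  shows "\<exists>n q' l'. 1 \<le> n \<and> 2 * n \<le> N \<and> (F ^^ n) q' = q' + of_int l' \<and>
    (\<Sum>t<n. DA ((F ^^ t) q')) \<le> (\<Sum>t<N. DA ((F ^^ t) q))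
       + \<bar>H ((F ^^ j) q + of_int k) - H ((F ^^ i) q)\<bar> / (lam - 1)"
proof -
  have part: "(\<Sum>t<n. DA ((F ^^ t) ((F ^^ s) q))) \<le> (\<Sum>t<N. DA ((F ^^ t) q))" if "n \<le> N" for n s
  proof -
    have "(\<Sum>t<n. DA ((F ^^ t) ((F ^^ s) q))) \<le> (\<Sum>t<N. DA ((F ^^ (s + t)) q))"
      using that by (simp add: add.commute[of s] funpow_add) (intro sum_mono2, auto simp: DA_nonneg)
    also have "\<dots> = (\<Sum>t<N. DA ((F ^^ t) q))" by (rule periodic_sum_shift[of DA, OF DA_per q])
    finally show ?thesis .
  qed
  show ?thesis
  proof (cases "2 * (j - i) \<le> N")
    case True
    define n where "n = j - i"
    have n1: "n \<ge> 1" using ij unfolding n_def by auto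
    have Fn: "(F ^^ n) ((F ^^ i) q) = (F ^^ j) q"
      using ij unfolding n_def by (simp add: funpow_add[symmetric, THEN fun_cong, unfolded o_apply])
    obtain q' l' where "(F ^^ n) q' = q' + of_int l'" and
      "(\<Sum>t<n. DA ((F ^^ t) q')) \<le> (\<Sum>t<n. DA ((F ^^ t) ((F ^^ i) q)))
        + \<bar>H ((F ^^ j) q + of_int k) - H ((F ^^ i) q)\<bar> / (lam - 1)"
      using closing_segment_DA[OF n1, of "(F ^^ i) q" k] unfolding Fn by blast
    moreover have "n \<le> N" "2 * n \<le> N" using True unfolding n_def by auto
    ultimately show ?thesis using part[of n i] n1
      by (intro exI[of _ n] exI[of _ q'] exI[of _ l']) linarith
  next
    case False
    define n where "n = N + i - j"
    have n1: "n \<ge> 1" "n \<le> N" "2 * n \<le> N" "n + j = i + N" using ij False unfolding n_def by auto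
    have "(F ^^ n) ((F ^^ j) q) = (F ^^ (n + j)) q" by (simp add: funpow_add)
    also have "\<dots> = (F ^^ i) (q + of_int l)" unfolding n1(4) by (simp add: funpow_add q)
    finally have Fn: "(F ^^ n) ((F ^^ j) q) = (F ^^ i) q + of_int (d ^ i * l)" by (simp only: Fn_int)
    \<comment> \<open>This piece runs past the end of the period and picks up the translation
      \<open>d ^ i * l\<close>, which \<open>k'\<close> undoes.\<close>
    define k' where "k' = - (d ^ i * l) - k"
    have "\<bar>H ((F ^^ n) ((F ^^ j) q) + of_int k') - H ((F ^^ j) q)\<bar> = \<bar>H ((F ^^ i) q + of_int (- k)) - H ((F ^^ j) q)\<bar>"
      unfolding Fn k'_def by (simp add: algebra_simps)
    also have "\<dots> = \<bar>H ((F ^^ j) q + of_int k) - H ((F ^^ i) q)\<bar>"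
      unfolding H_int by (simp add: algebra_simps)
    finally have eq: "\<bar>H ((F ^^ n) ((F ^^ j) q) + of_int k') - H ((F ^^ j) q)\<bar>
        = \<bar>H ((F ^^ j) q + of_int k) - H ((F ^^ i) q)\<bar>" .
    obtain q' l' where "(F ^^ n) q' = q' + of_int l'" and
      "(\<Sum>t<n. DA ((F ^^ t) q')) \<le> (\<Sum>t<n. DA ((F ^^ t) ((F ^^ j) q)))
        + \<bar>H ((F ^^ j) q + of_int k) - H ((F ^^ i) q)\<bar> / (lam - 1)"
      using closing_segment_DA[OF n1(1), of "(F ^^ j) q" k'] unfolding eq by blast
    then show ?thesis using part[of n j] n1
      by (intro exI[of _ n] exI[of _ q'] exI[of _ l']) linarith
  qed
qed

end

section \<open>Symbolic coding and word complexity of the set\<close>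

context adapted_set
begin

definition X :: "real set" where "X = A \<inter> {0..<1}"

abbreviation f :: "real \<Rightarrow> real" where "f \<equiv> circ_map F"

text \<open>The integer part of the lifted iterate tells on which inverse branch of the
  \<open>m\<close>-th iterate a point of the unit interval lies; it serves as the word of length
  \<open>m\<close> of that point.\<close>

definition code :: "nat \<Rightarrow> real \<Rightarrow> int" where "code m x = \<lfloor>(F ^^ m) x\<rfloor>"

lemma f_X: "x \<in> X \<Longrightarrow> f x \<in> X"
proof -
  assume "x \<in> X"
  then have "F x + of_int (- \<lfloor>F x\<rfloor>) \<in> A" by (intro A_per A_forward) (simp add: X_def)
  then have "f x \<in> A" by (simp add: circ_map_def frac_def)
  then show ?thesis by (simp add: X_def circ_map_def frac_lt_1)
qed

lemma fn_X: "x \<in> X \<Longrightarrow> (f ^^ n) x \<in> X"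
  by (induction n) (auto intro: f_X)

lemma X_nonempty: "X \<noteq> {}"
proof -
  obtain a where "a \<in> A" using A_nonempty by auto
  then have "frac a \<in> X"
    using A_per[of a "- \<lfloor>a\<rfloor>"] by (auto simp: X_def frac_lt_1) (simp add: frac_def)
  then show ?thesis by auto
qed

lemma fn_frac: "x \<in> X \<Longrightarrow> (f ^^ n) x = frac ((F ^^ n) x)"
proof -
  assume "x \<in> X"
  then have "frac x = x" by (auto simp: X_def frac_eq)
  then show ?thesis using circ_map_iter[of F d n x] per by simp
qed

text \<open>Concatenation of words as an expansion to base \<open>d\<close>: the integer part left
  by the first \<open>m\<close> steps is multiplied by \<open>d ^ n\<close> in the next
  \<open>n\<close> steps.\<close>

lemma code_add:
  assumes "x \<in> X"
  shows "code (m + n) x = d ^ n * code m x + code n ((f ^^ m) x)"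
proof -
  have "(F ^^ (m + n)) x = (F ^^ n) ((F ^^ m) x)" by (simp add: add.commute[of m] funpow_add)
  also have "(F ^^ m) x = (f ^^ m) x + of_int (code m x)"
    unfolding fn_frac[OF assms] code_def by (simp add: frac_def)
  also have "(F ^^ n) \<dots> = (F ^^ n) ((f ^^ m) x) + of_int (d ^ n * code m x)" by (rule Fn_int)
  finally show ?thesis unfolding code_def by linarith
qed

definition words :: "nat \<Rightarrow> int set" where "words m = code m ` X"

definition w :: "nat \<Rightarrow> nat" where "w m = card (words m)"

lemma words_finite: "finite (words m)"
proof -
  have "compact ((F ^^ m) ` {0..1})"
    by (intro compact_continuous_image continuous_on_subset[OF Fn_cont]) auto
  then obtain B where B: "\<And>x. x \<in> {0..1} \<Longrightarrow> \<bar>(F ^^ m) x\<bar> \<le> B"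
    using compact_imp_bounded bounded_iff by (metis imageI real_norm_def)
  have "words m \<subseteq> {\<lfloor>- B\<rfloor>..\<lceil>B\<rceil>}"
  proof
    fix v assume "v \<in> words m"
    then obtain x where "x \<in> X" "v = \<lfloor>(F ^^ m) x\<rfloor>" unfolding words_def code_def by blast
    then have "x \<in> {0..1}" "v = \<lfloor>(F ^^ m) x\<rfloor>" by (auto simp: X_def)
    then show "v \<in> {\<lfloor>- B\<rfloor>..\<lceil>B\<rceil>}" using B[of x] by (auto simp: abs_le_iff) linarith+
  qed
  then show ?thesis by (rule finite_subset) simp
qed

lemma w_pos: "w m \<ge> 1"
  unfolding w_def using words_finite X_nonempty by (simp add: words_def Suc_le_eq card_gt_0_iff)

lemma w_submult: "w (m + n) \<le> w m * w n"
proof -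
  have "words (m + n) \<subseteq> (\<lambda>(a, b). d ^ n * a + b) ` (words m \<times> words n)"
    unfolding words_def using code_add fn_X by force
  then have "card (words (m + n)) \<le> card ((\<lambda>(a, b). d ^ n * a + b) ` (words m \<times> words n))"
    by (intro card_mono finite_imageI finite_cartesian_product words_finite)
  also have "\<dots> \<le> card (words m \<times> words n)"
    by (intro card_image_le finite_cartesian_product words_finite)
  finally show ?thesis by (simp add: w_def card_cartesian_product)
qed

lemma w_power: "w (j * m) \<le> w m ^ j"
proof (induction j)
  case 0
  have "words 0 \<subseteq> {0}" unfolding words_def code_def X_def by (auto simp: floor_eq_iff)
  then have "w 0 \<le> 1" unfolding w_def using card_mono[of "{0::int}" "words 0"] by simp
  then show ?case by simp
next
  case (Suc j)
  have "w (Suc j * m) \<le> w m * w (j * m)" using w_submult[of m "j * m"] by simp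
  also have "\<dots> \<le> w m * w m ^ j" by (rule mult_le_mono2[OF Suc])
  finally show ?case by simp
qed

definition word :: "nat \<Rightarrow> nat \<Rightarrow> real \<Rightarrow> int list" where
  "word m n x = map (\<lambda>i. code m ((f ^^ (i * m)) x)) [0..<n]"

text \<open>An edge asks for one point of \<open>X\<close> that shows both words in succession. A
  path may thus change the point at every vertex, and a cycle of edges is only a
  pseudo-orbit.\<close>

definition edge :: "nat \<Rightarrow> int \<Rightarrow> int \<Rightarrow> bool" where
  "edge m a b \<longleftrightarrow> (\<exists>x\<in>X. code m x = a \<and> code m ((f ^^ m) x) = b)"

lemma word_determines_code:
  assumes "x \<in> X" "y \<in> X" "word m n x = word m n y"
  shows "code (n * m) x = code (n * m) y"
proof -
  have eq: "code m ((f ^^ (i * m)) x) = code m ((f ^^ (i * m)) y)" if "i < n" for i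
    using arg_cong[OF assms(3), of "\<lambda>l. l ! i"] that by (simp add: word_def)
  have "code (j * m) x = code (j * m) y" if "j \<le> n" for j
    using that
  proof (induction j)
    case 0
    have "\<lfloor>x\<rfloor> = 0" "\<lfloor>y\<rfloor> = 0" using assms by (auto simp: X_def floor_eq_iff)
    then show ?case by (simp add: code_def)
  next
    case (Suc j)
    then show ?case
      using code_add[OF assms(1), of "j * m" m] code_add[OF assms(2), of "j * m" m] eq[of j]
      by (simp add: add.commute)
  qed
  then show ?thesis by simp
qed

text \<open>The word of length \<open>n * m\<close> can be recovered from its \<open>n\<close>
  blocks, so different long words give different paths. The function \<open>g\<close> reads the long
  word off from any point with the given blocks.\<close>

lemma word_count: "w (n * m) \<le> card (word m n ` X)"
proof -
  have fin: "finite (word m n ` X)"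
  proof (rule finite_subset)
    show "word m n ` X \<subseteq> {xs. set xs \<subseteq> words m \<and> length xs = n}"
      using fn_X by (auto simp: word_def words_def)
    show "finite {xs. set xs \<subseteq> words m \<and> length xs = n}"
      by (rule finite_lists_length_eq[OF words_finite])
  qed
  define g where "g v = code (n * m) (SOME x. x \<in> X \<and> word m n x = v)" for v
  have "words (n * m) \<subseteq> g ` (word m n ` X)"
  proof
    fix v assume "v \<in> words (n * m)"
    then obtain x where x: "x \<in> X" "v = code (n * m) x" by (auto simp: words_def)
    define y where "y = (SOME y. y \<in> X \<and> word m n y = word m n x)"
    have "y \<in> X \<and> word m n y = word m n x"
      unfolding y_def by (rule someI[of _ x]) (simp add: x)
    then have "g (word m n x) = v"
      using word_determines_code[of y x m n] x unfolding g_def y_def by simp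
    then show "v \<in> g ` (word m n ` X)" using x by blast
  qed
  then have "w (n * m) \<le> card (g ` (word m n ` X))"
    unfolding w_def using fin by (intro card_mono) auto
  also have "\<dots> \<le> card (word m n ` X)" using fin by (rule card_image_le)
  finally show ?thesis .
qed

lemma no_cycle_bound:
  assumes acyc: "\<And>l a. 1 \<le> l \<Longrightarrow> l \<le> 2 * n \<Longrightarrow> \<not> (edge m ^^ l) a a"
  shows "w (n * m) * fact n \<le> w m ^ n"
proof -
  have "card (word m n ` X) * fact n \<le> card (words m) ^ n"
  proof (rule path_count[where E = "edge m"])
    show "set xs \<subseteq> words m \<and> length xs = n" if "xs \<in> word m n ` X" for xs
      using that fn_X by (auto simp: word_def words_def)
    show "edge m (xs ! i) (xs ! Suc i)" if xs: "xs \<in> word m n ` X" and i: "Suc i < length xs" for xs i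
    proof -
      obtain x where x: "x \<in> X" "xs = word m n x" using xs by auto
      have "(f ^^ (Suc i * m)) x = (f ^^ m) ((f ^^ (i * m)) x)" by (simp add: funpow_add)
      then show ?thesis unfolding edge_def using x i fn_X[OF x(1), of "i * m"]
        by (auto simp: word_def intro!: bexI[of _ "(f ^^ (i * m)) x"])
    qed
  qed (use words_finite acyc in auto)
  then show ?thesis using word_count[of n m] unfolding w_def[of m]
    by (meson le_trans mult_le_mono1)
qed

text \<open>Equal integer parts after \<open>m\<close> steps mean Euclidean distance at most 1 at
  that time, and the expansion by \<open>lam ^ m\<close> carries this back.\<close>

lemma same_code_close:
  assumes "code m x = code m y"
  shows "\<bar>H x - H y\<bar> \<le> W / lam ^ m"
proof -
  have "\<bar>(F ^^ m) x - (F ^^ m) y\<bar> \<le> 1" using assms unfolding code_def by linarith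
  then have "\<bar>H ((F ^^ m) x) - H ((F ^^ m) y)\<bar> \<le> W"
    using H_upper[of "(F ^^ m) x" "(F ^^ m) y"] W_ge_1 by (smt (verit) mult_left_le)
  then have "lam ^ m * \<bar>H x - H y\<bar> \<le> W" using expand_iter[of m x y] by linarith
  then show ?thesis using lam by (simp add: field_simps)
qed

text \<open>A cycle of words gives a pseudo-orbit made of \<open>l\<close> true orbit pieces of
  \<open>m\<close> steps in \<open>X\<close>; each jump joins two points with the same word of
  length \<open>m\<close>. As the pseudo-orbit lies in \<open>A\<close>, the distance of the closed
  orbit to \<open>A\<close> comes from the jumps alone.\<close>

lemma cycle_closing:
  assumes cyc: "(edge m ^^ l) a a" and l: "l \<ge> 1" and m: "m \<ge> 1"
  shows "\<exists>q k. (F ^^ (l * m)) q = q + of_int k \<and>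
    (\<Sum>t<l * m. DA ((F ^^ t) q)) \<le> real (l * m) * (W / lam ^ m) / (lam - 1)"
proof -
  obtain v where v: "v 0 = a" "v l = a" "\<And>i. i < l \<Longrightarrow> edge m (v i) (v (Suc i))"
    using cyc unfolding relpowp_fun_conv by blast
  have "\<forall>i. \<exists>x. i < l \<longrightarrow> x \<in> X \<and> code m x = v i \<and> code m ((f ^^ m) x) = v (Suc i)"
    using v(3) unfolding edge_def by blast
  then obtain y where y: "\<And>i. i < l \<Longrightarrow> y i \<in> X \<and> code m (y i) = v i \<and> code m ((f ^^ m) (y i)) = v (Suc i)"
    by metis
  \<comment> \<open>Reduction modulo \<open>l\<close> lets the last piece jump back to the first and
    gives \<open>x (l * m) = x 0\<close>.\<close>
  define y' where "y' i = y (i mod l)" for i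
  define x where "x t = (f ^^ (t mod m)) (y' (t div m))" for t
  have y'X: "y' i \<in> X" for i using y[of "i mod l"] l unfolding y'_def by simp
  have xX: "x t \<in> X" for t unfolding x_def by (intro fn_X y'X)
  have jump: "\<bar>H (F (x t) + of_int (- \<lfloor>F (x t)\<rfloor>)) - H (x (Suc t))\<bar> \<le> W / lam ^ m" if t: "t < l * m" for t
  proof -
    have Fx: "F (x t) + of_int (- \<lfloor>F (x t)\<rfloor>) = f (x t)" by (simp add: circ_map_def frac_def)
    show ?thesis
    proof (cases "Suc (t mod m) = m")
      case False
      then have "Suc t mod m = Suc (t mod m)" "Suc t div m = t div m"
        using m by (auto simp: mod_Suc div_Suc)
      then have "x (Suc t) = f (x t)" by (simp add: x_def)
      then show ?thesis unfolding Fx using W_ge_1 lam by simp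
    next
      case True
      then have "Suc t mod m = 0" "Suc t div m = Suc (t div m)"
        by (auto simp: mod_Suc div_Suc)
      then have xS: "x (Suc t) = y' (Suc (t div m))" by (simp add: x_def)
      have i: "t div m < l" using t by (simp add: less_mult_imp_div_less)
      have "f (x t) = (f ^^ Suc (t mod m)) (y' (t div m))" by (simp add: x_def)
      also have "\<dots> = (f ^^ m) (y (t div m))" unfolding True y'_def using i by simp
      finally have "code m (f (x t)) = v (Suc (t div m))" using y[OF i] by simp
      also have "\<dots> = code m (y' (Suc (t div m)))"
        using y[of "Suc (t div m)"] y[of 0] i l v unfolding y'_def
        by (cases "Suc (t div m) = l") auto
      finally show ?thesis unfolding Fx xS by (rule same_code_close)
    qed
  qed
  have "x (l * m) = x 0" unfolding x_def y'_def using m by simp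
  moreover have "l * m \<ge> 1" using l m by simp
  ultimately obtain q k where q: "(F ^^ (l * m)) q = q + of_int k" and
    "(\<Sum>t<l * m. DA ((F ^^ t) q)) \<le> (\<Sum>t<l * m. DA (x t)) + (\<Sum>t<l * m. W / lam ^ m) / (lam - 1)"
    using closing_DA[of "l * m" x "\<lambda>t. - \<lfloor>F (x t)\<rfloor>" "\<lambda>t. W / lam ^ m"] jump by blast
  moreover have "(\<Sum>t<l * m. DA (x t)) = 0"
    using xX by (intro sum.neutral) (auto simp: DA_in X_def)
  ultimately show ?thesis by auto
qed

text \<open>The infimum \<open>h\<close> of \<open>ln (w m) / m\<close> is the exponential growth
  rate of the word counts. An upper bound close to \<open>h\<close> passes from \<open>m0\<close> to
  its multiples by submultiplicativity, which is why only multiples of \<open>m0\<close> appear; the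
  lower bound by \<open>h\<close> holds at every length because \<open>h\<close> is an
  infimum.\<close>

lemma entropy_choice:
  assumes "\<epsilon> > 0"
  shows "\<exists>m0\<ge>1. \<forall>j\<ge>1. \<forall>n. real (w (j * m0)) ^ n \<le> real (w (n * (j * m0))) * exp (\<epsilon> * real (j * m0) * real n)"
proof -
  define S where "S = (\<lambda>m. ln (real (w m)) / real m) ` {1..}"
  define h where "h = Inf S"
  have "bdd_below S" unfolding S_def
    by (intro bdd_belowI[of _ 0]) (use w_pos in \<open>auto intro!: divide_nonneg_nonneg ln_ge_zero\<close>)
  have "S \<noteq> {}" unfolding S_def by auto
  then obtain s where "s \<in> S" "s < h + \<epsilon>"
    using cInf_lessD[of S "h + \<epsilon>"] assms unfolding h_def by auto
  then obtain m0 where m0: "m0 \<ge> 1" "ln (real (w m0)) / real m0 < h + \<epsilon>" unfolding S_def by auto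
  have low: "ln (real (w k)) \<ge> real k * h" for k
  proof (cases "k = 0")
    case True
    then show ?thesis using w_pos[of 0] by (simp add: ln_ge_zero)
  next
    case False
    then have "h \<le> ln (real (w k)) / real k"
      unfolding h_def using \<open>bdd_below S\<close> by (intro cInf_lower) (auto simp: S_def)
    then show ?thesis using False by (simp add: field_simps)
  qed
  have "real (w (j * m0)) ^ n \<le> real (w (n * (j * m0))) * exp (\<epsilon> * real (j * m0) * real n)"
    if "j \<ge> 1" for j n
  proof -
    define m where "m = j * m0"
    have pos: "real (w k) > 0" for k using w_pos[of k] by simp
    have "real (w m) \<le> real (w m0) ^ j" unfolding m_def using w_power[of j m0]
      by (metis of_nat_le_iff of_nat_power)
    then have "ln (real (w m)) \<le> real j * ln (real (w m0))"
      using pos by (metis ln_le_cancel_iff ln_realpow zero_less_power)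
    also have "\<dots> \<le> real j * (real m0 * (h + \<epsilon>))"
      using m0 by (intro mult_left_mono) (auto simp: field_simps)
    finally have "ln (real (w m)) \<le> real m * h + \<epsilon> * real m" by (simp add: m_def algebra_simps)
    then have "real n * ln (real (w m)) \<le> real n * (real m * h + \<epsilon> * real m)"
      by (intro mult_left_mono) auto
    also have "\<dots> \<le> ln (real (w (n * m))) + \<epsilon> * real m * real n"
      using low[of "n * m"] by (simp add: algebra_simps)
    finally have "ln (real (w m) ^ n) \<le> ln (real (w (n * m)) * exp (\<epsilon> * real m * real n))"
      using pos by (simp add: ln_realpow ln_mult)
    then show ?thesis using pos unfolding m_def by (subst (asm) ln_le_cancel_iff) auto
  qed
  then show ?thesis using m0 by blast
qed

text \<open>Without a cycle of length at most \<open>2 * n\<close> the two counts give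
  \<open>fact n \<le> exp (\<epsilon> * m * n)\<close>, which fails once
  \<open>n > exp (\<epsilon> * m + 1)\<close>. So there is a cycle of length at most of order
  \<open>exp (\<epsilon> * m)\<close>, while the jumps needed to close it are of order
  \<open>1 / lam ^ m\<close>; for small \<open>\<epsilon>\<close> this beats any power of the
  period.\<close>

lemma fast_approx:
  fixes c0 :: real
  assumes c0: "c0 > 0"
  shows "\<exists>N q l. N \<ge> 1 \<and> (F ^^ N) q = q + of_int l \<and> real N ^ k * (\<Sum>t<N. DA ((F ^^ t) q)) \<le> c0"
proof -
  \<comment> \<open>Half of the rate \<open>ln lam\<close> pays for the growth of
    \<open>b ^ Suc k\<close>, the other half beats the power of \<open>m\<close>. The exponent is
    \<open>Suc k\<close> because the closing estimate contributes one more factor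
    \<open>N\<close>.\<close>
  define a where "a = ln lam / 2"
  have a: "a > 0" using lam by (simp add: a_def)
  define \<epsilon> where "\<epsilon> = a / real (Suc k)"
  have \<epsilon>: "\<epsilon> > 0" using a by (simp add: \<epsilon>_def)
  obtain m0 where m0: "m0 \<ge> 1" and ent: "\<And>j n. j \<ge> 1 \<Longrightarrow>
    real (w (j * m0)) ^ n \<le> real (w (n * (j * m0))) * exp (\<epsilon> * real (j * m0) * real n)"
    using entropy_choice[OF \<epsilon>] by blast
  define C where "C = (4 * exp 1) ^ Suc k * (W / (lam - 1))"
  have C: "C > 0" using W_ge_1 lam unfolding C_def by simp
  obtain m1 where m1: "\<And>m. m \<ge> m1 \<Longrightarrow> real m ^ Suc k * exp (- (a * real m)) \<le> c0 / C"
    using poly_times_exp_decay[OF a, of "c0 / C" "Suc k"] c0 C by auto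
  \<comment> \<open>A multiple of \<open>m0\<close>, as \<open>ent\<close> requires, that is also at
    least \<open>m1\<close>.\<close>
  define m where "m = Suc m1 * m0"
  have "Suc m1 * 1 \<le> m" using m0 unfolding m_def by (intro mult_le_mono2)
  then have m: "m \<ge> m1" "m \<ge> 1" by simp_all
  define b where "b = exp (\<epsilon> * real m + 1)"
  have bump1: "b \<ge> 1" using \<epsilon> unfolding b_def by simp
  define n where "n = Suc (nat \<lfloor>b\<rfloor>)"
  have n: "real n > b" "real n \<le> 2 * b" using bump1 unfolding n_def by linarith+
  have "\<exists>l a. 1 \<le> l \<and> l \<le> 2 * n \<and> (edge m ^^ l) a a"
  proof (rule ccontr)
    assume "\<not> ?thesis"
    then have "w (n * m) * fact n \<le> w m ^ n" by (intro no_cycle_bound) auto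
    then have "real (w (n * m)) * fact n \<le> real (w m) ^ n"
      by (metis of_nat_fact of_nat_le_iff of_nat_mult of_nat_power)
    also have "\<dots> \<le> real (w (n * m)) * exp (\<epsilon> * real m * real n)"
      unfolding m_def by (rule ent) simp
    finally have "fact n \<le> exp (\<epsilon> * real m * real n)" using w_pos[of "n * m"]
      by (simp add: mult_le_cancel_left)
    then have "real n ^ n \<le> exp (\<epsilon> * real m * real n) * exp (real n)"
      using pow_le_fact_exp[of n] by (meson exp_ge_zero mult_right_mono order_trans)
    also have "\<dots> = b ^ n" unfolding b_def
      by (simp add: exp_of_nat_mult[symmetric] exp_add[symmetric] algebra_simps)
    finally show False using n(1) bump1 power_strict_mono[of b "real n" n] unfolding n_def by simp
  qed
  then obtain l v where l: "1 \<le> l" "l \<le> 2 * n" and cyc: "(edge m ^^ l) v v" by blast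
  obtain q k' where q: "(F ^^ (l * m)) q = q + of_int k'" and
    S: "(\<Sum>t<l * m. DA ((F ^^ t) q)) \<le> real (l * m) * (W / lam ^ m) / (lam - 1)"
    using cycle_closing[OF cyc l(1) m(2)] by blast
  define N where "N = l * m"
  have "real l \<le> 4 * b" using l n by linarith
  then have N: "real N \<le> 4 * b * real m" unfolding N_def by (simp add: mult_right_mono)
  have lamm: "lam ^ m = exp (2 * a * real m)"
    using lam by (simp add: a_def mult.commute exp_of_nat_mult)
  have bk: "b ^ Suc k = exp (a * real m) * exp 1 ^ Suc k"
  proof -
    have "b ^ Suc k = exp (real (Suc k) * (\<epsilon> * real m + 1))" unfolding b_def by (simp only: exp_of_nat_mult)
    also have "real (Suc k) * (\<epsilon> * real m + 1) = a * real m + real (Suc k) * 1"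
      by (simp add: \<epsilon>_def field_simps)
    also have "exp \<dots> = exp (a * real m) * exp 1 ^ Suc k" by (simp only: exp_add exp_of_nat_mult)
    finally show ?thesis .
  qed
  have "real N ^ k * (\<Sum>t<N. DA ((F ^^ t) q)) \<le> real N ^ k * (real N * (W / lam ^ m) / (lam - 1))"
    using S unfolding N_def by (intro mult_left_mono) auto
  also have "\<dots> = real N ^ Suc k * (W / (lam - 1) / lam ^ m)" by (simp add: field_simps)
  also have "\<dots> \<le> (4 * b * real m) ^ Suc k * (W / (lam - 1) / lam ^ m)"
    using N W_ge_1 lam by (intro mult_right_mono power_mono) auto
  also have "\<dots> = 4 ^ Suc k * b ^ Suc k * real m ^ Suc k * (W / (lam - 1) / lam ^ m)"
    by (simp only: power_mult_distrib)
  also have "\<dots> = C * (real m ^ Suc k * (exp (a * real m) / lam ^ m))"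
    unfolding bk C_def by (simp only: power_mult_distrib) (simp add: field_simps)
  also have "exp (a * real m) / lam ^ m = exp (- (a * real m))"
    unfolding lamm by (simp add: exp_diff[symmetric])
  also have "C * (real m ^ Suc k * exp (- (a * real m))) \<le> C * (c0 / C)"
    using m1[OF m(1)] C by (intro mult_left_mono) auto
  also have "\<dots> = c0" using C by simp
  finally have "real N ^ k * (\<Sum>t<N. DA ((F ^^ t) q)) \<le> c0" .
  moreover have "N \<ge> 1" using l m unfolding N_def by simp
  ultimately show ?thesis using q unfolding N_def by blast
qed

text \<open>The weight \<open>N ^ K\<close> turns cutting into an improvement: the period at least
  halves, which gains \<open>2 ^ K\<close>, more than the factor
  \<open>1 + 1 / (\<epsilon> * (lam - 1))\<close> lost when a jump of size at most
  \<open>\<sigma> / \<epsilon>\<close> is closed. In an orbit of least period among the good ones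
  all gaps therefore exceed \<open>\<sigma> / \<epsilon>\<close>.\<close>

lemma well_separated_orbit:
  assumes \<epsilon>: "\<epsilon> > 0" and D0: "D0 > 0"
  shows "\<exists>N q l D. N \<ge> 1 \<and> (F ^^ N) q = q + of_int l \<and> 0 < D \<and> D \<le> D0 \<and>
    (\<Sum>t<N. DA ((F ^^ t) q)) \<le> \<epsilon> * D \<and>
    (\<forall>i<N. \<forall>j<N. \<forall>k. (i \<noteq> j \<or> k \<noteq> 0) \<longrightarrow> D \<le> \<bar>H ((F ^^ i) q + of_int k) - H ((F ^^ j) q)\<bar>)"
proof -
  define D1 where "D1 = min D0 1"
  have D1: "0 < D1" "D1 \<le> D0" "D1 \<le> 1" using D0 unfolding D1_def by auto
  obtain K :: nat where K: "1 + 1 / (\<epsilon> * (lam - 1)) < 2 ^ K"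
    using real_arch_pow[of 2 "1 + 1 / (\<epsilon> * (lam - 1))"] by auto
  define good where "good N \<longleftrightarrow> N \<ge> 1 \<and> (\<exists>q l. (F ^^ N) q = q + of_int l \<and>
    real N ^ K * (\<Sum>t<N. DA ((F ^^ t) q)) \<le> \<epsilon> * D1)" for N
  have ex: "\<exists>N. good N" using fast_approx[of "\<epsilon> * D1" K] \<epsilon> D1 unfolding good_def by auto
  define N where "N = (LEAST N. good N)"
  have gN: "good N" unfolding N_def by (rule LeastI_ex[OF ex])
  have minN: "\<not> good n" if "n < N" for n using that not_less_Least unfolding N_def by blast
  obtain q l where N1: "N \<ge> 1" and q: "(F ^^ N) q = q + of_int l" and
    J: "real N ^ K * (\<Sum>t<N. DA ((F ^^ t) q)) \<le> \<epsilon> * D1" using gN unfolding good_def by blast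
  define \<sigma> where "\<sigma> = (\<Sum>t<N. DA ((F ^^ t) q))"
  have \<sigma>0: "\<sigma> \<ge> 0" unfolding \<sigma>_def by (intro sum_nonneg) (simp add: DA_nonneg)
  have "1 * \<sigma> \<le> real N ^ K * \<sigma>" using \<sigma>0 N1 by (intro mult_right_mono) auto
  then have \<sigma>1: "\<sigma> \<le> \<epsilon> * D1" using J unfolding \<sigma>_def by linarith
  have sep: "\<bar>H ((F ^^ j) q + of_int k) - H ((F ^^ i) q)\<bar> > \<sigma> / \<epsilon>" if ij: "i < j" "j < N" for i j k
  proof (rule ccontr)
    assume "\<not> ?thesis"
    then have e: "\<bar>H ((F ^^ j) q + of_int k) - H ((F ^^ i) q)\<bar> / (lam - 1) \<le> \<sigma> / \<epsilon> / (lam - 1)"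
      using lam by (intro divide_right_mono) auto
    obtain n q' l' where n: "1 \<le> n" "2 * n \<le> N" and q': "(F ^^ n) q' = q' + of_int l'" and
      s: "(\<Sum>t<n. DA ((F ^^ t) q')) \<le> \<sigma> + \<bar>H ((F ^^ j) q + of_int k) - H ((F ^^ i) q)\<bar> / (lam - 1)"
      using split_orbit[OF q ij, of k] unfolding \<sigma>_def by blast
    have s': "(\<Sum>t<n. DA ((F ^^ t) q')) \<le> \<sigma> * (1 + 1 / (\<epsilon> * (lam - 1)))"
      using s e by (simp add: algebra_simps)
    have "real n ^ K * (\<Sum>t<n. DA ((F ^^ t) q')) \<le> real n ^ K * (\<sigma> * 2 ^ K)"
      using s' K \<sigma>0 by (intro mult_left_mono order_trans[OF s'] ) auto
    also have "\<dots> = (2 * real n) ^ K * \<sigma>" by (simp add: power_mult_distrib)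
    also have "\<dots> \<le> real N ^ K * \<sigma>" using n \<sigma>0 by (intro mult_right_mono power_mono) auto
    also have "\<dots> \<le> \<epsilon> * D1" using J unfolding \<sigma>_def .
    finally have "good n" unfolding good_def using n q' by blast
    then show False using minN n by simp
  qed
  define G where "G = (\<lambda>(i, j). let t = (F ^^ j) q - (F ^^ i) q in \<bar>of_int (round t) - t\<bar>) ` {(i, j). i < j \<and> j < N}"
  \<comment> \<open>If \<open>\<sigma> = 0\<close>, the value \<open>\<sigma> / \<epsilon>\<close>
    is useless. Then the smallest distance on the circle between orbit points is taken, capped by
    \<open>D1\<close>; it is positive because the strict inequality in \<open>sep\<close> makes the
    points distinct.\<close>
  define D where "D = (if \<sigma> > 0 then \<sigma> / \<epsilon> else Min (insert D1 G))"
  have finG: "finite G" unfolding G_def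
    by (intro finite_imageI finite_subset[of "{(i, j). i < j \<and> j < N}" "{..<N} \<times> {..<N}"]) auto
  have Gpos: "g > 0" if g: "g \<in> G" for g
  proof -
    obtain i j where ij: "i < j" "j < N" and
      g': "g = \<bar>of_int (round ((F ^^ j) q - (F ^^ i) q)) - ((F ^^ j) q - (F ^^ i) q)\<bar>"
      using g unfolding G_def Let_def by auto
    have "\<bar>H ((F ^^ j) q + of_int (- round ((F ^^ j) q - (F ^^ i) q))) - H ((F ^^ i) q)\<bar> > 0"
      using sep[OF ij] \<sigma>0 \<epsilon> by (meson divide_nonneg_pos le_less_trans)
    then have "(F ^^ j) q + of_int (- round ((F ^^ j) q - (F ^^ i) q)) \<noteq> (F ^^ i) q" by auto
    then show ?thesis unfolding g' by auto
  qed
  have Dpos: "D > 0" using Gpos finG D1 \<epsilon> unfolding D_def by auto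
  have D_D1: "D \<le> D1"
    using \<sigma>1 \<epsilon> finG unfolding D_def by (auto simp: field_simps)
  have \<sigma>D: "\<sigma> \<le> \<epsilon> * D" using \<epsilon> Dpos \<sigma>0 unfolding D_def by (auto split: if_splits)
  have sepD: "D \<le> \<bar>H ((F ^^ j) q + of_int k) - H ((F ^^ i) q)\<bar>" if ij: "i < j" "j < N" for i j k
  proof (cases "\<sigma> > 0")
    case True
    then show ?thesis using sep[OF ij, of k] unfolding D_def by simp
  next
    case False
    define t where "t = (F ^^ j) q - (F ^^ i) q"
    have "\<bar>of_int (round t) - t\<bar> \<in> G" unfolding G_def t_def Let_def using ij by force
    then have "D \<le> \<bar>of_int (round t) - t\<bar>" using False finG unfolding D_def by simp
    also have "\<dots> \<le> \<bar>of_int (- k) - t\<bar>"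
      using round_diff_minimal[of t "- k"] by (simp add: abs_minus_commute)
    also have "\<dots> = \<bar>(F ^^ j) q + of_int k - (F ^^ i) q\<bar>" unfolding t_def by simp
    also have "\<dots> \<le> \<bar>H ((F ^^ j) q + of_int k) - H ((F ^^ i) q)\<bar>" by (rule H_lower)
    finally show ?thesis .
  qed
  have "D \<le> \<bar>H ((F ^^ i) q + of_int k) - H ((F ^^ j) q)\<bar>"
    if ij: "i < N" "j < N" "i \<noteq> j \<or> k \<noteq> 0" for i j k
  proof -
    consider "j < i" | "i < j" | "i = j" "k \<noteq> 0" using ij by linarith
    then show ?thesis
    proof cases
      case 1
      then show ?thesis using sepD[of j i k] ij by simp
    next
      case 2
      have "D \<le> \<bar>H ((F ^^ j) q + of_int (- k)) - H ((F ^^ i) q)\<bar>" by (rule sepD[OF 2 ij(2)])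
      then show ?thesis unfolding H_int by (simp add: algebra_simps abs_minus_commute)
    next
      case 3
      have "1 * 1 \<le> \<bar>real_of_int k\<bar> * \<bar>c\<bar>" using 3(2) c_ge_1 by (intro mult_mono) auto
      then have "1 \<le> \<bar>H ((F ^^ i) q + of_int k) - H ((F ^^ j) q)\<bar>"
        unfolding 3(1) H_int by (simp add: abs_mult)
      then show ?thesis using D_D1 D1 by linarith
    qed
  qed
  then show ?thesis using N1 q Dpos D_D1 D1 \<sigma>D unfolding \<sigma>_def
    by (intro exI[of _ N] exI[of _ q] exI[of _ l] exI[of _ D]) auto
qed

end

section \<open>Locking onto a periodic orbit\<close>

lemma sum_lessThan_add:
  fixes g :: "nat \<Rightarrow> real"
  shows "(\<Sum>j<k + m. g j) = (\<Sum>j<k. g j) + (\<Sum>j<m. g (k + j))"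
  by (induction m) (simp_all add: add.assoc)

text \<open>Outside radius \<open>r\<close> around the orbit, \<open>\<psi>\<close> exceeds its
  orbit average \<open>a\<close> by \<open>b\<close>, and outside the larger radius \<open>R\<close>
  by a further \<open>E\<close>. By \<open>low\<close>, \<open>E\<close> covers the worst loss of a
  stretch inside radius \<open>r\<close>: an incomplete period of the orbit, and the deviation from
  it. \<open>L * R + r \<le> G\<close> ensures that a point within \<open>R\<close> of an orbit
  point can map into the \<open>r\<close>-neighbourhood only at the image of that orbit
  point.\<close>

locale locked_orbit = adapted_lift +
  fixes \<psi> :: "real \<Rightarrow> real" and M L a b r R G E q :: real and N :: nat and l :: int
  assumes \<psi>_per: "\<psi> (x + 1) = \<psi> x"
    and \<psi>_lip: "\<bar>\<psi> x - \<psi> y\<bar> \<le> M * \<bar>H x - H y\<bar>"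
    and F_lip: "\<bar>H (F x) - H (F y)\<bar> \<le> L * \<bar>H x - H y\<bar>"
    and N: "N \<ge> 1" and q: "(F ^^ N) q = q + of_int l"
    and sep: "i < N \<Longrightarrow> j < N \<Longrightarrow> i \<noteq> j \<or> k \<noteq> 0 \<Longrightarrow> G \<le> \<bar>H ((F ^^ i) q + of_int k) - H ((F ^^ j) q)\<bar>"
    and r: "0 < r" "r < R" and G: "L * R + r \<le> G"
    and a: "(\<Sum>i<N. \<psi> ((F ^^ i) q)) = real N * a"
    and b: "b > 0"
    and outer: "(\<And>i k. i < N \<Longrightarrow> r \<le> \<bar>H x - H ((F ^^ i) q + of_int k)\<bar>) \<Longrightarrow> \<psi> x \<ge> a + b"
    and far: "(\<And>i k. i < N \<Longrightarrow> R \<le> \<bar>H x - H ((F ^^ i) q + of_int k)\<bar>) \<Longrightarrow> \<psi> x \<ge> a + b + E"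
    and low: "i < N \<Longrightarrow> real N * (a - \<psi> ((F ^^ i) q)) + M * (r * lam / (lam - 1)) \<le> E"
begin

definition Orb :: "real set" where
  "Orb = {(F ^^ i) q + of_int k | i k. i < N}"

lemma OrbI: "i < N \<Longrightarrow> (F ^^ i) q + of_int k \<in> Orb"
  unfolding Orb_def by blast

lemma OrbE:
  assumes "o' \<in> Orb"
  obtains i k where "i < N" "o' = (F ^^ i) q + of_int k"
  using assms unfolding Orb_def by blast

lemma Orb_forward: "o' \<in> Orb \<Longrightarrow> F o' \<in> Orb"
proof -
  assume "o' \<in> Orb"
  then obtain i k where i: "i < N" "o' = (F ^^ i) q + of_int k" by (rule OrbE)
  have F: "F o' = (F ^^ Suc i) q + of_int (d * k)" by (simp only: i F_int) simp
  show ?thesis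
  proof (cases "Suc i = N")
    case True
    have "F o' = (F ^^ 0) q + of_int (l + d * k)" unfolding F True q by simp
    then show ?thesis using OrbI[of 0 "l + d * k"] N by (simp only:)
  next
    case False
    then show ?thesis unfolding F using i by (intro OrbI) simp
  qed
qed

lemma Orb_iter: "o' \<in> Orb \<Longrightarrow> (F ^^ n) o' \<in> Orb"
  by (induction n) (auto intro: Orb_forward)

lemma Orb_sep:
  assumes "o1 \<in> Orb" "o2 \<in> Orb" "\<bar>H o1 - H o2\<bar> < G"
  shows "o1 = o2"
proof -
  obtain i k where i: "i < N" "o1 = (F ^^ i) q + of_int k" using assms(1) by (rule OrbE)
  obtain j m where j: "j < N" "o2 = (F ^^ j) q + of_int m" using assms(2) by (rule OrbE)
  have "\<bar>H o1 - H o2\<bar> = \<bar>H ((F ^^ i) q + of_int (k - m)) - H ((F ^^ j) q)\<bar>"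
    unfolding i j H_int by (simp add: algebra_simps)
  then have "\<not> (i \<noteq> j \<or> k - m \<noteq> 0)" using sep[OF i(1) j(1), of "k - m"] assms(3) by linarith
  then show ?thesis using i j by simp
qed

lemma L_nonneg: "L \<ge> 0"
proof -
  have "\<bar>H 1 - H 0\<bar> > 0" using H_lower[of 1 0] by linarith
  then show ?thesis using F_lip[of 1 0] by (smt (verit) mult_neg_pos)
qed

lemma M_nonneg: "M \<ge> 0"
proof -
  have "\<bar>H 1 - H 0\<bar> > 0" using H_lower[of 1 0] by linarith
  then show ?thesis using \<psi>_lip[of 1 0] by (smt (verit) mult_neg_pos)
qed

definition near :: "real \<Rightarrow> bool" where "near x \<longleftrightarrow> (\<exists>o'\<in>Orb. \<bar>H x - H o'\<bar> < r)"

definition E0 :: real where "E0 = E - M * (r * lam / (lam - 1))"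

lemma low_Orb: "o' \<in> Orb \<Longrightarrow> real N * (a - \<psi> o') \<le> E0"
  using low periodic_of_int[of \<psi>, OF \<psi>_per] unfolding E0_def
  by (force elim!: OrbE)

lemma E0_nonneg: "E0 \<ge> 0"
proof (rule ccontr)
  assume "\<not> ?thesis"
  have "a < \<psi> ((F ^^ i) q)" if "i < N" for i
  proof -
    have "real N * (a - \<psi> ((F ^^ i) q)) < 0"
      using low[OF that] \<open>\<not> 0 \<le> E0\<close> unfolding E0_def by linarith
    then show ?thesis by (simp add: mult_less_0_iff)
  qed
  then have "(\<Sum>i<N. a) < (\<Sum>i<N. \<psi> ((F ^^ i) q))"
    using N by (intro sum_strict_mono) (auto simp: lessThan_empty_iff)
  then show False using a by simp
qed

lemma Orb_period_sum:
  assumes "o' \<in> Orb"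
  shows "(\<Sum>j<N. \<psi> ((F ^^ j) o') - a) = 0"
proof -
  obtain i k where i: "i < N" "o' = (F ^^ i) q + of_int k" using assms by (rule OrbE)
  have "(\<Sum>j<N. \<psi> ((F ^^ j) o')) = (\<Sum>j<N. \<psi> ((F ^^ (i + j)) q))"
  proof (rule sum.cong)
    fix j
    have "(F ^^ j) o' = (F ^^ (i + j)) q + of_int (d ^ j * k)"
      unfolding i add.commute[of i] funpow_add o_apply by (rule Fn_int)
    then show "\<psi> ((F ^^ j) o') = \<psi> ((F ^^ (i + j)) q)"
      by (simp only: periodic_of_int[of \<psi>, OF \<psi>_per])
  qed simp
  also have "\<dots> = real N * a" using periodic_sum_shift[of \<psi>, OF \<psi>_per q] a by simp
  finally show ?thesis by (simp add: sum_subtractf)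
qed

text \<open>Complete periods contribute nothing, and the fewer than \<open>N\<close> remaining steps
  lose at most \<open>E0 / real N\<close> each.\<close>

lemma Orb_partial_sum:
  assumes "o' \<in> Orb"
  shows "(\<Sum>j<n. \<psi> ((F ^^ j) o') - a) \<ge> - E0"
  using assms
proof (induction n arbitrary: o' rule: less_induct)
  case (less n)
  show ?case
  proof (cases "n < N")
    case True
    have "- (E0 / real N) \<le> \<psi> ((F ^^ j) o') - a" for j
      using low_Orb[OF Orb_iter[OF less.prems, of j]] N by (simp add: field_simps)
    then have "(\<Sum>j<n. - (E0 / real N)) \<le> (\<Sum>j<n. \<psi> ((F ^^ j) o') - a)" by (intro sum_mono)
    moreover have "real n * (E0 / real N) \<le> real N * (E0 / real N)"
      using True E0_nonneg by (intro mult_right_mono) auto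
    ultimately show ?thesis using N by simp
  next
    case False
    then obtain m where m: "n = N + m" using le_Suc_ex not_less by blast
    have "(\<Sum>j<n. \<psi> ((F ^^ j) o') - a) = (\<Sum>j<N. \<psi> ((F ^^ j) o') - a) + (\<Sum>j<m. \<psi> ((F ^^ (N + j)) o') - a)"
      unfolding m by (rule sum_lessThan_add)
    also have "(\<Sum>j<m. \<psi> ((F ^^ (N + j)) o') - a) = (\<Sum>j<m. \<psi> ((F ^^ j) ((F ^^ N) o')) - a)"
      by (simp add: add.commute[of N] funpow_add)
    finally show ?thesis using less.IH[of m "(F ^^ N) o'"] Orb_iter[OF less.prems, of N] m N
      Orb_period_sum[OF less.prems] by simp
  qed
qed

text \<open>While shadowing lasts, the image of the shadowed point is within \<open>L * R\<close> of
  the image of \<open>x\<close>, hence closer than \<open>G\<close> to whichever orbit point is near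
  the latter; separation identifies the two.\<close>

lemma stretch_shadow:
  assumes "o' \<in> Orb" "\<bar>H x - H o'\<bar> < r" "\<And>i. i < n \<Longrightarrow> near ((F ^^ i) x)" "i < n"
  shows "\<bar>H ((F ^^ i) x) - H ((F ^^ i) o')\<bar> < r"
  using assms(4)
proof (induction i)
  case 0
  then show ?case using assms by simp
next
  case (Suc i)
  obtain o2 where o2: "o2 \<in> Orb" "\<bar>H ((F ^^ Suc i) x) - H o2\<bar> < r"
    using assms(3)[OF Suc.prems] unfolding near_def by blast
  have "\<bar>H ((F ^^ Suc i) x) - H ((F ^^ Suc i) o')\<bar> \<le> L * \<bar>H ((F ^^ i) x) - H ((F ^^ i) o')\<bar>"
    using F_lip by simp
  also have "\<dots> \<le> L * R" using Suc r L_nonneg by (intro mult_left_mono) auto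
  finally have "\<bar>H o2 - H ((F ^^ Suc i) o')\<bar> < G" using o2(2) G by linarith
  then have "o2 = (F ^^ Suc i) o'" using Orb_sep[OF o2(1) Orb_iter[OF assms(1)]] by blast
  then show ?case using o2 by simp
qed

text \<open>Compared with the shadowed orbit the loss is at most \<open>M\<close> times the total
  distance, and by expansion this total is controlled by the last distance, which is below
  \<open>r\<close>.\<close>

lemma stretch_sum:
  assumes near: "\<And>i. i < n \<Longrightarrow> near ((F ^^ i) x)"
  shows "(\<Sum>i<n. \<psi> ((F ^^ i) x) - a) \<ge> - E"
proof (cases n)
  case 0
  have "M * (r * lam / (lam - 1)) \<ge> 0" using M_nonneg r lam by simp
  then show ?thesis using 0 E0_nonneg unfolding E0_def by simp
next
  case (Suc m)
  obtain o' where o': "o' \<in> Orb" "\<bar>H x - H o'\<bar> < r" using near[of 0] Suc unfolding near_def by auto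
  have sh: "\<bar>H ((F ^^ i) x) - H ((F ^^ i) o')\<bar> < r" if "i < n" for i
    by (rule stretch_shadow[OF o', of n]) (use near that in auto)
  define \<delta> where "\<delta> i = \<bar>H ((F ^^ i) x) - H ((F ^^ i) o')\<bar>" for i
  have "(lam - 1) * (\<Sum>i<m. \<delta> i) \<le> \<delta> m" unfolding \<delta>_def by (rule expand_sum)
  moreover have "\<delta> m < r" using sh[of m] Suc unfolding \<delta>_def by simp
  ultimately have "(\<Sum>i<m. \<delta> i) \<le> r / (lam - 1)" using lam by (simp add: field_simps)
  then have "(\<Sum>i<n. \<delta> i) \<le> r / (lam - 1) + r" using \<open>\<delta> m < r\<close> unfolding Suc by simp
  also have "\<dots> = r * lam / (lam - 1)" using lam by (simp add: field_simps)
  finally have S: "(\<Sum>i<n. \<delta> i) \<le> r * lam / (lam - 1)" .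
  have "(\<Sum>i<n. \<psi> ((F ^^ i) o') - a) - (\<Sum>i<n. \<psi> ((F ^^ i) x) - a) = (\<Sum>i<n. \<psi> ((F ^^ i) o') - \<psi> ((F ^^ i) x))"
    by (simp add: sum_subtractf)
  also have "\<dots> \<le> (\<Sum>i<n. M * \<delta> i)"
    by (intro sum_mono) (use \<psi>_lip in \<open>smt (verit) \<delta>_def\<close>)
  also have "\<dots> \<le> M * (r * lam / (lam - 1))"
    unfolding sum_distrib_left[symmetric] by (intro mult_left_mono S M_nonneg)
  finally show ?thesis using Orb_partial_sum[OF o'(1), of n] unfolding E0_def by linarith
qed

text \<open>Subtracting the reward \<open>b\<close> outside records the time spent there: lower
  bounds for sums of \<open>gap\<close> become the estimate with
  \<open>b * measure \<mu> outside\<close>, which later forces minimizing measures onto the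
  orbit.\<close>

definition gap :: "real \<Rightarrow> real" where "gap x = \<psi> x - a - b * (if near x then 0 else 1)"

lemma gap_outer: "\<not> near x \<Longrightarrow> gap x \<ge> 0"
  using outer[of x] b OrbI unfolding gap_def near_def by (simp add: not_less)

text \<open>From distance between \<open>r\<close> and \<open>R\<close> of an orbit point, expansion
  keeps the image at least \<open>r\<close> away from the image of that orbit point, and separation
  keeps it from landing near another one. Every entry into the neighbourhood therefore starts at
  distance at least \<open>R\<close> and is paid for in advance by \<open>E\<close>.\<close>

lemma escape:
  assumes "\<not> near x"
  shows "gap x \<ge> E \<or> \<not> near (F x)"
proof (cases "\<forall>o'\<in>Orb. R \<le> \<bar>H x - H o'\<bar>")
  case True
  then show ?thesis using far[of x] OrbI assms unfolding gap_def by simp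
next
  case False
  then obtain o' where o': "o' \<in> Orb" "\<bar>H x - H o'\<bar> < R" by auto
  have ge: "\<bar>H x - H o'\<bar> \<ge> r" using assms o' unfolding near_def by (simp add: not_less)
  have "\<not> near (F x)"
  proof
    assume "near (F x)"
    then obtain o2 where o2: "o2 \<in> Orb" "\<bar>H (F x) - H o2\<bar> < r" unfolding near_def by blast
    have "\<bar>H (F x) - H (F o')\<bar> \<le> L * R"
      using F_lip[of x o'] o'(2) L_nonneg by (smt (verit) mult_left_mono)
    then have "\<bar>H o2 - H (F o')\<bar> < G" using o2 G by linarith
    then have "o2 = F o'" using Orb_sep[OF o2(1) Orb_forward[OF o'(1)]] by blast
    then have "lam * \<bar>H x - H o'\<bar> < r" using expand[of x o'] o2 by simp
    moreover have "1 * r \<le> lam * \<bar>H x - H o'\<bar>" using ge lam r by (intro mult_mono) auto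
    ultimately show False by simp
  qed
  then show ?thesis by simp
qed

text \<open>The loss of a near stretch is covered by the step that enters it, so only an initial
  stretch can make a sum negative. The two claims support each other: outside, one step is split
  off; near the orbit, the whole first stretch is.\<close>

lemma gap_sums: "(\<Sum>i<n. gap ((F ^^ i) x)) \<ge> - E \<and> (\<not> near x \<longrightarrow> (\<Sum>i<n. gap ((F ^^ i) x)) \<ge> 0)"
proof (induction n arbitrary: x rule: less_induct)
  case (less n)
  have E: "E \<ge> 0"
    using E0_nonneg M_nonneg r lam unfolding E0_def by (smt (verit) divide_nonneg_nonneg mult_nonneg_nonneg)
  have shift: "(\<Sum>i<k + m. gap ((F ^^ i) x)) = (\<Sum>i<k. gap ((F ^^ i) x)) + (\<Sum>i<m. gap ((F ^^ i) ((F ^^ k) x)))" for k m x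
    by (induction m) (simp_all add: funpow_add add.commute[of k] add.assoc)
  have outer_case: "(\<Sum>i<m. gap ((F ^^ i) y)) \<ge> 0" if "m \<le> n" "\<not> near y" and
    IH: "\<And>k x. k < m \<Longrightarrow> (\<Sum>i<k. gap ((F ^^ i) x)) \<ge> - E \<and> (\<not> near x \<longrightarrow> (\<Sum>i<k. gap ((F ^^ i) x)) \<ge> 0)" for m y
  proof (cases m)
    case (Suc k)
    have "(\<Sum>i<m. gap ((F ^^ i) y)) = gap y + (\<Sum>i<k. gap ((F ^^ i) (F y)))"
      using shift[where k = 1 and m = k and x = y] Suc by simp
    then show ?thesis using escape[OF that(2)] gap_outer[OF that(2)] IH[of k "F y"] Suc by auto
  qed simp
  show ?case
  proof (cases "near x")
    case False
    then have "(\<Sum>i<n. gap ((F ^^ i) x)) \<ge> 0" using outer_case[of n x] less by blast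
    then show ?thesis using E by simp
  next
    case near: True
    show ?thesis
    proof (cases "\<forall>i<n. near ((F ^^ i) x)")
      case True
      have "(\<Sum>i<n. gap ((F ^^ i) x)) = (\<Sum>i<n. \<psi> ((F ^^ i) x) - a)"
        using True by (intro sum.cong) (auto simp: gap_def)
      then show ?thesis using stretch_sum[of n x] True near by auto
    next
      case False
      define k where "k = (LEAST i. \<not> near ((F ^^ i) x))"
      have k: "\<not> near ((F ^^ k) x)" unfolding k_def using False by (metis (mono_tags, lifting) LeastI)
      have kn: "k < n" unfolding k_def using False by (metis (mono_tags, lifting) Least_le le_less_trans)
      have below: "near ((F ^^ i) x)" if "i < k" for i using not_less_Least that unfolding k_def by blast
      have "k > 0" using k near by (cases k) auto
      obtain m where m: "n = k + m" using kn by (metis less_imp_add_positive)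
      have "(\<Sum>i<k. gap ((F ^^ i) x)) = (\<Sum>i<k. \<psi> ((F ^^ i) x) - a)"
        using below by (intro sum.cong) (auto simp: gap_def)
      then have 1: "(\<Sum>i<k. gap ((F ^^ i) x)) \<ge> - E" using stretch_sum[of k x] below by auto
      have 2: "(\<Sum>i<m. gap ((F ^^ i) ((F ^^ k) x))) \<ge> 0"
        using less[of m "(F ^^ k) x"] k m \<open>k > 0\<close> by auto
      show ?thesis using 1 2 shift[where k = k and m = m and x = x] m near by simp
    qed
  qed
qed

text \<open>Expansiveness: a positive distance to the shadowed orbit would grow at least like
  \<open>lam ^ n\<close>, yet it stays below \<open>r\<close>.\<close>

lemma near_forever:
  assumes "\<And>i. near ((F ^^ i) x)"
  shows "x \<in> Orb"
proof -
  obtain o' where o': "o' \<in> Orb" "\<bar>H x - H o'\<bar> < r" using assms[of 0] unfolding near_def by auto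
  have "\<bar>H x - H o'\<bar> = 0"
  proof (rule ccontr)
    assume "\<not> ?thesis"
    then have pos: "\<bar>H x - H o'\<bar> > 0" by linarith
    obtain n where n: "r / \<bar>H x - H o'\<bar> < lam ^ n" using real_arch_pow[OF lam] by blast
    have "lam ^ n * \<bar>H x - H o'\<bar> < r"
      using expand_iter[of n x o'] stretch_shadow[OF o', of "Suc n" n] assms by fastforce
    then show False using n pos by (simp add: field_simps)
  qed
  then show ?thesis using o' H_inj[of x o'] by simp
qed

end

section \<open>Invariant measures\<close>

lemma continuous_periodic_bounded:
  fixes g :: "real \<Rightarrow> real"
  assumes "continuous_on UNIV g" and per: "\<And>x. g (x + 1) = g x"
  shows "\<exists>B. \<forall>x. \<bar>g x\<bar> \<le> B"
proof -
  have "compact (g ` {0..1})"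
    using assms by (intro compact_continuous_image continuous_on_subset[OF assms(1)]) auto
  then obtain B where B: "\<And>x. x \<in> {0..1} \<Longrightarrow> \<bar>g x\<bar> \<le> B"
    using compact_imp_bounded bounded_iff by (metis imageI real_norm_def)
  have "\<bar>g x\<bar> \<le> B" for x
  proof -
    have "g x = g (frac x)"
      by (rule periodic_frac[of g, OF per, symmetric])
    then show ?thesis using B[of "frac x"] frac_lt_1[of x] frac_ge_0[of x] by (simp add: less_imp_le)
  qed
  then show ?thesis by blast
qed

lemma frac_measurable: "frac \<in> borel_measurable (borel :: real measure)"
  unfolding frac_def by measurable

lemma circ_map_measurable:
  assumes "continuous_on UNIV F"
  shows "circ_map F \<in> borel_measurable borel"
  unfolding circ_map_def
  using measurable_compose[OF borel_measurable_continuous_onI[OF assms] frac_measurable] .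

locale invariant_lift =
  fixes F :: "real \<Rightarrow> real" and d :: int and \<mu> :: "real measure"
  assumes F_cont: "continuous_on UNIV F" and F_per: "F (x + 1) = F x + of_int d"
    and inv: "invariant_measure F \<mu>"
begin

lemma sets_mu: "sets \<mu> = sets borel" using inv by (simp add: invariant_measure_def)

lemma space_mu: "space \<mu> = UNIV" using sets_eq_imp_space_eq[OF sets_mu] by simp

lemma distr_mu: "distr \<mu> borel (circ_map F) = \<mu>" using inv by (simp add: invariant_measure_def)

lemma circ_meas: "circ_map F \<in> measurable \<mu> borel"
  using circ_map_measurable[OF F_cont] measurable_cong_sets[OF sets_mu refl] by blast

sublocale prob_space \<mu> using inv by (simp add: invariant_measure_def)

lemma AE_unit: "AE x in \<mu>. x \<in> {0..<1}"
proof -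
  have "{0..<1::real} \<in> sets \<mu>" by (simp add: sets_mu)
  moreover have "emeasure \<mu> {0..<1} = 1" using inv by (simp add: invariant_measure_def)
  ultimately show ?thesis using AE_in_set_eq_1[of "{0..<1}"] by (metis emeasure_eq_measure ennreal_eq_1)
qed

lemma meas: "g \<in> borel_measurable borel \<Longrightarrow> g \<in> borel_measurable \<mu>"
  for g :: "real \<Rightarrow> real"
  using measurable_cong_sets[OF sets_mu refl] by blast

lemma integral_circ:
  fixes g :: "real \<Rightarrow> real"
  assumes "g \<in> borel_measurable borel"
  shows "(\<integral>x. g (circ_map F x) \<partial>\<mu>) = (\<integral>x. g x \<partial>\<mu>)"
  using integral_distr[OF circ_meas assms] by (simp add: distr_mu)

lemma circ_iter_meas: "(circ_map F ^^ i) \<in> borel_measurable borel"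
proof (induction i)
  case (Suc i)
  have "(\<lambda>x. circ_map F ((circ_map F ^^ i) x)) \<in> borel_measurable borel"
    using measurable_compose[OF Suc circ_map_measurable[OF F_cont]] .
  then show ?case by (simp add: o_def)
qed (simp add: id_def)

lemma integral_circ_iter:
  fixes g :: "real \<Rightarrow> real"
  assumes "g \<in> borel_measurable borel"
  shows "(\<integral>x. g ((circ_map F ^^ i) x) \<partial>\<mu>) = (\<integral>x. g x \<partial>\<mu>)"
proof (induction i)
  case (Suc i)
  have "(\<lambda>x. g ((circ_map F ^^ i) x)) \<in> borel_measurable borel"
    using measurable_compose[OF circ_iter_meas assms] .
  from integral_circ[OF this] Suc show ?case
    by (simp add: funpow_Suc_right del: funpow.simps)
qed simp

lemma AE_circ_iter: "AE x in \<mu>. P x \<Longrightarrow> AE x in \<mu>. P ((circ_map F ^^ i) x)"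
proof (induction i)
  case (Suc i)
  then have "AE x in distr \<mu> borel (circ_map F). P ((circ_map F ^^ i) x)" unfolding distr_mu by blast
  then have "AE x in \<mu>. P ((circ_map F ^^ i) (circ_map F x))" by (rule AE_distrD[OF circ_meas])
  then show ?case by (simp add: funpow_Suc_right del: funpow.simps)
qed simp

lemma circ_iter_frac: "x \<in> {0..<1} \<Longrightarrow> (circ_map F ^^ i) x = frac ((F ^^ i) x)"
proof -
  assume "x \<in> {0..<1}"
  then have "frac x = x" by (auto simp: frac_eq)
  then show ?thesis using circ_map_iter[of F d i x] F_per by simp
qed

text \<open>By invariance, \<open>n\<close> times the integral is the integral of a Birkhoff sum and
  hence at least \<open>- K\<close>, for every \<open>n\<close>.\<close>

lemma integral_nonneg_of_birkhoff:
  fixes g :: "real \<Rightarrow> real"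
  assumes g: "g \<in> borel_measurable borel" and bd: "\<And>x. \<bar>g x\<bar> \<le> B" and gper: "\<And>x. g (x + 1) = g x"
    and low: "\<And>n x. (\<Sum>i<n. g ((F ^^ i) x)) \<ge> - K"
  shows "(\<integral>x. g x \<partial>\<mu>) \<ge> 0"
proof -
  have int: "integrable \<mu> (\<lambda>x. g ((circ_map F ^^ i) x))" for i
    using bd meas[OF measurable_compose[OF circ_iter_meas g]]
    by (intro integrable_const_bound[where B = B]) auto
  have nK: "real n * (\<integral>x. g x \<partial>\<mu>) \<ge> - K" for n
  proof -
    have "- K = (\<integral>x. - K \<partial>\<mu>)" by (simp add: prob_space)
    also have "\<dots> \<le> (\<integral>x. (\<Sum>i<n. g ((circ_map F ^^ i) x)) \<partial>\<mu>)"
    proof (rule integral_mono_AE)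
      show "AE x in \<mu>. - K \<le> (\<Sum>i<n. g ((circ_map F ^^ i) x))"
        using AE_unit
      proof eventually_elim
        case (elim x)
        then have "(\<Sum>i<n. g ((circ_map F ^^ i) x)) = (\<Sum>i<n. g ((F ^^ i) x))"
          by (intro sum.cong) (simp_all add: circ_iter_frac periodic_frac[of g, OF gper])
        then show ?case using low by simp
      qed
    qed (use int in auto)
    also have "\<dots> = (\<Sum>i<n. \<integral>x. g ((circ_map F ^^ i) x) \<partial>\<mu>)" using int by (intro Bochner_Integration.integral_sum) auto
    also have "\<dots> = real n * (\<integral>x. g x \<partial>\<mu>)" by (simp add: integral_circ_iter[OF g])
    finally show ?thesis .
  qed
  show ?thesis
  proof (rule ccontr)
    assume "\<not> ?thesis"
    then have neg: "- (\<integral>x. g x \<partial>\<mu>) > 0" by simp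
    obtain n :: nat where "real n * - (\<integral>x. g x \<partial>\<mu>) > K" using reals_Archimedean3[OF neg] by blast
    then show False using nK[of n] by simp
  qed
qed

end

section \<open>The orbit measure as the unique minimizing measure\<close>

locale locked_lyap = locked_orbit +
  fixes u :: "real \<Rightarrow> real"
  assumes u_cont: "continuous_on UNIV u" and u_per: "u (x + 1) = u x"
    and cohom: "ln \<bar>deriv F x\<bar> = \<psi> x + u (F x) - u x"
begin

definition x0 :: real where "x0 = frac q"

definition \<Gamma> :: "real set" where "\<Gamma> = range (\<lambda>k. (circ_map F ^^ k) x0)"

lemma circ_iter: "(circ_map F ^^ k) x0 = frac ((F ^^ k) q)"
  unfolding x0_def using circ_map_iter[of F d k q] per by simp

lemma circ_period: "(circ_map F ^^ N) x0 = x0"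
  using circ_iter[of N] by (simp add: q x0_def)

lemma circ_iter_mod: "(circ_map F ^^ k) x0 = (circ_map F ^^ (k mod N)) x0"
  by (rule funpow_mod_eq[symmetric]) (rule circ_period)

lemma \<Gamma>_eq: "\<Gamma> = (\<lambda>k. (circ_map F ^^ k) x0) ` {..<N}"
proof
  show "\<Gamma> \<subseteq> (\<lambda>k. (circ_map F ^^ k) x0) ` {..<N}"
    unfolding \<Gamma>_def using circ_iter_mod N by (auto intro!: image_eqI[of _ _ "_ mod N"])
qed (auto simp: \<Gamma>_def)

lemma inj_\<Gamma>: "inj_on (\<lambda>k. (circ_map F ^^ k) x0) {..<N}"
proof (rule inj_onI)
  fix i j assume ij: "i \<in> {..<N}" "j \<in> {..<N}" "(circ_map F ^^ i) x0 = (circ_map F ^^ j) x0"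
  have "G > 0" using G r L_nonneg by (smt (verit) mult_nonneg_nonneg)
  define k where "k = \<lfloor>(F ^^ j) q\<rfloor> - \<lfloor>(F ^^ i) q\<rfloor>"
  have "(F ^^ i) q + of_int k = (F ^^ j) q" using ij(3) unfolding circ_iter frac_def k_def by simp
  then have "\<not> (i \<noteq> j \<or> k \<noteq> 0)" using sep[of i j k] ij \<open>G > 0\<close> by fastforce
  then show "i = j" by simp
qed

lemma card_\<Gamma>: "card \<Gamma> = N" unfolding \<Gamma>_eq using inj_\<Gamma> by (simp add: card_image)

lemma finite_\<Gamma>: "finite \<Gamma>" unfolding \<Gamma>_eq by simp

lemma \<Gamma>_nonempty: "\<Gamma> \<noteq> {}" unfolding \<Gamma>_def by simp

lemma periodic_orbit_\<Gamma>: "periodic_orbit F \<Gamma>"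
  unfolding periodic_orbit_def \<Gamma>_def
  by (rule bexI[of _ x0]) (use N circ_period in \<open>auto simp: x0_def frac_lt_1\<close>)

lemma sum_\<Gamma>:
  fixes g :: "real \<Rightarrow> real"
  assumes "\<And>x. g (x + 1) = g x"
  shows "(\<Sum>x\<in>\<Gamma>. g x) = (\<Sum>i<N. g ((F ^^ i) q))"
proof -
  have "g (frac x) = g x" for x
    by (rule periodic_frac[of g, OF assms])
  then show ?thesis unfolding \<Gamma>_eq sum.reindex[OF inj_\<Gamma>] by (simp add: circ_iter)
qed

definition \<phi> :: "real \<Rightarrow> real" where "\<phi> x = ln \<bar>deriv F x\<bar>"

lemma \<phi>_eq: "\<phi> x = \<psi> x + u (F x) - u x" by (simp add: \<phi>_def cohom)

lemma u_F_per: "u (F (x + 1)) = u (F x)"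
  unfolding per by (rule periodic_of_int[of u, OF u_per])

lemma \<phi>_per: "\<phi> (x + 1) = \<phi> x" by (simp add: \<phi>_eq \<psi>_per u_per u_F_per)

lemma H_cont: "continuous_on UNIV H"
proof -
  have "W-lipschitz_on UNIV H"
    using H_upper W_ge_1 by (intro lipschitz_onI) (auto simp: dist_real_def)
  then show ?thesis by (rule lipschitz_on_continuous_on)
qed

lemma \<psi>_cont: "continuous_on UNIV \<psi>"
proof -
  have "(M * W)-lipschitz_on UNIV \<psi>"
  proof (rule lipschitz_onI)
    show "dist (\<psi> x) (\<psi> y) \<le> M * W * dist x y" for x y
      using \<psi>_lip[of x y] mult_left_mono[OF H_upper[of x y] M_nonneg]
      by (simp add: dist_real_def mult.assoc)
  qed (use M_nonneg W_ge_1 in simp)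
  then show ?thesis by (rule lipschitz_on_continuous_on)
qed

lemma \<phi>_cont: "continuous_on UNIV \<phi>"
  unfolding \<phi>_eq[abs_def]
  by (intro continuous_intros \<psi>_cont u_cont continuous_on_compose2[OF u_cont cont]) auto

lemma sum_\<phi>: "(\<Sum>i<n. \<phi> ((F ^^ i) x)) = (\<Sum>i<n. \<psi> ((F ^^ i) x)) + u ((F ^^ n) x) - u x"
  by (induction n) (simp_all add: \<phi>_eq)

lemma mean_\<Gamma>: "(\<Sum>x\<in>\<Gamma>. \<phi> x) = real N * a"
  using sum_\<phi>[where n = N and x = q] a periodic_of_int[of u q l, OF u_per]
  by (simp add: sum_\<Gamma>[of \<phi>, OF \<phi>_per] q)

definition outside :: "real set" where "outside = {x. \<not> near x}"

lemma near_per: "near (x + of_int k) \<longleftrightarrow> near x"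
proof -
  have *: "near (x + of_int k)" if nx: "near x" for x k
  proof -
    obtain o' where "o' \<in> Orb" "\<bar>H x - H o'\<bar> < r" using nx unfolding near_def by blast
    moreover from this(1) obtain i m where "i < N" "o' = (F ^^ i) q + of_int m" by (rule OrbE)
    moreover from this have "o' + of_int k = (F ^^ i) q + of_int (m + k)" by simp
    then have "o' + of_int k \<in> Orb" using OrbI[OF \<open>i < N\<close>] by (simp only:)
    ultimately show ?thesis unfolding near_def using H_int_diff by metis
  qed
  show ?thesis using *[of x k] *[of "x + of_int k" "- k"] by auto
qed

lemma outside_closed: "closed outside"
proof -
  have "outside = (\<Inter>o'\<in>Orb. {x. r \<le> \<bar>H x - H o'\<bar>})"
    unfolding outside_def near_def by (auto simp: not_less)
  moreover have "closed {x. r \<le> \<bar>H x - H o'\<bar>}" for o'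
    by (intro closed_Collect_le continuous_intros H_cont)
  ultimately show ?thesis by auto
qed

text \<open>\<open>ln |deriv F x|\<close> and \<open>\<psi>\<close> differ by a coboundary of the
  bounded function \<open>u\<close>, which changes Birkhoff sums by at most \<open>2 * Bu\<close>;
  otherwise the sums of \<open>g\<close> are the sums of \<open>gap\<close>.\<close>

lemma lyap_ge:
  assumes "invariant_measure F \<mu>"
  shows "lyap F \<mu> \<ge> a + b * measure \<mu> outside"
proof -
  interpret I: invariant_lift F d \<mu> by unfold_locales (use cont per assms in auto)
  define g where "g x = \<phi> x - a - b * indicator outside x" for x
  obtain B\<phi> where B\<phi>: "\<And>x. \<bar>\<phi> x\<bar> \<le> B\<phi>" using continuous_periodic_bounded[OF \<phi>_cont \<phi>_per] by blast
  obtain Bu where Bu: "\<And>x. \<bar>u x\<bar> \<le> Bu" using continuous_periodic_bounded[OF u_cont u_per] by blast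
  have out: "outside \<in> sets borel" using outside_closed by (rule borel_closed)
  have \<phi>m: "\<phi> \<in> borel_measurable borel" using \<phi>_cont by (rule borel_measurable_continuous_onI)
  have "(\<integral>x. g x \<partial>\<mu>) \<ge> 0"
  proof (rule I.integral_nonneg_of_birkhoff[where B = "B\<phi> + \<bar>a\<bar> + b" and K = "E + 2 * Bu"])
    show "g \<in> borel_measurable borel" unfolding g_def using \<phi>m out by measurable
    show "\<bar>g x\<bar> \<le> B\<phi> + \<bar>a\<bar> + b" for x
      unfolding g_def using B\<phi>[of x] b by (auto simp: indicator_def)
    show "g (x + 1) = g x" for x
      using near_per[of x 1] by (simp add: g_def \<phi>_per indicator_def outside_def)
    show "(\<Sum>i<n. g ((F ^^ i) x)) \<ge> - (E + 2 * Bu)" for n x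
    proof -
      have "g y = gap y + (\<phi> y - \<psi> y)" for y
        by (simp add: g_def gap_def indicator_def outside_def)
      then have "(\<Sum>i<n. g ((F ^^ i) x)) = (\<Sum>i<n. gap ((F ^^ i) x)) + u ((F ^^ n) x) - u x"
        using sum_\<phi>[where n = n and x = x] by (simp add: sum.distrib sum_subtractf)
      then show ?thesis
        using gap_sums[where n = n and x = x] Bu[of x] Bu[of "(F ^^ n) x"] by linarith
    qed
  qed
  moreover have "(\<integral>x. g x \<partial>\<mu>) = lyap F \<mu> - a - b * measure \<mu> outside"
  proof -
    have i1: "integrable \<mu> \<phi>" using B\<phi> I.meas[OF \<phi>m] by (intro I.integrable_const_bound[where B = B\<phi>]) auto
    have i2: "integrable \<mu> (indicator outside :: real \<Rightarrow> real)" using out I.sets_mu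
      by (intro integrable_real_indicator) (auto simp: I.emeasure_eq_measure)
    have "(\<integral>x. g x \<partial>\<mu>) = (\<integral>x. \<phi> x \<partial>\<mu>) - (\<integral>x. a \<partial>\<mu>) - b * (\<integral>x. indicator outside x \<partial>\<mu>)"
      unfolding g_def using i1 i2 by simp
    also have "(\<integral>x. indicator outside x \<partial>\<mu>) = measure \<mu> outside" using out I.sets_mu I.space_mu by simp
    finally show ?thesis by (simp add: lyap_def \<phi>_def I.prob_space)
  qed
  ultimately show ?thesis by simp
qed

lemma Orb_frac: "x \<in> Orb \<Longrightarrow> frac x \<in> \<Gamma>"
proof -
  assume "x \<in> Orb"
  then obtain i k where "i < N" "x = (F ^^ i) q + of_int k" by (rule OrbE)
  then have "frac x = (circ_map F ^^ i) x0" by (simp add: circ_iter)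
  then show ?thesis unfolding \<Gamma>_def by blast
qed

text \<open>By \<open>lyap_ge\<close> the set \<open>outside\<close> has measure 0, so almost every
  orbit stays near forever and lies on the periodic orbit. Invariance lets the mass of a point only
  grow when passing to its image; around a cycle it must be constant.\<close>

lemma minimizing_orbit_measure:
  assumes inv: "invariant_measure F \<mu>" and le: "lyap F \<mu> \<le> a"
  shows "is_orbit_measure \<Gamma> \<mu>"
proof -
  interpret I: invariant_lift F d \<mu> by unfold_locales (use cont per inv in auto)
  have out: "outside \<in> sets \<mu>" using outside_closed I.sets_mu by simp
  have "measure \<mu> outside = 0"
  proof -
    have "b * measure \<mu> outside \<le> 0" using lyap_ge[OF inv] le by linarith
    then show ?thesis using b by (simp add: mult_le_0_iff order_antisym)
  qed
  then have "AE x in \<mu>. x \<notin> outside" using out AE_iff_measurable[OF out, of "\<lambda>x. x \<notin> outside"]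
    by (simp add: I.emeasure_eq_measure I.space_mu)
  then have "AE x in \<mu>. near x" by (simp add: outside_def)
  then have "AE x in \<mu>. \<forall>i. near ((circ_map F ^^ i) x)"
    using I.AE_circ_iter by (subst AE_all_countable) blast
  then have conc: "AE x in \<mu>. x \<in> \<Gamma>" using I.AE_unit
  proof eventually_elim
    case (elim x)
    have "near ((F ^^ i) x)" for i
    proof -
      have "near (frac ((F ^^ i) x))" using elim I.circ_iter_frac[of x i] by metis
      then show ?thesis using near_per[of "frac ((F ^^ i) x)" "\<lfloor>(F ^^ i) x\<rfloor>"] by (simp add: frac_def)
    qed
    then have "frac x \<in> \<Gamma>" by (intro Orb_frac near_forever)
    then show ?case using elim by (simp add: frac_eq)
  qed
  have single: "{x} \<in> sets \<mu>" for x using I.sets_mu by simp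
  define m where "m i = measure \<mu> {(circ_map F ^^ i) x0}" for i
  have mono: "m i \<le> m (Suc i)" for i
  proof -
    have S: "circ_map F -` {(circ_map F ^^ Suc i) x0} \<inter> space \<mu> \<in> sets \<mu>"
      by (rule measurable_sets[OF I.circ_meas]) simp
    have "m i \<le> measure \<mu> (circ_map F -` {(circ_map F ^^ Suc i) x0} \<inter> space \<mu>)"
      unfolding m_def using S by (intro I.finite_measure_mono) (auto simp: I.space_mu)
    also have "\<dots> = measure (distr \<mu> borel (circ_map F)) {(circ_map F ^^ Suc i) x0}"
      by (rule measure_distr[symmetric]) (use I.circ_meas in auto)
    also have "\<dots> = m (Suc i)" by (simp add: I.distr_mu m_def)
    finally show ?thesis .
  qed
  have mono': "m i \<le> m j" if "i \<le> j" for i j using that mono by (rule lift_Suc_mono_le[rotated])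
  have mN: "m N = m 0" by (simp add: m_def circ_period)
  have const: "m i = m 0" if "i < N" for i
    using mono'[of 0 i] mono'[of i N] mN that by simp
  have m\<Gamma>: "measure \<mu> {x} = m 0" if "x \<in> \<Gamma>" for x
    using that const unfolding \<Gamma>_eq m_def by auto
  have "\<Gamma> \<in> sets \<mu>" using I.sets_mu finite_\<Gamma> by (simp add: finite_imp_closed)
  have sumA: "measure \<mu> (\<Gamma> \<inter> A) = real (card (\<Gamma> \<inter> A)) * m 0" for A
  proof -
    have "measure \<mu> (\<Gamma> \<inter> A) = (\<Sum>x\<in>\<Gamma> \<inter> A. measure \<mu> {x})"
      using finite_\<Gamma> single by (intro I.finite_measure_eq_sum_singleton) auto
    then show ?thesis using m\<Gamma> by simp
  qed
  have "measure \<mu> \<Gamma> = 1" using conc \<open>\<Gamma> \<in> sets \<mu>\<close> I.prob_eq_1 by blast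
  then have m0: "m 0 = 1 / real N" using sumA[of UNIV] card_\<Gamma> N by (simp add: field_simps)
  show ?thesis unfolding is_orbit_measure_def
  proof (intro conjI ballI)
    show "sets \<mu> = sets borel" by (rule I.sets_mu)
    fix A :: "real set" assume A: "A \<in> sets borel"
    have "measure \<mu> A = measure \<mu> (\<Gamma> \<inter> A)"
      using conc A I.sets_mu \<open>\<Gamma> \<in> sets \<mu>\<close> by (intro I.finite_measure_eq_AE) auto
    then show "emeasure \<mu> A = ennreal (real (card (\<Gamma> \<inter> A)) / real (card \<Gamma>))"
      unfolding I.emeasure_eq_measure by (simp add: sumA m0 card_\<Gamma>)
  qed
qed

definition \<mu>0 :: "real measure" where "\<mu>0 = distr (measure_pmf (pmf_of_set \<Gamma>)) borel (\<lambda>x. x)"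

lemma sets_\<mu>0: "sets \<mu>0 = sets borel" by (simp add: \<mu>0_def)

lemma emeasure_\<mu>0:
  assumes "A \<in> sets borel"
  shows "emeasure \<mu>0 A = ennreal (real (card (\<Gamma> \<inter> A)) / real (card \<Gamma>))"
  unfolding \<mu>0_def using assms
  by (subst emeasure_distr) (auto simp: emeasure_pmf_of_set[OF \<Gamma>_nonempty finite_\<Gamma>] Int_commute)

lemma circ_\<Gamma>: "bij_betw (circ_map F) \<Gamma> \<Gamma>"
proof -
  have sub: "\<Gamma> \<subseteq> circ_map F ` \<Gamma>"
  proof
    fix x assume "x \<in> \<Gamma>"
    then obtain k where k: "x = (circ_map F ^^ k) x0" unfolding \<Gamma>_def by auto
    have "x = (circ_map F ^^ (k + N)) x0" by (simp add: funpow_add circ_period k)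
    also have "\<dots> = circ_map F ((circ_map F ^^ (k + N - 1)) x0)"
      using N funpow.simps(2)[of "k + N - 1" "circ_map F"] by simp
    finally show "x \<in> circ_map F ` \<Gamma>" unfolding \<Gamma>_def by blast
  qed
  moreover have "circ_map F ` \<Gamma> \<subseteq> \<Gamma>"
    unfolding \<Gamma>_def by (auto intro: range_eqI[of _ _ "Suc _"])
  ultimately have "circ_map F ` \<Gamma> = \<Gamma>" by blast
  then show ?thesis using finite_\<Gamma> eq_card_imp_inj_on[of \<Gamma> "circ_map F"] by (simp add: bij_betw_def)
qed

lemma invariant_\<mu>0: "invariant_measure F \<mu>0"
  unfolding invariant_measure_def
proof (intro conjI)
  show "sets \<mu>0 = sets borel" by (rule sets_\<mu>0)
  show "prob_space \<mu>0" unfolding \<mu>0_def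
    by (rule prob_space.prob_space_distr) (auto simp: measure_pmf.prob_space_axioms)
  have "\<Gamma> \<subseteq> {0..<1}" unfolding \<Gamma>_def circ_iter by (auto simp: frac_lt_1)
  then have "\<Gamma> \<inter> {0..<1} = \<Gamma>" by blast
  then show "emeasure \<mu>0 {0..<1} = 1" using card_\<Gamma> N by (simp add: emeasure_\<mu>0)
  have cm: "circ_map F \<in> measurable \<mu>0 borel"
    using circ_map_measurable[OF cont] measurable_cong_sets[OF sets_\<mu>0 refl] by blast
  show "distr \<mu>0 borel (circ_map F) = \<mu>0"
  proof (rule measure_eqI)
    show "sets (distr \<mu>0 borel (circ_map F)) = sets \<mu>0" by (simp add: sets_\<mu>0)
    fix A assume "A \<in> sets (distr \<mu>0 borel (circ_map F))"
    then have A: "A \<in> sets borel" by simp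
    have pre: "circ_map F -` A \<in> sets borel"
      using measurable_sets[OF circ_map_measurable[OF cont] A] by simp
    have "circ_map F ` (\<Gamma> \<inter> circ_map F -` A) = circ_map F ` \<Gamma> \<inter> A" by auto
    then have "circ_map F ` (\<Gamma> \<inter> circ_map F -` A) = \<Gamma> \<inter> A" using circ_\<Gamma> by (simp add: bij_betw_def)
    moreover have "inj_on (circ_map F) (\<Gamma> \<inter> circ_map F -` A)"
      using circ_\<Gamma> by (auto simp: bij_betw_def inj_on_def)
    ultimately have "card (\<Gamma> \<inter> circ_map F -` A) = card (\<Gamma> \<inter> A)" using card_image by metis
    moreover have "space \<mu>0 = UNIV" by (simp add: \<mu>0_def)
    ultimately show "emeasure (distr \<mu>0 borel (circ_map F)) A = emeasure \<mu>0 A"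
      using emeasure_distr[OF cm A] by (simp add: emeasure_\<mu>0 A pre)
  qed
qed

lemma lyap_\<mu>0: "lyap F \<mu>0 = a"
proof -
  have "lyap F \<mu>0 = (\<integral>x. \<phi> x \<partial>(measure_pmf (pmf_of_set \<Gamma>)))"
    unfolding lyap_def \<mu>0_def \<phi>_def[symmetric]
    by (rule integral_distr) (use \<phi>_cont in \<open>auto intro: borel_measurable_continuous_onI\<close>)
  also have "\<dots> = (\<Sum>x\<in>\<Gamma>. \<phi> x) / real (card \<Gamma>)"
    by (rule integral_pmf_of_set[OF \<Gamma>_nonempty finite_\<Gamma>])
  finally show ?thesis using mean_\<Gamma> card_\<Gamma> N by simp
qed

lemma unique_periodic_minimizer:
  "(\<exists>!\<mu>. lyap_minimizing F \<mu>) \<and>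
   (\<forall>\<mu>. lyap_minimizing F \<mu> \<longrightarrow> (\<exists>\<Gamma>. periodic_orbit F \<Gamma> \<and> is_orbit_measure \<Gamma> \<mu>))"
proof -
  have ge: "a \<le> lyap F \<mu>" if "invariant_measure F \<mu>" for \<mu>
    using lyap_ge[OF that] b measure_nonneg[of \<mu> outside] by (smt (verit) mult_nonneg_nonneg)
  have alpha: "alpha F = a"
    unfolding alpha_def using ge invariant_\<mu>0 lyap_\<mu>0
    by (intro cInf_eq_minimum) (auto intro!: image_eqI[of _ _ \<mu>0])
  have min0: "lyap_minimizing F \<mu>0"
    using invariant_\<mu>0 lyap_\<mu>0 alpha by (simp add: lyap_minimizing_def)
  have om: "is_orbit_measure \<Gamma> \<mu>" if "lyap_minimizing F \<mu>" for \<mu>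
    using that minimizing_orbit_measure alpha by (simp add: lyap_minimizing_def)
  have "\<mu> = \<mu>0" if "lyap_minimizing F \<mu>" for \<mu>
    using om[OF that] om[OF min0] unfolding is_orbit_measure_def
    by (intro measure_eqI) auto
  then show ?thesis using min0 om periodic_orbit_\<Gamma> by blast
qed

end

section \<open>Adapted coordinates\<close>

lemma continuous_periodic_uniform:
  fixes g :: "real \<Rightarrow> real"
  assumes "continuous_on UNIV g" and per: "\<And>x. g (x + 1) = g x" and "e > 0"
  shows "\<exists>\<delta>>0. \<forall>x y. \<bar>x - y\<bar> \<le> \<delta> \<longrightarrow> \<bar>g x - g y\<bar> \<le> e"
proof -
  have "uniformly_continuous_on {-1..2} g"
    by (intro compact_uniformly_continuous continuous_on_subset[OF assms(1)]) auto
  then obtain \<delta> where \<delta>: "\<delta> > 0" and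
    unif: "\<And>x y. x \<in> {-1..2} \<Longrightarrow> y \<in> {-1..2} \<Longrightarrow> dist y x < \<delta> \<Longrightarrow> dist (g y) (g x) < e"
    unfolding uniformly_continuous_on_def using \<open>e > 0\<close> by metis
  have "\<bar>g x - g y\<bar> \<le> e" if "\<bar>x - y\<bar> \<le> min (\<delta> / 2) 1" for x y
  proof -
    define k where "k = - \<lfloor>x\<rfloor>"
    have "x + of_int k \<in> {-1..2}" "y + of_int k \<in> {-1..2}"
      using that unfolding k_def by (auto simp: abs_le_iff) linarith+
    moreover have "dist (x + of_int k) (y + of_int k) < \<delta>"
      using that \<delta> by (simp add: dist_real_def)
    ultimately have "dist (g (x + of_int k)) (g (y + of_int k)) < e" by (intro unif)
    then show ?thesis by (simp add: periodic_of_int[of g, OF per] dist_real_def)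
  qed
  then show ?thesis using \<delta> by (intro exI[of _ "min (\<delta> / 2) 1"]) auto
qed

section \<open>Iterates of C2 lifts and their derivatives\<close>

lemma deriv_shift:
  fixes F :: "real \<Rightarrow> real"
  assumes "\<And>x. F (x + 1) = F x + c" and "\<And>x. F differentiable at x"
  shows "deriv F (x + 1) = deriv F x"
proof -
  have D: "(F has_real_derivative deriv F y) (at y)" for y
    using assms(2)[of y] DERIV_deriv_iff_real_differentiable by blast
  have "((\<lambda>y. F (y + 1)) has_real_derivative deriv F (x + 1)) (at x)"
    using D[of "x + 1"] DERIV_shift[of F "deriv F (x + 1)" x 1] by simp
  moreover have "((\<lambda>y. F (y + 1)) has_real_derivative deriv F x) (at x)"
    unfolding assms(1) using DERIV_add[OF D[of x] DERIV_const[of c]] by simp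
  ultimately show ?thesis by (rule DERIV_unique)
qed

locale C2_circle =
  fixes F :: "real \<Rightarrow> real" and d :: int
  assumes diff1: "F differentiable at x" and diff2: "deriv F differentiable at x"
    and cont2: "continuous_on UNIV (deriv (deriv F))"
    and Fper: "F (x + 1) = F x + of_int d"
begin

lemma D1: "(F has_real_derivative deriv F x) (at x)"
  using diff1 DERIV_deriv_iff_real_differentiable by blast

lemma D2: "(deriv F has_real_derivative deriv (deriv F) x) (at x)"
  using diff2 DERIV_deriv_iff_real_differentiable by blast

lemma cont0: "continuous_on UNIV F"
  using D1 by (meson DERIV_isCont continuous_at_imp_continuous_on)

lemma cont1: "continuous_on UNIV (deriv F)"
  using D2 by (meson DERIV_isCont continuous_at_imp_continuous_on)

lemma per1: "deriv F (x + 1) = deriv F x"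
  by (rule deriv_shift[OF Fper diff1])

lemma per2: "deriv (deriv F) (x + 1) = deriv (deriv F) x"
  by (rule deriv_shift[where c = 0]) (simp_all add: per1 diff2)

definition Pn :: "nat \<Rightarrow> real \<Rightarrow> real" where "Pn n x = (\<Prod>j<n. deriv F ((F ^^ j) x))"

lemma DERIV_iter: "((F ^^ n) has_real_derivative Pn n x) (at x)"
proof (induction n)
  case 0
  then show ?case by (simp add: Pn_def id_def)
next
  case (Suc n)
  have "((\<lambda>x. F ((F ^^ n) x)) has_real_derivative deriv F ((F ^^ n) x) * Pn n x) (at x)"
    by (rule DERIV_chain2[OF D1 Suc])
  then show ?case by (simp add: Pn_def o_def mult.commute)
qed

lemma deriv_iter: "deriv (F ^^ n) x = Pn n x"
  by (rule DERIV_imp_deriv[OF DERIV_iter])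

lemma iter_cont: "continuous_on UNIV (F ^^ n)"
  using DERIV_iter by (meson DERIV_isCont continuous_at_imp_continuous_on)

lemma Pn_cont: "continuous_on UNIV (Pn n)"
  unfolding Pn_def[abs_def]
  by (intro continuous_on_prod continuous_on_compose2[OF cont1 iter_cont]) auto

lemma iter_int: "(F ^^ n) (x + of_int k) = (F ^^ n) x + of_int (d ^ n * k)"
proof (induction n)
  case (Suc n)
  have "(F ^^ Suc n) (x + of_int k) = F ((F ^^ n) x + of_int (d ^ n * k))" using Suc by simp
  also have "\<dots> = (F ^^ Suc n) x + of_int (d ^ Suc n * k)"
    using shift_of_int[of F "of_int d" _ "d ^ n * k", OF Fper] by (simp add: mult_ac)
  finally show ?case .
qed simp

lemma Pn_per: "Pn n (x + 1) = Pn n x"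
proof -
  have "deriv F ((F ^^ j) (x + 1)) = deriv F ((F ^^ j) x)" for j
    using iter_int[of j x 1] periodic_of_int[of "deriv F" _ "d ^ j", OF per1] by simp
  then show ?thesis unfolding Pn_def by simp
qed

lemma Pn_Suc: "Pn (Suc n) x = deriv F x * Pn n (F x)"
proof -
  have "Pn (Suc n) x = deriv F x * (\<Prod>j<n. deriv F ((F ^^ Suc j) x))"
    unfolding Pn_def by (subst prod.lessThan_Suc_shift) simp
  then show ?thesis unfolding Pn_def by (simp only: funpow_Suc_right o_apply)
qed

end

lemma C2_lift_locale:
  assumes "C2_lift F"
  shows "\<exists>d. C2_circle F d"
  using assms unfolding C2_lift_def C2_circle_def by blast

lemma nonvanishing_sign:
  fixes g :: "real \<Rightarrow> real"
  assumes "continuous_on UNIV g" and "\<And>x. g x \<noteq> 0"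
  shows "\<exists>s::real. (s = 1 \<or> s = - 1) \<and> (\<forall>x. s * g x = \<bar>g x\<bar>)"
proof -
  have conn: "connected (g ` UNIV)" using assms(1) by (intro connected_continuous_image) auto
  have "(\<forall>x. g x > 0) \<or> (\<forall>x. g x < 0)"
  proof (rule ccontr)
    assume "\<not> ?thesis"
    then obtain x y where "g x \<le> 0" "0 \<le> g y" by (meson not_less)
    then have "0 \<in> g ` UNIV" using conn by (meson UNIV_I atLeastAtMost_iff connected_contains_Icc imageI subsetD)
    then show False using assms(2) by auto
  qed
  then show ?thesis
  proof
    assume "\<forall>x. g x > 0"
    then show ?thesis by (intro exI[of _ 1]) (auto simp: less_imp_le)
  next
    assume "\<forall>x. g x < 0"
    then show ?thesis by (intro exI[of _ "- 1"]) (auto simp: less_imp_le)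
  qed
qed

text \<open>The density \<open>w\<close> is Mather's adapted metric: with it the map expands in a single step.
  Since \<open>F\<close> is monotone on the line, its primitive \<open>H\<close> is an explicit combination of iterates.\<close>

lemma adapted_coordinate:
  assumes "C2_circle F d" and "expanding_lift F"
  shows "\<exists>\<sigma> H w W c lam m0. (\<sigma> = 1 \<or> \<sigma> = (- 1 :: real)) \<and> lam > 1 \<and> m0 > 0 \<and>
    (\<forall>x. (H has_real_derivative w x) (at x)) \<and> continuous_on UNIV w \<and> (\<forall>x. w (x + 1) = w x) \<and>
    (\<forall>x. 1 \<le> w x \<and> w x \<le> W) \<and> (\<forall>x. H (x + 1) = H x + c) \<and>
    (\<forall>x. m0 \<le> \<sigma> * deriv F x) \<and> (\<forall>x. lam * w x \<le> \<sigma> * deriv F x * w (F x))"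
proof -
  interpret C2_circle F d by fact
  obtain C l where C: "C > 0" and l: "l > 1" and exp: "\<And>x n. n \<ge> 1 \<Longrightarrow> C * l ^ n \<le> \<bar>deriv (F ^^ n) x\<bar>"
    using assms(2) unfolding expanding_lift_def by blast
  have low: "C * l \<le> \<bar>deriv F x\<bar>" for x using exp[of 1 x] by simp
  have Cl: "C * l > 0" using C l by simp
  obtain \<sigma> where \<sigma>: "\<sigma> = 1 \<or> \<sigma> = (- 1 :: real)" and \<sigma>F: "\<And>x. \<sigma> * deriv F x = \<bar>deriv F x\<bar>"
  proof -
    have "deriv F x \<noteq> 0" for x using low[of x] Cl by auto
    then show ?thesis using nonvanishing_sign[OF cont1] that by blast
  qed
  \<comment> \<open>Any rate strictly between 1 and \<open>l\<close> leaves a surplus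
    \<open>l / lam > 1\<close> whose powers eventually absorb the constant \<open>C\<close>;
    \<open>N\<close> is such a time.\<close>
  define lam where "lam = (1 + l) / 2"
  have lam: "lam > 1" "lam < l" using l unfolding lam_def by auto
  have "1 < l / lam" using lam by simp
  then obtain n where n: "1 / C < (l / lam) ^ n" using real_arch_pow by blast
  define N where "N = Suc n"
  have "(l / lam) ^ n * 1 \<le> (l / lam) ^ n * (l / lam)" using \<open>1 < l / lam\<close> by (intro mult_left_mono) auto
  then have "1 / C < (l / lam) ^ N" using n unfolding N_def by (simp add: mult.commute)
  then have N: "lam ^ N \<le> C * l ^ N" using C lam by (simp add: power_divide field_simps)
  \<comment> \<open>The sign \<open>\<sigma> ^ i\<close> makes every term increasing, so the
    derivative of \<open>H\<close> is the sum of \<open>|Pn i x| / lam ^ i\<close>.\<close>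
  define H where "H x = (\<Sum>i<N. (\<sigma> / lam) ^ i * (F ^^ i) x)" for x
  define w where "w x = (\<Sum>i<N. (\<sigma> / lam) ^ i * Pn i x)" for x
  define P where "P i x = \<bar>Pn i x\<bar> / lam ^ i" for i x
  have \<sigma>P: "\<sigma> ^ i * Pn i x = \<bar>Pn i x\<bar>" for i x
    unfolding Pn_def abs_prod by (simp add: \<sigma>F[symmetric] prod.distrib)
  have wP: "w x = (\<Sum>i<N. P i x)" for x
    unfolding w_def P_def using \<sigma>P by (simp add: power_divide)
  have P0: "P 0 x = 1" for x by (simp add: P_def Pn_def)
  have Pnn: "P i x \<ge> 0" for i x using lam unfolding P_def by simp
  have Hd: "(H has_real_derivative w x) (at x)" for x
    unfolding H_def w_def by (intro DERIV_sum DERIV_cmult DERIV_iter)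
  have wc: "continuous_on UNIV w" unfolding w_def[abs_def] by (intro continuous_intros Pn_cont)
  have wper: "w (x + 1) = w x" for x unfolding w_def Pn_per ..
  have w1: "1 \<le> w x" for x
  proof -
    have "P 0 x \<le> (\<Sum>i<N. P i x)" by (rule member_le_sum) (auto simp: N_def Pnn)
    then show ?thesis by (simp add: wP P0)
  qed
  obtain W where wW: "\<And>x. w x \<le> W"
    using continuous_periodic_bounded[OF wc wper] by (metis abs_le_D1)
  have Hp: "H (x + 1) = H x + (\<Sum>i<N. (\<sigma> / lam) ^ i * of_int (d ^ i))" for x
    unfolding H_def using iter_int[of _ x 1] by (simp add: algebra_simps sum.distrib)
  have ex: "lam * w x \<le> \<sigma> * deriv F x * w (F x)" for x
  proof -
    have step: "\<bar>deriv F x\<bar> * P i (F x) = lam * P (Suc i) x" for i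
      using lam unfolding P_def Pn_Suc by (simp add: abs_mult field_simps)
    have "C * l ^ N \<le> \<bar>Pn N x\<bar>" using exp[of N x] unfolding deriv_iter by (simp add: N_def)
    then have "P N x \<ge> 1" unfolding P_def using N lam by (subst le_divide_eq_1_pos) auto
    \<comment> \<open>Passing to \<open>F x\<close> shifts the sum by one: the term
      \<open>P 0 x = 1\<close> is lost and \<open>P N x\<close>, at least 1, is gained.\<close>
    have "(\<Sum>i<N. P (Suc i) x) = w x + P N x - P 0 x"
      unfolding wP using sum.lessThan_Suc_shift[of "\<lambda>i. P i x" N] by simp
    then have "w x \<le> (\<Sum>i<N. P (Suc i) x)" using \<open>P N x \<ge> 1\<close> P0 by simp
    then have "lam * w x \<le> lam * (\<Sum>i<N. P (Suc i) x)" using lam by simp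
    also have "\<dots> = \<sigma> * deriv F x * w (F x)"
      unfolding wP \<sigma>F sum_distrib_left by (simp add: step)
    finally show ?thesis .
  qed
  have "C * l \<le> \<sigma> * deriv F x" for x unfolding \<sigma>F by (rule low)
  note facts = \<sigma> lam(1) Cl Hd wc wper w1 wW Hp this ex
  show ?thesis
    by (rule exI[of _ \<sigma>], rule exI[of _ H], rule exI[of _ w], rule exI[of _ W],
        rule exI[of _ "\<Sum>i<N. (\<sigma> / lam) ^ i * of_int (d ^ i)"], rule exI[of _ lam],
        rule exI[of _ "C * l"]) (intro conjI allI facts)
qed

section \<open>Lengths and expansion in the adapted coordinate\<close>

locale adapted_density =
  fixes H w :: "real \<Rightarrow> real" and W c :: real
  assumes H_deriv: "(H has_real_derivative w x) (at x)"
    and w_cont: "continuous_on UNIV w" and w_per: "w (x + 1) = w x"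
    and w_bounds: "1 \<le> w x" "w x \<le> W" and Hper: "H (x + 1) = H x + c"
begin

lemma H_mvt: "\<exists>z. H x - H y = (x - y) * w z"
proof (cases x y rule: linorder_cases)
  case less
  then obtain z where "H y - H x = (y - x) * w z" using MVT2[OF less H_deriv] by auto
  then show ?thesis by (intro exI[of _ z]) (simp add: algebra_simps)
next
  case greater
  then obtain z where "H x - H y = (x - y) * w z" using MVT2[OF greater H_deriv] by auto
  then show ?thesis by blast
qed simp

lemma H_diff_abs: "\<exists>z. \<bar>H x - H y\<bar> = \<bar>x - y\<bar> * w z"
proof -
  obtain z where z: "H x - H y = (x - y) * w z" using H_mvt by blast
  have "\<bar>w z\<bar> = w z" using w_bounds(1)[of z] by linarith
  then show ?thesis unfolding z abs_mult by metis
qed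

lemma H_low: "\<bar>x - y\<bar> \<le> \<bar>H x - H y\<bar>"
proof -
  obtain z where z: "\<bar>H x - H y\<bar> = \<bar>x - y\<bar> * w z" using H_diff_abs by blast
  have "\<bar>x - y\<bar> * 1 \<le> \<bar>x - y\<bar> * w z" by (intro mult_left_mono w_bounds) simp
  then show ?thesis unfolding z by simp
qed

lemma H_up: "\<bar>H x - H y\<bar> \<le> W * \<bar>x - y\<bar>"
proof -
  obtain z where z: "\<bar>H x - H y\<bar> = \<bar>x - y\<bar> * w z" using H_diff_abs by blast
  have "\<bar>x - y\<bar> * w z \<le> \<bar>x - y\<bar> * W" by (intro mult_left_mono w_bounds) simp
  then show ?thesis unfolding z by (simp add: mult.commute)
qed

text \<open>Since the sign \<open>\<sigma>\<close> is the same everywhere,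
  \<open>\<sigma> * H (S t) - l * H t\<close> is nondecreasing on the whole line; this turns the
  pointwise inequality into one for arbitrary pairs of points.\<close>

lemma expand_of_deriv:
  fixes S S' :: "real \<Rightarrow> real"
  assumes \<sigma>: "\<sigma> = 1 \<or> \<sigma> = (- 1 :: real)"
    and S: "\<And>x. (S has_real_derivative S' x) (at x)"
    and low: "\<And>x. l * w x \<le> \<sigma> * S' x * w (S x)" and l: "l > 0"
  shows "l * \<bar>H x - H y\<bar> \<le> \<bar>H (S x) - H (S y)\<bar>"
proof -
  have *: "l * \<bar>H x - H y\<bar> \<le> \<bar>H (S x) - H (S y)\<bar>" if xy: "x \<le> y" for x y
  proof -
    define g where "g t = \<sigma> * H (S t) - l * H t" for t
    have "(g has_real_derivative \<sigma> * (w (S t) * S' t) - l * w t) (at t)" for t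
      unfolding g_def by (intro DERIV_diff DERIV_cmult DERIV_chain2[OF H_deriv S] H_deriv)
    moreover have "\<sigma> * (w (S t) * S' t) - l * w t \<ge> 0" for t using low[of t] by (simp add: mult_ac)
    ultimately have "g x \<le> g y" using DERIV_nonneg_imp_nondecreasing[OF xy, of g] by blast
    then have "l * (H y - H x) \<le> \<sigma> * (H (S y) - H (S x))" unfolding g_def by (simp add: algebra_simps)
    also have "\<dots> \<le> \<bar>H (S x) - H (S y)\<bar>" using \<sigma> by auto
    finally have 1: "l * (H y - H x) \<le> \<bar>H (S x) - H (S y)\<bar>" .
    have "w t \<ge> 0" for t using w_bounds(1)[of t] by linarith
    then have "H x \<le> H y" using DERIV_nonneg_imp_nondecreasing[OF xy, of H] H_deriv by blast
    then show ?thesis using 1 by (simp add: abs_minus_commute)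
  qed
  show ?thesis using *[of x y] *[of y x] by (cases "x \<le> y") (auto simp: abs_minus_commute)
qed

text \<open>A C1-small change alters \<open>deriv F x * w (F x)\<close> through the value of
  \<open>w\<close> at the image and through the derivative, each by at most \<open>e\<close>. The
  total \<open>2 * e = lam - lam'\<close> is affordable since \<open>w \<ge> 1\<close>.\<close>

lemma perturbed_expansion:
  fixes F :: "real \<Rightarrow> real"
  assumes lam: "lam' < lam" and \<sigma>: "\<sigma> = 1 \<or> \<sigma> = (- 1 :: real)"
    and low: "\<And>x. lam * w x \<le> \<sigma> * deriv F x * w (F x)" and B1: "\<And>x. \<bar>deriv F x\<bar> \<le> B1"
  shows "\<exists>\<eta>>0. \<forall>S. (\<forall>x. \<bar>S x - F x\<bar> \<le> \<eta>) \<longrightarrow> (\<forall>x. \<bar>deriv S x - deriv F x\<bar> \<le> \<eta>) \<longrightarrow>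
     (\<forall>x. lam' * w x \<le> \<sigma> * deriv S x * w (S x))"
proof -
  define e where "e = (lam - lam') / 2"
  have e: "e > 0" using lam unfolding e_def by simp
  have B10: "B1 \<ge> 0" using B1[of 0] by linarith
  have W1: "W \<ge> 1" using w_bounds[of 0] by linarith
  obtain \<delta> where \<delta>: "\<delta> > 0" and unif: "\<And>x y. \<bar>x - y\<bar> \<le> \<delta> \<Longrightarrow> \<bar>w x - w y\<bar> \<le> e / (B1 + 1)"
    using continuous_periodic_uniform[OF w_cont w_per, of "e / (B1 + 1)"] e B10 by auto
  define \<eta> where "\<eta> = min \<delta> (e / W)"
  have "\<eta> > 0" using \<delta> e W1 unfolding \<eta>_def by simp
  moreover have "lam' * w x \<le> \<sigma> * deriv S x * w (S x)"
    if S0: "\<And>x. \<bar>S x - F x\<bar> \<le> \<eta>" and S1: "\<And>x. \<bar>deriv S x - deriv F x\<bar> \<le> \<eta>" for S x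
  proof -
    have "\<bar>deriv F x\<bar> * \<bar>w (S x) - w (F x)\<bar> \<le> B1 * (e / (B1 + 1))"
      using S0[of x] unif[of "S x" "F x"] B1 B10 e unfolding \<eta>_def by (intro mult_mono) auto
    also have "\<dots> \<le> e" using B10 e by (simp add: field_simps)
    finally have 1: "\<bar>deriv F x * (w (S x) - w (F x))\<bar> \<le> e" by (simp add: abs_mult)
    have "\<bar>deriv S x - deriv F x\<bar> * \<bar>w (S x)\<bar> \<le> (e / W) * W"
      using S1[of x] w_bounds[of "S x"] e W1 unfolding \<eta>_def by (intro mult_mono) auto
    then have 2: "\<bar>(deriv S x - deriv F x) * w (S x)\<bar> \<le> e" using W1 by (simp add: abs_mult)
    have eq: "deriv S x * w (S x) = deriv F x * w (F x) + deriv F x * (w (S x) - w (F x))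
        + (deriv S x - deriv F x) * w (S x)" by (simp add: algebra_simps)
    have "\<sigma> * p \<ge> \<sigma> * f - 2 * e" if "\<bar>u\<bar> \<le> e" "\<bar>v\<bar> \<le> e" "p = f + u + v" for p f u v
      using \<sigma> that by auto
    from this[OF 1 2 eq]
    have "\<sigma> * (deriv S x * w (S x)) \<ge> \<sigma> * (deriv F x * w (F x)) - 2 * e" .
    moreover have "lam * w x - 2 * e \<ge> lam' * w x"
    proof -
      have "2 * e = lam - lam'" unfolding e_def by simp
      then have "lam * w x - lam' * w x = 2 * e * w x" by (simp add: left_diff_distrib)
      moreover have "2 * e * 1 \<le> 2 * e * w x" using e by (intro mult_left_mono w_bounds) simp
      ultimately show ?thesis by linarith
    qed
    ultimately show ?thesis using low[of x] by (simp add: mult.assoc)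
  qed
  ultimately show ?thesis by blast
qed

end

section \<open>The perturbation\<close>

text \<open>Each derivative lowers the power of the positive part by one, so the third power is
  still twice continuously differentiable. Hence the exponent 3 in the bump.\<close>

lemma pos_part_power_deriv:
  "((\<lambda>v. max 0 v ^ (n + 2)) has_real_derivative real (n + 2) * max 0 v ^ (n + 1)) (at (v::real))"
proof (cases v "0::real" rule: linorder_cases)
  case greater
  have "((\<lambda>v. v ^ (n + 2)) has_real_derivative real (n + 2) * max 0 v ^ (n + 1)) (at v)"
    using DERIV_pow[of "n + 2" v] greater by simp
  then show ?thesis
  proof (rule has_field_derivative_transform_within_open[where S = "{0<..}"])
    show "x ^ (n + 2) = max 0 x ^ (n + 2)" if "x \<in> {0<..}" for x :: real
    proof -
      have "max 0 x = x" using that by auto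
      then show ?thesis by simp
    qed
  qed (use greater in auto)
next
  case less
  have "((\<lambda>v. 0) has_real_derivative real (n + 2) * max 0 v ^ (n + 1)) (at v)"
    using less by (auto intro!: derivative_eq_intros)
  then show ?thesis
  proof (rule has_field_derivative_transform_within_open[where S = "{..<0}"])
    show "\<And>x::real. x \<in> {..<0} \<Longrightarrow> 0 = max 0 x ^ (n + 2)" by (auto simp: max_def)
  qed (use less in auto)
next
  case equal
  have "((\<lambda>h. max 0 h ^ (n + 2) / h) \<longlongrightarrow> 0) (at (0::real))"
  proof (rule Lim_null_comparison)
    show "\<forall>\<^sub>F h in at (0::real). norm (max 0 h ^ (n + 2) / h) \<le> max 0 h ^ (n + 1)"
      by (rule always_eventually) (auto simp: max_def)
    have "((\<lambda>h. max 0 h ^ (n + 1)) \<longlongrightarrow> max 0 0 ^ (n + 1)) (at (0::real))"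
      by (intro tendsto_intros)
    then show "((\<lambda>h. max 0 h ^ (n + 1)) \<longlongrightarrow> 0) (at (0::real))" by simp
  qed
  then show ?thesis using equal by (simp add: has_field_derivative_iff)
qed

definition bump_cut :: "real \<Rightarrow> real \<Rightarrow> real" where
  "bump_cut s t = max 0 (1 - (sin (pi * t) / s)\<^sup>2)"

text \<open>A periodic bump of width \<open>s\<close> around the integers whose derivative is minimal there;
  writing it in terms of \<open>sin (pi t)\<close> makes it periodic and twice differentiable at once.\<close>

definition bump0 :: "real \<Rightarrow> real \<Rightarrow> real" where
  "bump0 s t = - (sin (2 * pi * t) / (2 * pi)) * bump_cut s t ^ 3"

definition bump1 :: "real \<Rightarrow> real \<Rightarrow> real" where
  "bump1 s t = - cos (2 * pi * t) * bump_cut s t ^ 3 + 3 / 2 * (sin (2 * pi * t) / s)\<^sup>2 * bump_cut s t ^ 2"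

definition bump2 :: "real \<Rightarrow> real \<Rightarrow> real" where
  "bump2 s t = 2 * pi * sin (2 * pi * t) * bump_cut s t ^ 3
     + 9 * pi * cos (2 * pi * t) * sin (2 * pi * t) / s\<^sup>2 * bump_cut s t ^ 2
     - 3 * pi * sin (2 * pi * t) ^ 3 / s ^ 4 * bump_cut s t"

lemma bump_cut_bounds: "0 \<le> bump_cut s t" "bump_cut s t \<le> 1"
  unfolding bump_cut_def by auto

lemma bump_cut_power_deriv:
  assumes "s \<noteq> 0"
  shows "((\<lambda>t. bump_cut s t ^ (n + 2)) has_real_derivative
     - (real (n + 2) * bump_cut s t ^ (n + 1) * (pi * sin (2 * pi * t) / s\<^sup>2))) (at t)"
proof -
  have v: "((\<lambda>t. 1 - (sin (pi * t) / s)\<^sup>2) has_real_derivative - (pi * sin (2 * pi * t) / s\<^sup>2)) (at t)"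
  proof -
    have "sin (2 * pi * t) = 2 * sin (pi * t) * cos (pi * t)"
      using sin_double[of "pi * t"] by (simp add: mult.assoc)
    then show ?thesis using assms
      by (auto intro!: derivative_eq_intros simp: power2_eq_square field_simps)
  qed
  show ?thesis unfolding bump_cut_def
    using DERIV_chain2[OF pos_part_power_deriv[of n "1 - (sin (pi * t) / s)\<^sup>2"] v] by simp
qed

lemma bump0_deriv:
  assumes "s \<noteq> 0"
  shows "(bump0 s has_real_derivative bump1 s t) (at t)"
proof -
  have s: "((\<lambda>t. - (sin (2 * pi * t) / (2 * pi))) has_real_derivative - cos (2 * pi * t)) (at t)"
    by (auto intro!: derivative_eq_intros)
  have m: "((\<lambda>t. bump_cut s t ^ 3) has_real_derivative - (3 * bump_cut s t ^ 2 * (pi * sin (2 * pi * t) / s\<^sup>2))) (at t)"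
    using bump_cut_power_deriv[OF assms, of 1] by (simp add: numeral_3_eq_3 numeral_2_eq_2)
  show ?thesis unfolding bump0_def[abs_def] bump1_def
    using DERIV_mult[OF s m] by (simp add: power2_eq_square field_simps)
qed

lemma bump1_deriv:
  assumes "s \<noteq> 0"
  shows "(bump1 s has_real_derivative bump2 s t) (at t)"
proof -
  have c: "((\<lambda>t. - cos (2 * pi * t)) has_real_derivative 2 * pi * sin (2 * pi * t)) (at t)"
    by (auto intro!: derivative_eq_intros)
  have q: "((\<lambda>t. 3 / 2 * (sin (2 * pi * t) / s)\<^sup>2) has_real_derivative
      6 * pi * sin (2 * pi * t) * cos (2 * pi * t) / s\<^sup>2) (at t)"
    using assms by (auto intro!: derivative_eq_intros simp: power2_eq_square field_simps)
  have m3: "((\<lambda>t. bump_cut s t ^ 3) has_real_derivative - (3 * bump_cut s t ^ 2 * (pi * sin (2 * pi * t) / s\<^sup>2))) (at t)"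
    using bump_cut_power_deriv[OF assms, of 1] by (simp add: numeral_3_eq_3 numeral_2_eq_2)
  have m2: "((\<lambda>t. bump_cut s t ^ 2) has_real_derivative - (2 * bump_cut s t * (pi * sin (2 * pi * t) / s\<^sup>2))) (at t)"
    using bump_cut_power_deriv[OF assms, of 0] by (simp add: numeral_2_eq_2)
  have "(bump1 s has_real_derivative
     (2 * pi * sin (2 * pi * t) * bump_cut s t ^ 3
       + - (3 * bump_cut s t ^ 2 * (pi * sin (2 * pi * t) / s\<^sup>2)) * - cos (2 * pi * t)) +
     (6 * pi * sin (2 * pi * t) * cos (2 * pi * t) / s\<^sup>2 * bump_cut s t ^ 2
       + - (2 * bump_cut s t * (pi * sin (2 * pi * t) / s\<^sup>2)) * (3 / 2 * (sin (2 * pi * t) / s)\<^sup>2))) (at t)"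
    unfolding bump1_def[abs_def] by (intro DERIV_add DERIV_mult c q m2 m3)
  moreover have "(2 * pi * S * m ^ 3 + - (3 * m ^ 2 * (pi * S / s\<^sup>2)) * - C) +
     (6 * pi * S * C / s\<^sup>2 * m ^ 2 + - (2 * m * (pi * S / s\<^sup>2)) * (3 / 2 * (S / s)\<^sup>2))
     = 2 * pi * S * m ^ 3 + 9 * pi * C * S / s\<^sup>2 * m ^ 2 - 3 * pi * S ^ 3 / s ^ 4 * m" for S C m :: real
  proof -
    define k where "k = inverse (s\<^sup>2)"
    have k: "x / s\<^sup>2 = x * k" "x / s ^ 4 = x * (k * k)" "(x / s)\<^sup>2 = x\<^sup>2 * k" for x
      unfolding k_def by (simp_all add: divide_inverse power_mult_distrib power_inverse
          flip: inverse_mult_distrib power_add)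
    show ?thesis unfolding k by (simp add: algebra_simps power2_eq_square power3_eq_cube)
  qed
  ultimately show ?thesis unfolding bump2_def by (simp only:)
qed

lemma bump2_cont: "s \<noteq> 0 \<Longrightarrow> continuous_on UNIV (bump2 s)"
  unfolding bump2_def[abs_def] bump_cut_def[abs_def] by (intro continuous_intros) auto

lemma bump_cut_per: "bump_cut s (t + 1) = bump_cut s t"
  unfolding bump_cut_def by (simp add: distrib_left power_divide)

lemma trig_per: "sin (2 * pi * (t + 1)) = sin (2 * pi * t)" "cos (2 * pi * (t + 1)) = cos (2 * pi * t)"
  using sin_periodic[of "2 * pi * t"] cos_periodic[of "2 * pi * t"]
  by (simp_all add: distrib_left)

lemma bump_per: "bump0 s (t + 1) = bump0 s t" "bump1 s (t + 1) = bump1 s t" "bump2 s (t + 1) = bump2 s t"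
  unfolding bump0_def bump1_def bump2_def bump_cut_per trig_per by simp_all

lemma bump_cut_zero: "bump_cut s t = 0 \<Longrightarrow> bump0 s t = 0 \<and> bump1 s t = 0 \<and> bump2 s t = 0"
  unfolding bump0_def bump1_def bump2_def by simp

lemma bump_cut_pos_sin:
  assumes "s > 0" "bump_cut s t \<noteq> 0"
  shows "\<bar>sin (pi * t)\<bar> < s" "\<bar>sin (2 * pi * t)\<bar> \<le> 2 * \<bar>sin (pi * t)\<bar>"
proof -
  have "(sin (pi * t) / s)\<^sup>2 < 1" using assms(2) unfolding bump_cut_def by (auto simp: max_def split: if_splits)
  then have "\<bar>sin (pi * t) / s\<bar> < 1" by (simp add: abs_square_less_1)
  then show "\<bar>sin (pi * t)\<bar> < s" using assms by (simp add: abs_divide)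
  have "sin (2 * pi * t) = 2 * sin (pi * t) * cos (pi * t)"
    using sin_double[of "pi * t"] by (simp add: mult.assoc)
  then have "\<bar>sin (2 * pi * t)\<bar> = 2 * \<bar>sin (pi * t)\<bar> * \<bar>cos (pi * t)\<bar>" by (simp add: abs_mult)
  also have "\<dots> \<le> 2 * \<bar>sin (pi * t)\<bar> * 1" by (intro mult_left_mono) auto
  finally show "\<bar>sin (2 * pi * t)\<bar> \<le> 2 * \<bar>sin (pi * t)\<bar>" by simp
qed

lemma bump0_bound:
  assumes "s > 0"
  shows "\<bar>bump0 s t\<bar> \<le> min \<bar>sin (pi * t)\<bar> s"
proof (cases "bump_cut s t = 0")
  case True
  then show ?thesis using assms by (simp add: bump_cut_zero)
next
  case False
  note p = bump_cut_pos_sin[OF assms False]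
  have m: "bump_cut s t ^ 3 \<le> 1" using bump_cut_bounds[of s t] by (simp add: power_le_one)
  have "\<bar>sin (2 * pi * t)\<bar> / (2 * pi) \<le> \<bar>sin (pi * t)\<bar>"
  proof -
    have "\<bar>sin (2 * pi * t)\<bar> \<le> \<bar>sin (pi * t)\<bar> * 2" using p by simp
    also have "\<dots> \<le> \<bar>sin (pi * t)\<bar> * (2 * pi)" using pi_gt3 by (intro mult_left_mono) auto
    finally show ?thesis by (simp add: field_simps)
  qed
  then have "\<bar>sin (2 * pi * t)\<bar> / (2 * pi) * bump_cut s t ^ 3 \<le> \<bar>sin (pi * t)\<bar> * 1"
    using m bump_cut_bounds[of s t] by (intro mult_mono) auto
  then have "\<bar>bump0 s t\<bar> \<le> \<bar>sin (pi * t)\<bar>"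
    unfolding bump0_def using bump_cut_bounds[of s t] by (simp add: abs_mult)
  then show ?thesis using p by simp
qed

text \<open>Source of the gain: away from the integers the derivative rises above \<open>- 1\<close>
  at least quadratically in the distance relative to \<open>s\<close>, and by a full unit outside
  the support. It suffices to bound the cosine by 1 and \<open>bump_cut s t ^ 3\<close> by
  \<open>bump_cut s t\<close>.\<close>

lemma bump1_lower:
  assumes "s > 0"
  shows "bump1 s t \<ge> - 1 + min 1 ((sin (pi * t) / s)\<^sup>2)"
proof -
  have m: "0 \<le> bump_cut s t ^ 3" "bump_cut s t ^ 3 \<le> bump_cut s t"
    using bump_cut_bounds[of s t] power_decreasing[of 1 3 "bump_cut s t"] by auto
  have "cos (2 * pi * t) * bump_cut s t ^ 3 \<le> 1 * bump_cut s t ^ 3" using m by (intro mult_right_mono) auto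
  moreover have "0 \<le> 3 / 2 * (sin (2 * pi * t) / s)\<^sup>2 * bump_cut s t ^ 2" by simp
  ultimately have "bump1 s t \<ge> - bump_cut s t" unfolding bump1_def using m by linarith
  then show ?thesis unfolding bump_cut_def by (auto simp: max_def min_def split: if_splits)
qed

lemma bump1_upper:
  assumes "s > 0"
  shows "bump1 s t \<le> 7"
proof (cases "bump_cut s t = 0")
  case True
  then show ?thesis by (simp add: bump_cut_zero)
next
  case False
  note p = bump_cut_pos_sin[OF assms False]
  have m: "0 \<le> bump_cut s t ^ 3" "bump_cut s t ^ 3 \<le> 1" "bump_cut s t ^ 2 \<le> 1"
    using bump_cut_bounds[of s t] by (auto simp: power_le_one)
  have "- cos (2 * pi * t) \<le> 1" using cos_ge_minus_one[of "2 * pi * t"] by linarith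
  then have "- cos (2 * pi * t) * bump_cut s t ^ 3 \<le> 1 * bump_cut s t ^ 3" using m by (intro mult_right_mono)
  moreover have "(sin (2 * pi * t) / s)\<^sup>2 * bump_cut s t ^ 2 \<le> 4 * 1"
  proof (rule mult_mono)
    have "\<bar>sin (2 * pi * t) / s\<bar> \<le> 2" using p assms by (simp add: abs_divide field_simps)
    then have "\<bar>sin (2 * pi * t) / s\<bar>\<^sup>2 \<le> 2\<^sup>2" by (intro power_mono) auto
    then have "(sin (2 * pi * t) / s)\<^sup>2 \<le> 2\<^sup>2" by (simp only: power2_abs)
    then show "(sin (2 * pi * t) / s)\<^sup>2 \<le> 4" by simp
  qed (use m in auto)
  ultimately show ?thesis unfolding bump1_def using m by linarith
qed

text \<open>On the support \<open>sin (2 * pi * t)\<close> is at most \<open>2 * s\<close>, which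
  leaves the order \<open>1 / s\<close>. This forces the amplitude \<open>\<epsilon> * s\<close> of
  the perturbation. The number 200 only has to exceed \<open>46 * pi\<close>.\<close>

lemma bump2_bound:
  assumes s: "s > 0" "s \<le> 1"
  shows "\<bar>bump2 s t\<bar> \<le> 200 / s"
proof (cases "bump_cut s t = 0")
  case True
  then show ?thesis using assms by (simp add: bump_cut_zero)
next
  case False
  note p = bump_cut_pos_sin[OF s(1) False]
  define S where "S = sin (2 * pi * t)"
  have S: "\<bar>S\<bar> \<le> 2 * s" using p unfolding S_def by simp
  have m: "0 \<le> bump_cut s t" "bump_cut s t \<le> 1" "0 \<le> bump_cut s t ^ 3" "bump_cut s t ^ 3 \<le> 1" "0 \<le> bump_cut s t ^ 2" "bump_cut s t ^ 2 \<le> 1"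
    using bump_cut_bounds[of s t] by (auto simp: power_le_one)
  have 1: "\<bar>2 * pi * S * bump_cut s t ^ 3\<bar> \<le> 4 * pi / s"
  proof -
    have "\<bar>S\<bar> * bump_cut s t ^ 3 \<le> 2 * s * 1" using S m s by (intro mult_mono) auto
    also have "\<dots> \<le> 2 / s" using s mult_mono[of s 1 s 1] by (simp add: field_simps)
    finally have "2 * pi * (\<bar>S\<bar> * bump_cut s t ^ 3) \<le> 2 * pi * (2 / s)" by (intro mult_left_mono) auto
    then show ?thesis using m by (simp add: abs_mult mult.assoc)
  qed
  have 2: "\<bar>9 * pi * cos (2 * pi * t) * S / s\<^sup>2 * bump_cut s t ^ 2\<bar> \<le> 18 * pi / s"
  proof -
    have "\<bar>cos (2 * pi * t)\<bar> * (\<bar>S\<bar> / s\<^sup>2) * bump_cut s t ^ 2 \<le> 1 * (2 * s / s\<^sup>2) * 1"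
      using S m s by (intro mult_mono divide_right_mono) auto
    also have "\<dots> = 2 / s" using s by (simp add: power2_eq_square)
    finally have "9 * pi * (\<bar>cos (2 * pi * t)\<bar> * (\<bar>S\<bar> / s\<^sup>2) * bump_cut s t ^ 2) \<le> 9 * pi * (2 / s)"
      by (intro mult_left_mono) auto
    then show ?thesis using m by (simp add: abs_mult mult.assoc)
  qed
  have 3: "\<bar>3 * pi * S ^ 3 / s ^ 4 * bump_cut s t\<bar> \<le> 24 * pi / s"
  proof -
    have "\<bar>S\<bar> ^ 3 / s ^ 4 * bump_cut s t \<le> (2 * s) ^ 3 / s ^ 4 * 1"
      using S m s by (intro mult_mono divide_right_mono power_mono) auto
    also have "\<dots> = 8 / s" using s by (simp add: power_mult_distrib eval_nat_numeral)
    finally have "3 * pi * (\<bar>S\<bar> ^ 3 / s ^ 4 * bump_cut s t) \<le> 3 * pi * (8 / s)"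
      by (intro mult_left_mono) auto
    then show ?thesis using m s by (simp add: abs_mult power_abs mult.assoc)
  qed
  have "\<bar>x + y - z\<bar> \<le> x' + y' + z'" if "\<bar>x\<bar> \<le> x'" "\<bar>y\<bar> \<le> y'" "\<bar>z\<bar> \<le> z'" for x y z x' y' z' :: real
    using that by linarith
  from this[OF 1 2 3] have "\<bar>bump2 s t\<bar> \<le> 4 * pi / s + 18 * pi / s + 24 * pi / s"
    unfolding bump2_def S_def .
  also have "\<dots> = 46 * pi / s" by (simp flip: add_divide_distrib)
  also have "\<dots> \<le> 200 / s" using s pi_less_4 by (intro divide_right_mono) auto
  finally show ?thesis .
qed

lemma bump_at_int: "s \<noteq> 0 \<Longrightarrow> bump0 s (of_int k) = 0 \<and> bump1 s (of_int k) = - 1"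
proof -
  have "bump0 s (0 + of_int k) = bump0 s 0" "bump1 s (0 + of_int k) = bump1 s 0"
    by (rule periodic_of_int, rule bump_per)+
  then show ?thesis by (simp add: bump0_def bump1_def bump_cut_def)
qed

text \<open>Up to \<open>1 / 4\<close> the cosine is at least \<open>1 / 2\<close>, so the slope of
  \<open>sin (pi * v)\<close> is at least \<open>pi / 2 > 1\<close>; from there to
  \<open>1 / 2\<close> the sine is at least \<open>1 / 2\<close> itself.\<close>

lemma sin_pi_lower: "\<bar>sin (pi * t)\<bar> \<ge> \<bar>t - of_int (round t)\<bar>"
proof -
  have base: "sin (pi * v) \<ge> v" if v: "0 \<le> v" "v \<le> 1 / 2" for v
  proof (cases "v \<le> 1 / 4")
    case True
    have "pi * v \<le> pi / 4" using True by simp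
    then have "cos (pi * v) \<ge> cos (pi / 4)" using v by (intro cos_monotone_0_pi_le) auto
    moreover have "cos (pi / 4) \<ge> 1 / 2"
      using real_le_rsqrt[of 1 2] by (simp add: cos_45)
    ultimately have "cos z \<ge> 1 / 2" if "0 \<le> z" "z \<le> pi * v" for z
      using that cos_monotone_0_pi_le[of z "pi * v"] \<open>pi * v \<le> pi / 4\<close> pi_gt_zero by linarith
    note c = this
    have D: "((\<lambda>z. sin z - z / 2) has_real_derivative cos z - 1 / 2) (at z)" for z :: real
      by (auto intro!: derivative_eq_intros)
    have "(\<lambda>z. sin z - z / 2) 0 \<le> (\<lambda>z. sin z - z / 2) (pi * v)"
    proof (rule DERIV_nonneg_imp_nondecreasing[where f = "\<lambda>z. sin z - z / 2"])
      show "0 \<le> pi * v" using v by simp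
      show "\<exists>y. ((\<lambda>z. sin z - z / 2) has_real_derivative y) (at z) \<and> 0 \<le> y"
        if "0 \<le> z" "z \<le> pi * v" for z
        using c[OF that] by (intro exI[of _ "cos z - 1 / 2"] conjI D) simp
    qed
    then have "sin (pi * v) \<ge> pi * v / 2" by simp
    also have "pi * v / 2 \<ge> v" using v pi_gt3 mult_right_mono[of 2 pi v] by linarith
    finally show ?thesis .
  next
    case False
    have "sin (pi * v) \<ge> sin (pi / 4)"
      using v False by (intro sin_monotone_2pi_le) (auto simp: field_simps)
    moreover have "sin (pi / 4) \<ge> 1 / 2"
      using real_le_rsqrt[of 1 2] by (simp add: sin_45)
    ultimately show ?thesis using v by linarith
  qed
  define v where "v = t - of_int (round t)"
  have v: "\<bar>v\<bar> \<le> 1 / 2" unfolding v_def using of_int_round_abs_le[of t] by linarith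
  have "sin (pi * t) = sin (pi * v + pi * of_int (round t))" unfolding v_def by (simp add: algebra_simps)
  also have "\<bar>\<dots>\<bar> = \<bar>sin (pi * v)\<bar>"
    by (simp add: sin_add abs_mult sin_npi_int cos_npi_int)
  finally have "\<bar>sin (pi * t)\<bar> = \<bar>sin (pi * v)\<bar>" .
  moreover have "\<bar>sin (pi * v)\<bar> \<ge> \<bar>v\<bar>" using base[of v] base[of "- v"] v by (cases "v \<ge> 0") auto
  ultimately show ?thesis unfolding v_def by simp
qed

lemma sin_pi_gap:
  assumes "\<And>k::int. D \<le> \<bar>t + of_int k\<bar>"
  shows "D \<le> \<bar>sin (pi * t)\<bar>"
  using sin_pi_lower[of t] assms[of "- round t"] by simp

text \<open>The separation \<open>2 * s\<close> makes the supports disjoint. With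
  \<open>\<epsilon> \<le> 1 / 14\<close> the derivative of \<open>g\<close> is at most
  \<open>7 * \<epsilon> \<le> 1 / 2\<close> in absolute value, so that adding \<open>g\<close> to
  the identity gives a diffeomorphism.\<close>

locale bump_sum =
  fixes N :: nat and p :: "nat \<Rightarrow> real" and s \<epsilon> :: real
  assumes N: "N \<ge> 1" and s: "0 < s" "s \<le> 1" and \<epsilon>: "0 < \<epsilon>" "\<epsilon> \<le> 1 / 14"
    and sep: "i < N \<Longrightarrow> j < N \<Longrightarrow> i \<noteq> j \<Longrightarrow> 2 * s \<le> \<bar>sin (pi * (p i - p j))\<bar>"
begin

definition g :: "real \<Rightarrow> real" where "g x = \<epsilon> * s * (\<Sum>i<N. bump0 s (x - p i))"
definition g1 :: "real \<Rightarrow> real" where "g1 x = \<epsilon> * s * (\<Sum>i<N. bump1 s (x - p i))"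
definition g2 :: "real \<Rightarrow> real" where "g2 x = \<epsilon> * s * (\<Sum>i<N. bump2 s (x - p i))"

lemma g_deriv: "(g has_real_derivative g1 x) (at x)"
proof -
  have "((\<lambda>x. bump0 s (x - p i)) has_real_derivative bump1 s (x - p i)) (at x)" for i
  proof -
    have "((\<lambda>x. x - p i) has_real_derivative 1) (at x)" by (auto intro!: derivative_eq_intros)
    from DERIV_chain2[where f = "bump0 s" and g = "\<lambda>x. x - p i", OF bump0_deriv this]
    show ?thesis using s by simp
  qed
  then show ?thesis unfolding g_def g1_def by (intro DERIV_cmult DERIV_sum)
qed

lemma g1_deriv: "(g1 has_real_derivative g2 x) (at x)"
proof -
  have "((\<lambda>x. bump1 s (x - p i)) has_real_derivative bump2 s (x - p i)) (at x)" for i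
  proof -
    have "((\<lambda>x. x - p i) has_real_derivative 1) (at x)" by (auto intro!: derivative_eq_intros)
    from DERIV_chain2[where f = "bump1 s" and g = "\<lambda>x. x - p i", OF bump1_deriv this]
    show ?thesis using s by simp
  qed
  then show ?thesis unfolding g1_def g2_def by (intro DERIV_cmult DERIV_sum)
qed

lemma g2_cont: "continuous_on UNIV g2"
  unfolding g2_def[abs_def] using s
  by (intro continuous_intros continuous_on_compose2[OF bump2_cont]) auto

lemma g_per: "g (x + 1) = g x" "g1 (x + 1) = g1 x" "g2 (x + 1) = g2 x"
  using bump_per[of s "x - p _"] unfolding g_def g1_def g2_def by (simp_all add: algebra_simps)

text \<open>By the formula for the sine of a difference, two bumps active at \<open>x\<close> would
  violate the separation of their centres. If none is active, every bump and its derivatives vanish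
  at \<open>x\<close> and any index serves.\<close>

lemma active:
  "\<exists>i<N. (\<forall>j<N. j \<noteq> i \<longrightarrow> bump_cut s (x - p j) = 0) \<and> g x = \<epsilon> * s * bump0 s (x - p i) \<and>
    g1 x = \<epsilon> * s * bump1 s (x - p i) \<and> g2 x = \<epsilon> * s * bump2 s (x - p i)"
proof -
  have uniq: "i = j" if ij: "i < N" "j < N" "bump_cut s (x - p i) \<noteq> 0" "bump_cut s (x - p j) \<noteq> 0" for i j
  proof (rule ccontr)
    assume "i \<noteq> j"
    define u v where "u = pi * (x - p j)" and "v = pi * (x - p i)"
    have "\<bar>sin v\<bar> < s" "\<bar>sin u\<bar> < s" using bump_cut_pos_sin(1)[OF s(1)] ij unfolding u_def v_def by auto
    moreover have "\<bar>sin (u - v)\<bar> \<le> \<bar>sin u\<bar> + \<bar>sin v\<bar>"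
    proof -
      have "\<bar>sin u * cos v\<bar> \<le> \<bar>sin u\<bar> * 1" unfolding abs_mult by (rule mult_left_mono) auto
      moreover have "\<bar>cos u * sin v\<bar> \<le> 1 * \<bar>sin v\<bar>" unfolding abs_mult by (rule mult_right_mono) auto
      ultimately show ?thesis unfolding sin_diff by linarith
    qed
    moreover have "u - v = pi * (p i - p j)" unfolding u_def v_def by (simp add: algebra_simps)
    ultimately show False using sep[OF ij(1,2) \<open>i \<noteq> j\<close>] by simp
  qed
  obtain i where i: "i < N" "\<forall>j<N. j \<noteq> i \<longrightarrow> bump_cut s (x - p j) = 0"
  proof (cases "\<exists>i<N. bump_cut s (x - p i) \<noteq> 0")
    case True
    then show ?thesis using uniq that by blast
  next
    case False
    then show ?thesis using that[of 0] N by auto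
  qed
  have "(\<Sum>j<N. f (x - p j)) = f (x - p i)" if "\<And>t. bump_cut s t = 0 \<Longrightarrow> f t = 0" for f :: "real \<Rightarrow> real"
  proof -
    have "(\<Sum>j<N. f (x - p j)) = (\<Sum>j\<in>{i}. f (x - p j))"
      using i that by (intro sum.mono_neutral_right) auto
    then show ?thesis by simp
  qed
  then show ?thesis using i bump_cut_zero[of s] unfolding g_def g1_def g2_def by (intro exI[of _ i]) auto
qed

lemma \<epsilon>s: "0 < \<epsilon> * s" "\<epsilon> * s \<le> \<epsilon>"
  using s \<epsilon> by (auto simp: mult_left_le)

lemma g_bound: "\<bar>g x\<bar> \<le> \<epsilon>"
proof -
  obtain i where "g x = \<epsilon> * s * bump0 s (x - p i)" using active[of x] by blast
  moreover have "\<bar>bump0 s (x - p i)\<bar> \<le> 1" using bump0_bound[OF s(1), of "x - p i"] s by linarith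
  then have "\<epsilon> * s * \<bar>bump0 s (x - p i)\<bar> \<le> \<epsilon> * s * 1" using \<epsilon>s by (intro mult_left_mono) auto
  moreover have "\<bar>\<epsilon> * s * bump0 s (x - p i)\<bar> = \<epsilon> * s * \<bar>bump0 s (x - p i)\<bar>"
    using s \<epsilon> by (simp add: abs_mult)
  ultimately show ?thesis using \<epsilon>s by linarith
qed

lemma g1_bounds: "- (\<epsilon> * s) \<le> g1 x" "g1 x \<le> 7 * (\<epsilon> * s)" "\<bar>g1 x\<bar> \<le> 7 * \<epsilon>" "g1 x \<le> 1"
proof -
  obtain i where i: "g1 x = \<epsilon> * s * bump1 s (x - p i)" using active[of x] by blast
  have b: "- 1 \<le> bump1 s (x - p i)" "bump1 s (x - p i) \<le> 7"
    using bump1_lower[OF s(1), of "x - p i"] bump1_upper[OF s(1)] by (auto simp: min_def split: if_splits)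
      (smt (verit) zero_le_power2)+
  show 1: "- (\<epsilon> * s) \<le> g1 x"
    using mult_left_mono[OF b(1), of "\<epsilon> * s"] \<epsilon>s unfolding i by simp
  show 2: "g1 x \<le> 7 * (\<epsilon> * s)"
    using mult_left_mono[OF b(2), of "\<epsilon> * s"] \<epsilon>s unfolding i by simp
  show "\<bar>g1 x\<bar> \<le> 7 * \<epsilon>" "g1 x \<le> 1" using 1 2 \<epsilon>s \<epsilon> by linarith+
qed

lemma g2_bound: "\<bar>g2 x\<bar> \<le> 200 * \<epsilon>"
proof -
  obtain i where i: "g2 x = \<epsilon> * s * bump2 s (x - p i)" using active[of x] by blast
  have "\<epsilon> * s * \<bar>bump2 s (x - p i)\<bar> \<le> \<epsilon> * s * (200 / s)"
    using bump2_bound[OF s] \<epsilon>s by (intro mult_left_mono) auto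
  then show ?thesis unfolding i using s \<epsilon> by (simp add: abs_mult)
qed

lemma g_at: "i < N \<Longrightarrow> g (p i + of_int k) = 0 \<and> g1 (p i + of_int k) = - (\<epsilon> * s)"
proof -
  assume i: "i < N"
  define x where "x = p i + of_int k"
  obtain i0 where i0: "\<forall>j<N. j \<noteq> i0 \<longrightarrow> bump_cut s (x - p j) = 0" "g x = \<epsilon> * s * bump0 s (x - p i0)"
    "g1 x = \<epsilon> * s * bump1 s (x - p i0)" using active[of x] by blast
  have "x - p i = of_int k" unfolding x_def by simp
  then have b: "bump0 s (x - p i) = 0" "bump1 s (x - p i) = - 1" using bump_at_int[of s k] s by auto
  then have "bump_cut s (x - p i) \<noteq> 0" using bump_cut_zero[of s "x - p i"] by auto
  then have "i0 = i" using i0(1) i by blast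
  then show ?thesis using i0 b unfolding x_def by simp
qed

text \<open>Let \<open>y\<close> be the distance to the centre of the selected bump relative to
  \<open>s\<close>, truncated at 1. The logarithms gain at least
  \<open>\<epsilon> * s * y\<^sup>2 / 2\<close>, while the displacement is at most
  \<open>\<epsilon> * s\<^sup>2 * y\<close>. As \<open>y \<ge> v\<close> and
  \<open>K * s \<le> v / 4\<close>, at least half of the gain survives. In the application
  \<open>K\<close> is a Lipschitz constant of \<open>u\<close>.\<close>

lemma gain:
  assumes far: "\<And>i. i < N \<Longrightarrow> v * s \<le> \<bar>sin (pi * (x - p i))\<bar>" and v: "0 < v" "v \<le> 1"
    and K: "0 \<le> K" "K * s \<le> v / 4"
  shows "ln (1 + g1 x) - ln (1 - \<epsilon> * s) - K * \<bar>g x\<bar> \<ge> \<epsilon> * s * v\<^sup>2 / 4"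
proof -
  obtain i where i: "i < N" "g x = \<epsilon> * s * bump0 s (x - p i)" "g1 x = \<epsilon> * s * bump1 s (x - p i)"
    using active[of x] by blast
  define z where "z = \<bar>sin (pi * (x - p i))\<bar> / s"
  define y where "y = min 1 z"
  have zv: "z \<ge> v" using far[OF i(1)] s unfolding z_def by (simp add: field_simps)
  then have yv: "y \<ge> v" "y \<le> 1" using v unfolding y_def by auto
  have y2: "min 1 ((sin (pi * (x - p i)) / s)\<^sup>2) \<ge> y\<^sup>2"
  proof -
    have "(sin (pi * (x - p i)) / s)\<^sup>2 = z\<^sup>2" unfolding z_def by (simp add: power_divide)
    moreover have "y\<^sup>2 \<le> z\<^sup>2" "y\<^sup>2 \<le> 1" using yv v unfolding y_def by (auto intro!: power_mono power_le_one)
    ultimately show ?thesis by simp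
  qed
  have "\<epsilon> * s * (- 1 + y\<^sup>2) \<le> g1 x"
    unfolding i(3) using bump1_lower[OF s(1), of "x - p i"] y2 \<epsilon>s by (intro mult_left_mono) auto
  then have G1: "\<epsilon> * s * y\<^sup>2 \<le> g1 x + \<epsilon> * s" by (simp add: algebra_simps)
  have "\<bar>bump0 s (x - p i)\<bar> \<le> s * y"
  proof -
    have "s * z = \<bar>sin (pi * (x - p i))\<bar>" using s by (simp add: z_def)
    then show ?thesis using bump0_bound[OF s(1), of "x - p i"] unfolding y_def by (cases "z \<le> 1") auto
  qed
  then have G0: "\<bar>g x\<bar> \<le> \<epsilon> * s * (s * y)"
    unfolding i(2) using s \<epsilon> by (simp add: abs_mult mult_left_mono)
  have pos: "1 - \<epsilon> * s > 0" "1 + g1 x > 0" using \<epsilon>s \<epsilon> g1_bounds[of x] by linarith+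
  \<comment> \<open>Inverting the quotient makes \<open>ln t \<le> t - 1\<close> point in the right
    direction; the denominator \<open>1 + g1 x\<close> is at most 2.\<close>
  have "ln ((1 - \<epsilon> * s) / (1 + g1 x)) \<le> (1 - \<epsilon> * s) / (1 + g1 x) - 1" using pos by (intro ln_le_minus_one) simp
  also have "\<dots> = - ((g1 x + \<epsilon> * s) / (1 + g1 x))" using pos by (simp add: field_simps)
  also have "\<dots> \<le> - ((g1 x + \<epsilon> * s) / 2)"
  proof -
    have "(g1 x + \<epsilon> * s) / 2 \<le> (g1 x + \<epsilon> * s) / (1 + g1 x)"
      by (rule frac_le) (use g1_bounds[of x] pos in auto)
    then show ?thesis by simp
  qed
  finally have "ln ((1 - \<epsilon> * s) / (1 + g1 x)) \<le> - ((g1 x + \<epsilon> * s) / 2)" .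
  moreover have "ln ((1 - \<epsilon> * s) / (1 + g1 x)) = ln (1 - \<epsilon> * s) - ln (1 + g1 x)"
    using pos by (simp add: ln_div)
  ultimately have "ln (1 + g1 x) - ln (1 - \<epsilon> * s) \<ge> (g1 x + \<epsilon> * s) / 2" by linarith
  moreover have "K * \<bar>g x\<bar> \<le> K * (\<epsilon> * s * (s * y))" using G0 K by (intro mult_left_mono)
  moreover have "a / 2 - c \<le> t - k" if "h / 2 \<le> t" "k \<le> c" "a \<le> h" for a c h k t :: real
    using that by linarith
  ultimately have "ln (1 + g1 x) - ln (1 - \<epsilon> * s) - K * \<bar>g x\<bar> \<ge> \<epsilon> * s * y\<^sup>2 / 2 - K * (\<epsilon> * s * (s * y))"
    using G1 by blast
  moreover have "\<epsilon> * s * y\<^sup>2 / 2 - K * (\<epsilon> * s * (s * y)) = \<epsilon> * s * (y * (y / 2 - K * s))"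
    by (simp add: power2_eq_square algebra_simps)
  moreover have "y * (y / 2 - K * s) \<ge> v * (v / 4)"
    using K yv v by (intro mult_mono) auto
  then have "\<epsilon> * s * (y * (y / 2 - K * s)) \<ge> \<epsilon> * s * (v * (v / 4))"
    using \<epsilon>s by (intro mult_left_mono) auto
  ultimately show ?thesis by (simp add: power2_eq_square)
qed

end

section \<open>Size of the precomposition in C2\<close>

context C2_circle
begin

lemma compose_deriv:
  assumes "\<And>x. (h has_real_derivative h1 x) (at x)" "\<And>x. (h1 has_real_derivative h2 x) (at x)"
  shows "deriv (\<lambda>x. F (x + h x)) = (\<lambda>x. deriv F (x + h x) * (1 + h1 x))"
    and "deriv (deriv (\<lambda>x. F (x + h x))) =
      (\<lambda>x. deriv (deriv F) (x + h x) * (1 + h1 x)\<^sup>2 + deriv F (x + h x) * h2 x)"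
    and "(\<lambda>x. F (x + h x)) differentiable at x" "deriv (\<lambda>x. F (x + h x)) differentiable at x"
proof -
  have y: "((\<lambda>x. x + h x) has_real_derivative 1 + h1 x) (at x)" for x
    by (intro DERIV_add DERIV_ident assms)
  have d1: "((\<lambda>x. F (x + h x)) has_real_derivative deriv F (x + h x) * (1 + h1 x)) (at x)" for x
    by (rule DERIV_chain2[OF D1 y])
  show e1: "deriv (\<lambda>x. F (x + h x)) = (\<lambda>x. deriv F (x + h x) * (1 + h1 x))"
    by (rule ext) (rule DERIV_imp_deriv[OF d1])
  have "((\<lambda>x. deriv F (x + h x) * (1 + h1 x)) has_real_derivative
      deriv (deriv F) (x + h x) * (1 + h1 x) * (1 + h1 x) + (0 + h2 x) * deriv F (x + h x)) (at x)" for x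
    by (intro DERIV_mult DERIV_chain2[OF D2 y] DERIV_add DERIV_const assms)
  then have d2: "((\<lambda>x. deriv F (x + h x) * (1 + h1 x)) has_real_derivative
      deriv (deriv F) (x + h x) * (1 + h1 x)\<^sup>2 + deriv F (x + h x) * h2 x) (at x)" for x
    by (simp add: power2_eq_square mult_ac)
  show "deriv (deriv (\<lambda>x. F (x + h x))) =
      (\<lambda>x. deriv (deriv F) (x + h x) * (1 + h1 x)\<^sup>2 + deriv F (x + h x) * h2 x)"
    unfolding e1 by (rule ext) (rule DERIV_imp_deriv[OF d2])
  show "(\<lambda>x. F (x + h x)) differentiable at x" unfolding real_differentiable_def using d1 by blast
  show "deriv (\<lambda>x. F (x + h x)) differentiable at x" unfolding e1 real_differentiable_def using d2 by blast
qed

lemma compose_C2_circle: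
  assumes "\<And>x. (h has_real_derivative h1 x) (at x)" "\<And>x. (h1 has_real_derivative h2 x) (at x)"
    and "continuous_on UNIV h2" "\<And>x. h (x + 1) = h x"
  shows "C2_circle (\<lambda>x. F (x + h x)) d"
proof
  note C = compose_deriv[OF assms(1,2)]
  show "(\<lambda>x. F (x + h x)) differentiable at x" for x by (rule C(3))
  show "deriv (\<lambda>x. F (x + h x)) differentiable at x" for x by (rule C(4))
  have ch: "continuous_on UNIV h" "continuous_on UNIV h1"
    using assms(1,2) by (meson DERIV_isCont continuous_at_imp_continuous_on)+
  then show "continuous_on UNIV (deriv (deriv (\<lambda>x. F (x + h x))))"
    unfolding C(2)
    by (intro continuous_intros assms(3) continuous_on_compose2[OF cont2] continuous_on_compose2[OF cont1]) auto
  show "F (x + 1 + h (x + 1)) = F (x + h x) + of_int d" for x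
  proof -
    have "x + 1 + h (x + 1) = x + h x + 1" by (simp add: assms(4))
    then show ?thesis using Fper[of "x + h x"] by (simp only:)
  qed
qed

lemma bounds12: "\<exists>B1 B2. \<forall>x. \<bar>deriv F x\<bar> \<le> B1 \<and> \<bar>deriv (deriv F) x\<bar> \<le> B2"
  using continuous_periodic_bounded[OF cont1 per1] continuous_periodic_bounded[OF cont2 per2] by metis

text \<open>Uniform continuity controls both derivatives of \<open>F\<close> at the displaced point,
  and all other terms are at most linear in \<open>\<epsilon>\<close>. The factors 7 and 200 are
  those of the bump sum.\<close>

lemma compose_close:
  assumes e: "e > 0"
  shows "\<exists>\<epsilon>0>0. \<forall>\<epsilon> h h1 h2. 0 < \<epsilon> \<longrightarrow> \<epsilon> \<le> \<epsilon>0 \<longrightarrow>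
    (\<forall>x. (h has_real_derivative h1 x) (at x)) \<longrightarrow> (\<forall>x. (h1 has_real_derivative h2 x) (at x)) \<longrightarrow>
    (\<forall>x. \<bar>h x\<bar> \<le> \<epsilon> \<and> \<bar>h1 x\<bar> \<le> 7 * \<epsilon> \<and> \<bar>h2 x\<bar> \<le> 200 * \<epsilon>) \<longrightarrow>
    (\<forall>x. \<bar>F (x + h x) - F x\<bar> \<le> e \<and> \<bar>deriv (\<lambda>x. F (x + h x)) x - deriv F x\<bar> \<le> e \<and>
      \<bar>deriv (deriv (\<lambda>x. F (x + h x))) x - deriv (deriv F) x\<bar> \<le> e)"
proof -
  obtain B1 B2 where B1: "\<And>x. \<bar>deriv F x\<bar> \<le> B1" and B2: "\<And>x. \<bar>deriv (deriv F) x\<bar> \<le> B2"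
    using bounds12 by blast
  have B0: "B1 \<ge> 0" "B2 \<ge> 0" using B1[of 0] B2[of 0] by linarith+
  obtain \<delta>1 where \<delta>1: "\<delta>1 > 0" "\<And>x y. \<bar>x - y\<bar> \<le> \<delta>1 \<Longrightarrow> \<bar>deriv F x - deriv F y\<bar> \<le> e / 2"
    using continuous_periodic_uniform[OF cont1 per1, of "e / 2"] e by auto
  obtain \<delta>2 where \<delta>2: "\<delta>2 > 0" "\<And>x y. \<bar>x - y\<bar> \<le> \<delta>2 \<Longrightarrow> \<bar>deriv (deriv F) x - deriv (deriv F) y\<bar> \<le> e / 2"
    using continuous_periodic_uniform[OF cont2 per2, of "e / 2"] e by auto
  \<comment> \<open>The coefficient 63 is \<open>2 * 7 + 7 * 7\<close>, from
    \<open>(1 + h1 x)\<^sup>2 - 1\<close> and \<open>\<epsilon> \<le> 1\<close>.\<close>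
  define K where "K = 1 + 200 * B1 + 63 * B2"
  have K: "K > 0" using B0 unfolding K_def by simp
  define \<epsilon>0 where "\<epsilon>0 = min (min \<delta>1 \<delta>2) (min 1 (e / (2 * K)))"
  have \<epsilon>0: "\<epsilon>0 > 0" using \<delta>1 \<delta>2 e K unfolding \<epsilon>0_def by simp
  have main: "\<bar>F (x + h x) - F x\<bar> \<le> e \<and> \<bar>deriv (\<lambda>x. F (x + h x)) x - deriv F x\<bar> \<le> e \<and>
      \<bar>deriv (deriv (\<lambda>x. F (x + h x))) x - deriv (deriv F) x\<bar> \<le> e"
    if \<epsilon>: "0 < \<epsilon>" "\<epsilon> \<le> \<epsilon>0" and h: "\<And>x. (h has_real_derivative h1 x) (at x)"
      "\<And>x. (h1 has_real_derivative h2 x) (at x)"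
      and b: "\<And>x. \<bar>h x\<bar> \<le> \<epsilon> \<and> \<bar>h1 x\<bar> \<le> 7 * \<epsilon> \<and> \<bar>h2 x\<bar> \<le> 200 * \<epsilon>" for \<epsilon> h h1 h2 x
  proof -
    have \<epsilon>': "\<epsilon> \<le> \<delta>1" "\<epsilon> \<le> \<delta>2" "\<epsilon> \<le> 1" "\<epsilon> \<le> e / (2 * K)" using \<epsilon> unfolding \<epsilon>0_def by auto
    then have K\<epsilon>: "K * \<epsilon> \<le> e / 2" using K by (simp add: field_simps)
    then have split: "\<epsilon> + 200 * (B1 * \<epsilon>) + 63 * (B2 * \<epsilon>) \<le> e / 2" unfolding K_def by (simp add: algebra_simps)
    have nn: "0 \<le> B1 * \<epsilon>" "0 \<le> B2 * \<epsilon>" using B0 \<epsilon> by auto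
    define y where "y = x + h x"
    have xy: "\<bar>y - x\<bar> \<le> \<epsilon>" using b[of x] unfolding y_def by simp
    have "\<bar>F y - F x\<bar> \<le> B1 * \<bar>y - x\<bar>"
      using field_differentiable_bound[of UNIV F "deriv F" B1 y x] D1 B1 by (simp add: has_field_derivative_at_within)
    also have "\<dots> \<le> B1 * \<epsilon>" using xy B0 by (intro mult_left_mono)
    finally have 1: "\<bar>F y - F x\<bar> \<le> e" using split nn \<epsilon> e by linarith
    have u1: "\<bar>deriv F y - deriv F x\<bar> \<le> e / 2" using \<delta>1(2)[of y x] xy \<epsilon>' by linarith
    have u2: "\<bar>deriv (deriv F) y - deriv (deriv F) x\<bar> \<le> e / 2" using \<delta>2(2)[of y x] xy \<epsilon>' by linarith
    have "\<bar>deriv F y * h1 x\<bar> \<le> B1 * (7 * \<epsilon>)"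
      unfolding abs_mult using B1[of y] b[of x] B0 by (intro mult_mono) auto
    moreover have "\<bar>a * (1 + t) - c\<bar> \<le> e" if "\<bar>a - c\<bar> \<le> e / 2" "\<bar>a * t\<bar> \<le> B1 * (7 * \<epsilon>)" for a t c
    proof -
      have "a * (1 + t) = a + a * t" "B1 * (7 * \<epsilon>) = 7 * (B1 * \<epsilon>)" by (simp_all add: distrib_left)
      then show ?thesis using that split nn \<epsilon> by linarith
    qed
    ultimately have "\<bar>deriv F y * (1 + h1 x) - deriv F x\<bar> \<le> e" using u1 by blast
    then have 2: "\<bar>deriv (\<lambda>x. F (x + h x)) x - deriv F x\<bar> \<le> e"
      unfolding compose_deriv(1)[OF h] y_def .
    have q: "\<bar>2 * h1 x + (h1 x)\<^sup>2\<bar> \<le> 63 * \<epsilon>"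
    proof -
      have "\<bar>h1 x\<bar> * \<bar>h1 x\<bar> \<le> (7 * \<epsilon>) * 7" using b[of x] \<epsilon>' by (intro mult_mono) auto
      then have "(h1 x)\<^sup>2 \<le> 49 * \<epsilon>" by (simp add: power2_eq_square abs_mult_self_eq)
      then show ?thesis using b[of x] zero_le_power2[of "h1 x"] by linarith
    qed
    have 3: "\<bar>deriv (deriv F) y * (2 * h1 x + (h1 x)\<^sup>2)\<bar> \<le> B2 * (63 * \<epsilon>)"
      unfolding abs_mult[of "deriv (deriv F) y"] using B2[of y] q B0 by (intro mult_mono) auto
    have 4: "\<bar>deriv F y * h2 x\<bar> \<le> B1 * (200 * \<epsilon>)"
      unfolding abs_mult using B1[of y] b[of x] B0 by (intro mult_mono) auto
    have eq: "deriv (deriv F) y * (1 + h1 x)\<^sup>2 + deriv F y * h2 x - deriv (deriv F) x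
       = (deriv (deriv F) y - deriv (deriv F) x) + deriv (deriv F) y * (2 * h1 x + (h1 x)\<^sup>2) + deriv F y * h2 x"
      by (simp add: power2_eq_square algebra_simps)
    have "\<bar>a + b' + c\<bar> \<le> e" if "\<bar>a\<bar> \<le> e / 2" "\<bar>b'\<bar> \<le> B2 * (63 * \<epsilon>)" "\<bar>c\<bar> \<le> B1 * (200 * \<epsilon>)" for a b' c
      using that split nn \<epsilon> by (simp add: mult_ac)
    from this[OF u2 3 4]
    have "\<bar>deriv (deriv (\<lambda>x. F (x + h x))) x - deriv (deriv F) x\<bar> \<le> e"
      unfolding compose_deriv(2)[OF h] y_def[symmetric] eq .
    then show ?thesis using 1 2 unfolding y_def by blast
  qed
  show ?thesis
    by (rule exI[of _ \<epsilon>0]) (use \<epsilon>0 main in blast)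
qed

end

section \<open>Stability of locking\<close>

definition uniquely_locked :: "(real \<Rightarrow> real) \<Rightarrow> bool" where
  "uniquely_locked T \<longleftrightarrow> (\<exists>!\<mu>. lyap_minimizing T \<mu>) \<and>
     (\<forall>\<mu>. lyap_minimizing T \<mu> \<longrightarrow> (\<exists>\<Gamma>. periodic_orbit T \<Gamma> \<and> is_orbit_measure \<Gamma> \<mu>))"

lemma ln_lipschitz:
  fixes x y m :: real
  assumes "m > 0" "m \<le> x" "m \<le> y"
  shows "\<bar>ln x - ln y\<bar> \<le> \<bar>x - y\<bar> / m"
proof -
  have *: "ln x - ln y \<le> \<bar>x - y\<bar> / m" if "m \<le> x" "m \<le> y" for x y
  proof -
    have pos: "x > 0" "y > 0" using that assms by auto
    have "ln x - ln y = ln (x / y)" using pos by (simp add: ln_div)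
    also have "\<dots> \<le> x / y - 1" using pos by (intro ln_le_minus_one) simp
    also have "\<dots> = (x - y) / y" using pos by (simp add: field_simps)
    also have "\<dots> \<le> \<bar>x - y\<bar> / m" using that assms pos by (intro frac_le) auto
    finally show ?thesis .
  qed
  show ?thesis using *[of x y] *[of y x] assms by (simp add: abs_le_iff abs_minus_commute)
qed

lemma (in C2_circle) lipschitz_of_bound:
  assumes "\<And>x. \<bar>deriv F x\<bar> \<le> B"
  shows "\<bar>F x - F y\<bar> \<le> B * \<bar>x - y\<bar>"
  using field_differentiable_bound[of UNIV F "deriv F" B x y] D1 assms
  by (simp add: has_field_derivative_at_within)

lemma (in C2_circle) deriv_lipschitz_of_bound:
  assumes "\<And>x. \<bar>deriv (deriv F) x\<bar> \<le> B"
  shows "\<bar>deriv F x - deriv F y\<bar> \<le> B * \<bar>x - y\<bar>"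
  using field_differentiable_bound[of UNIV "deriv F" "deriv (deriv F)" B x y] D2 assms
  by (simp add: has_field_derivative_at_within)

locale C2_expanding = C2_circle F d + adapted_density H w W c
  for F d H w W c +
  fixes \<sigma> lam m0 B1 B2 :: real
  assumes \<sigma>: "\<sigma> = 1 \<or> \<sigma> = - 1" and lam: "lam > 1" and m0: "m0 > 0"
    and F_low: "m0 \<le> \<sigma> * deriv F x" and exp1: "lam * w x \<le> \<sigma> * deriv F x * w (F x)"
    and B1: "\<bar>deriv F x\<bar> \<le> B1" and B2: "\<bar>deriv (deriv F) x\<bar> \<le> B2"
begin

text \<open>This and the following constants are relaxed to hold uniformly for maps near
  \<open>F\<close>: half of the surplus of \<open>lam\<close> over 1 is given away here, and
  \<open>L\<close> and \<open>M'\<close> let the derivatives grow by 1.\<close>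

definition lam' :: real where "lam' = (1 + lam) / 2"
definition L :: real where "L = W * (B1 + 1)"

lemma lam': "1 < lam'" "lam' < lam" using lam unfolding lam'_def by auto

lemma W1: "W \<ge> 1" using w_bounds[of 0] by linarith

lemma B_nonneg: "B1 \<ge> 0" "B2 \<ge> 0" using B1[of 0] B2[of 0] by linarith+

lemma L_nonneg: "L \<ge> 0" unfolding L_def using W1 B_nonneg by simp

lemma adapted_of_deriv:
  assumes T: "C2_circle T d'" and low: "\<And>x. l * w x \<le> \<sigma> * deriv T x * w (T x)" and l: "l > 1"
  shows "adapted_lift T H d' l W c"
proof -
  interpret T: C2_circle T d' by fact
  show ?thesis
  proof
    show "l * \<bar>H x - H y\<bar> \<le> \<bar>H (T x) - H (T y)\<bar>" for x y
      using expand_of_deriv[OF \<sigma> T.D1 low] l by simp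
  qed (use T.cont0 T.Fper l H_low H_up Hper in auto)
qed

lemma H_lip_of_deriv:
  assumes T: "C2_circle T d'" and bd: "\<And>x. \<bar>deriv T x\<bar> \<le> B1 + 1"
  shows "\<bar>H (T x) - H (T y)\<bar> \<le> L * \<bar>H x - H y\<bar>"
proof -
  interpret T: C2_circle T d' by fact
  have "\<bar>T x - T y\<bar> \<le> (B1 + 1) * \<bar>H x - H y\<bar>"
    using T.lipschitz_of_bound[OF bd, of x y] H_low[of x y] B_nonneg mult_left_mono[of "\<bar>x - y\<bar>" "\<bar>H x - H y\<bar>" "B1 + 1"]
    by linarith
  then have "W * \<bar>T x - T y\<bar> \<le> W * ((B1 + 1) * \<bar>H x - H y\<bar>)" using W1 by (intro mult_left_mono) auto
  then show ?thesis using H_up[of "T x" "T y"] unfolding L_def by (simp add: mult.assoc)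
qed

lemma ln_deriv_lip:
  assumes T: "C2_circle T d'" and low: "\<And>x. m \<le> \<bar>deriv T x\<bar>" and m: "m > 0"
    and bd: "\<And>x. \<bar>deriv (deriv T) x\<bar> \<le> B"
  shows "\<bar>ln \<bar>deriv T x\<bar> - ln \<bar>deriv T y\<bar>\<bar> \<le> B / m * \<bar>H x - H y\<bar>"
proof -
  interpret T: C2_circle T d' by fact
  have B: "B \<ge> 0" using bd[of 0] by linarith
  have "\<bar>ln \<bar>deriv T x\<bar> - ln \<bar>deriv T y\<bar>\<bar> \<le> \<bar>\<bar>deriv T x\<bar> - \<bar>deriv T y\<bar>\<bar> / m"
    by (intro ln_lipschitz low m)
  also have "\<dots> \<le> (B * \<bar>H x - H y\<bar>) / m"
  proof (rule divide_right_mono)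
    have "\<bar>\<bar>deriv T x\<bar> - \<bar>deriv T y\<bar>\<bar> \<le> \<bar>deriv T x - deriv T y\<bar>" by linarith
    also have "\<dots> \<le> B * \<bar>x - y\<bar>" by (rule T.deriv_lipschitz_of_bound[OF bd])
    also have "\<dots> \<le> B * \<bar>H x - H y\<bar>" using H_low B by (intro mult_left_mono) auto
    finally show "\<bar>\<bar>deriv T x\<bar> - \<bar>deriv T y\<bar>\<bar> \<le> B * \<bar>H x - H y\<bar>" .
  qed (use m in simp)
  finally show ?thesis by simp
qed

lemma F_low_abs: "m0 \<le> \<bar>deriv F x\<bar>"
  using F_low[of x] \<sigma> by auto

sublocale pot: adapted_potential F H d lam W c "\<lambda>x. ln \<bar>deriv F x\<bar>" "B2 / m0" L
proof -
  interpret A: adapted_lift F H d lam W c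
    by (rule adapted_of_deriv) (use C2_circle_axioms exp1 lam in auto)
  show "adapted_potential F H d lam W c (\<lambda>x. ln \<bar>deriv F x\<bar>) (B2 / m0) L"
  proof
    show "ln \<bar>deriv F (x + 1)\<bar> = ln \<bar>deriv F x\<bar>" for x by (simp add: per1)
    show "\<bar>ln \<bar>deriv F x\<bar> - ln \<bar>deriv F y\<bar>\<bar> \<le> B2 / m0 * \<bar>H x - H y\<bar>" for x y
      by (rule ln_deriv_lip[OF C2_circle_axioms F_low_abs m0 B2])
    have "\<bar>deriv F x\<bar> \<le> B1 + 1" for x using B1[of x] by linarith
    then show "\<bar>H (F x) - H (F y)\<bar> \<le> L * \<bar>H x - H y\<bar>" for x y
      by (rule H_lip_of_deriv[OF C2_circle_axioms])
  qed
qed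

sublocale inv: adapted_set F H d lam W c pot.Z
  by unfold_locales (use pot.Z_per pot.Z_forward pot.Z_nonempty in auto)

definition Lu :: real where "Lu = B2 / m0 / (lam - 1)"
definition KW :: real where "KW = Lu * W"
definition M' :: real where "M' = 2 * (B2 + 1) / m0 + Lu * L + Lu"
text \<open>With outer radius \<open>\<kappa> * D\<close> and inner radius
  \<open>\<theta> * D\<close>, where \<open>\<theta> \<le> \<kappa>\<close>, this yields
  \<open>L * (\<kappa> * D) + \<theta> * D \<le> D / 4\<close>, within the gap \<open>D / 2\<close>
  that remains for a perturbed orbit.\<close>

definition \<kappa> :: real where "\<kappa> = 1 / (4 * (L + 1))"

lemma Lu_nonneg: "Lu \<ge> 0" unfolding Lu_def using B_nonneg m0 lam by simp

lemma KW_nonneg: "KW \<ge> 0" unfolding KW_def using Lu_nonneg W1 by simp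

lemma M'_nonneg: "M' \<ge> 0" unfolding M'_def using B_nonneg m0 Lu_nonneg L_nonneg by simp

lemma \<kappa>: "0 < \<kappa>" "\<kappa> \<le> 1 / 4" "(L + 1) * \<kappa> = 1 / 4"
  unfolding \<kappa>_def using L_nonneg by (auto simp: field_simps)

lemma u_lipH: "\<bar>pot.u x - pot.u y\<bar> \<le> Lu * \<bar>H x - H y\<bar>"
  using pot.u_lip unfolding Lu_def by simp

lemma u_lip: "\<bar>pot.u x - pot.u y\<bar> \<le> KW * \<bar>x - y\<bar>"
  using u_lipH[of x y] mult_left_mono[OF H_up[of x y] Lu_nonneg] unfolding KW_def by (simp add: mult.assoc)

lemma u_cont: "continuous_on UNIV pot.u"
proof -
  have "KW-lipschitz_on UNIV pot.u"
    using u_lip KW_nonneg by (intro lipschitz_onI) (auto simp: dist_real_def)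
  then show ?thesis by (rule lipschitz_on_continuous_on)
qed

text \<open>The function \<open>u\<close> belongs to the unperturbed \<open>F\<close> and is kept
  for every \<open>T\<close>, so that \<open>psi T\<close> is close to \<open>psi S\<close> whenever
  \<open>T\<close> is close to \<open>S\<close>.\<close>

definition psi :: "(real \<Rightarrow> real) \<Rightarrow> real \<Rightarrow> real" where
  "psi T x = ln \<bar>deriv T x\<bar> - pot.u (T x) + pot.u x"

end

text \<open>\<open>\<theta> * D\<close> and \<open>\<kappa> * D\<close> become the two radii of the
  locking criterion, and \<open>\<eta>\<close> bounds the deficit of the orbit. The width
  \<open>s\<close> translates the gap: adapted distance \<open>D\<close> means Euclidean distance at
  least \<open>2 * s\<close>.\<close>

locale locking_setup = C2_expanding +
  fixes N :: nat and q D \<epsilon> \<theta> \<eta> s :: real and l :: int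
  assumes N: "N \<ge> 1" and q: "(F ^^ N) q = q + of_int l" and D: "0 < D" "D \<le> 1"
    and sepH: "i < N \<Longrightarrow> j < N \<Longrightarrow> i \<noteq> j \<or> k \<noteq> 0 \<Longrightarrow> D \<le> \<bar>H ((F ^^ i) q + of_int k) - H ((F ^^ j) q)\<bar>"
    and s_def: "s = D / (2 * W)"
    and fsum: "(\<Sum>i<N. pot.fbar ((F ^^ i) q)) \<le> \<eta>"
    and \<epsilon>: "0 < \<epsilon>" "\<epsilon> \<le> 1 / 14" and \<theta>: "0 < \<theta>" "\<theta> \<le> \<kappa> / 2"
    and \<eta>: "\<eta> \<le> \<epsilon> * s * \<theta>\<^sup>2 / 16" and KWs: "KW * s \<le> \<theta> / 4"
    and shadow: "M' * (\<theta> * D * lam' / (lam' - 1)) \<le> \<epsilon> * s * \<kappa>\<^sup>2 / 16"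
begin

abbreviation p :: "nat \<Rightarrow> real" where "p i \<equiv> (F ^^ i) q"

lemma s: "0 < s" "s \<le> 1" "2 * W * s = D"
proof -
  show "0 < s" "2 * W * s = D" using D W1 unfolding s_def by auto
  have "D / (2 * W) \<le> 1 / 1" using D W1 by (intro frac_le) auto
  then show "s \<le> 1" unfolding s_def by simp
qed

lemma sin_far:
  assumes "\<And>k::int. v * (2 * W * s) \<le> \<bar>H x - H (p i + of_int k)\<bar>"
  shows "2 * v * s \<le> \<bar>sin (pi * (x - p i))\<bar>"
proof (rule sin_pi_gap)
  fix k :: int
  have "v * (2 * W * s) \<le> W * \<bar>x - (p i + of_int (- k))\<bar>"
    using assms[of "- k"] H_up[of x "p i + of_int (- k)"] by linarith
  then have "W * (2 * v * s) \<le> W * \<bar>x - p i + of_int k\<bar>" by (simp add: algebra_simps)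
  then show "2 * v * s \<le> \<bar>x - p i + of_int k\<bar>" using W1 by (simp add: mult_le_cancel_left)
qed

sublocale B: bump_sum N p s \<epsilon>
proof
  show "2 * s \<le> \<bar>sin (pi * (p i - p j))\<bar>" if "i < N" "j < N" "i \<noteq> j" for i j
  proof -
    have "2 * 1 * s \<le> \<bar>sin (pi * (p i - p j))\<bar>"
    proof (rule sin_far)
      show "1 * (2 * W * s) \<le> \<bar>H (p i) - H (p j + of_int k)\<bar>" for k
        using sepH[of j i k] that s by (simp add: abs_minus_commute)
    qed
    then show ?thesis by simp
  qed
qed (use N s \<epsilon> in auto)

definition S :: "real \<Rightarrow> real" where "S x = F (x + B.g x)"

text \<open>The level of \<open>psi S\<close> at an orbit point with \<open>fbar = 0\<close>: there
  the derivative of \<open>F\<close> is multiplied by \<open>1 - \<epsilon> * s\<close>.\<close>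

definition \<beta> :: real where "\<beta> = pot.\<alpha> + ln (1 - \<epsilon> * s)"

lemma S_eq: "S = (\<lambda>x. F (x + B.g x))" by (rule ext) (simp add: S_def)

lemma S_C2: "C2_circle S d"
  unfolding S_eq by (rule compose_C2_circle[OF B.g_deriv B.g1_deriv B.g2_cont B.g_per(1)])

text \<open>As \<open>S x\<close> is the image under \<open>F\<close> of the displaced point,
  \<open>fbar\<close> appears at that point, and the only error is the change of \<open>u\<close>
  along the displacement.\<close>

lemma psi_S: "psi S x = pot.\<alpha> + pot.fbar (x + B.g x) + ln (1 + B.g1 x) + pot.u x - pot.u (x + B.g x)"
proof -
  define y where "y = x + B.g x"
  have dS: "deriv S x = deriv F y * (1 + B.g1 x)"
    unfolding S_eq compose_deriv(1)[OF B.g_deriv B.g1_deriv] y_def ..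
  have "1 + B.g1 x > 0" using B.g1_bounds(1)[of x] B.\<epsilon>s \<epsilon> by linarith
  then have "ln \<bar>deriv S x\<bar> = ln \<bar>deriv F y\<bar> + ln (1 + B.g1 x)"
    using F_low_abs[of y] m0 unfolding dS by (simp add: abs_mult ln_mult)
  then show ?thesis unfolding psi_def pot.fbar_def S_def y_def[symmetric] by simp
qed

lemma psi_S_far:
  assumes "\<And>i. i < N \<Longrightarrow> v * s \<le> \<bar>sin (pi * (x - p i))\<bar>" and v: "\<theta> \<le> v" "v \<le> 1"
  shows "psi S x \<ge> \<beta> + \<epsilon> * s * v\<^sup>2 / 4"
proof -
  have "ln (1 + B.g1 x) - ln (1 - \<epsilon> * s) - KW * \<bar>B.g x\<bar> \<ge> \<epsilon> * s * v\<^sup>2 / 4"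
    by (rule B.gain) (use assms \<theta> KWs KW_nonneg in auto)
  moreover have "\<bar>pot.u x - pot.u (x + B.g x)\<bar> \<le> KW * \<bar>B.g x\<bar>" using u_lip[of x "x + B.g x"] by simp
  ultimately show ?thesis unfolding psi_S \<beta>_def using pot.fbar_nonneg[of "x + B.g x"] by linarith
qed

lemma S_orbit: "i < N \<Longrightarrow> S (p i) = F (p i)"
  using B.g_at[of i 0] by (simp add: S_def)

lemma psi_S_orbit: "i < N \<Longrightarrow> psi S (p i) = \<beta> + pot.fbar (p i)"
  using B.g_at[of i 0] unfolding psi_S \<beta>_def by simp

lemma psi_lip:
  assumes T: "C2_circle T d'" and low: "\<And>x. m0 / 2 \<le> \<bar>deriv T x\<bar>"
    and up1: "\<And>x. \<bar>deriv T x\<bar> \<le> B1 + 1" and up2: "\<And>x. \<bar>deriv (deriv T) x\<bar> \<le> B2 + 1"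
  shows "\<bar>psi T x - psi T y\<bar> \<le> M' * \<bar>H x - H y\<bar>"
proof -
  have "\<bar>ln \<bar>deriv T x\<bar> - ln \<bar>deriv T y\<bar>\<bar> \<le> (B2 + 1) / (m0 / 2) * \<bar>H x - H y\<bar>"
    by (rule ln_deriv_lip[OF T low _ up2]) (use m0 in simp)
  moreover have "(B2 + 1) / (m0 / 2) = 2 * (B2 + 1) / m0" by simp
  moreover have "\<bar>pot.u (T x) - pot.u (T y)\<bar> \<le> Lu * (L * \<bar>H x - H y\<bar>)"
    using u_lipH[of "T x" "T y"] mult_left_mono[OF H_lip_of_deriv[OF T up1, of x y] Lu_nonneg] by linarith
  moreover have "M' * h = 2 * (B2 + 1) / m0 * h + Lu * (L * h) + Lu * h" for h
    unfolding M'_def by (simp add: distrib_right)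
  ultimately show ?thesis using u_lipH[of x y] unfolding psi_def by (smt (verit))
qed

lemma psi_close:
  assumes low: "m0 / 2 \<le> \<bar>deriv T x\<bar>" "m0 / 2 \<le> \<bar>deriv S x\<bar>"
    and cl: "\<bar>T x - S x\<bar> \<le> \<delta>" "\<bar>deriv T x - deriv S x\<bar> \<le> \<delta>"
  shows "\<bar>psi T x - psi S x\<bar> \<le> (2 / m0 + KW) * \<delta>"
proof -
  have "\<bar>ln \<bar>deriv T x\<bar> - ln \<bar>deriv S x\<bar>\<bar> \<le> \<bar>\<bar>deriv T x\<bar> - \<bar>deriv S x\<bar>\<bar> / (m0 / 2)"
    using low m0 by (intro ln_lipschitz) auto
  also have "\<dots> \<le> \<delta> / (m0 / 2)" using cl m0 by (intro divide_right_mono) auto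
  finally have 1: "\<bar>ln \<bar>deriv T x\<bar> - ln \<bar>deriv S x\<bar>\<bar> \<le> 2 / m0 * \<delta>" by (simp add: mult.commute)
  have "\<bar>pot.u (T x) - pot.u (S x)\<bar> \<le> KW * \<delta>"
    using u_lip[of "T x" "S x"] mult_left_mono[OF cl(1) KW_nonneg] by linarith
  then show ?thesis using 1 unfolding psi_def distrib_right by linarith
qed

text \<open>Closing the orbit of \<open>S\<close> under \<open>T\<close> continues it to a periodic
  orbit of \<open>T\<close> within \<open>\<zeta>\<close>, and \<open>\<tau>\<close> bounds the
  resulting change of \<open>psi\<close>. The locking criterion then holds for \<open>T\<close>,
  with gap \<open>D / 2\<close>.\<close>

lemma locked_perturbation:
  assumes T: "C2_circle T d'" and expT: "\<And>x. lam' * w x \<le> \<sigma> * deriv T x * w (T x)"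
    and low: "\<And>x. m0 / 2 \<le> \<bar>deriv T x\<bar>" "\<And>x. m0 / 2 \<le> \<bar>deriv S x\<bar>"
    and up1: "\<And>x. \<bar>deriv T x\<bar> \<le> B1 + 1" and up2: "\<And>x. \<bar>deriv (deriv T) x\<bar> \<le> B2 + 1"
    and cl: "\<And>x. \<bar>T x - S x\<bar> \<le> \<delta>" "\<And>x. \<bar>deriv T x - deriv S x\<bar> \<le> \<delta>"
    and \<zeta>: "real N * (W * \<delta>) \<le> (lam' - 1) * \<zeta>" "\<zeta> \<le> \<theta> * D / 2"
    and \<tau>: "M' * \<zeta> + (2 / m0 + KW) * \<delta> \<le> \<tau>" "(2 + 2 * real N) * \<tau> \<le> \<epsilon> * s * \<theta>\<^sup>2 / 32"
  shows "uniquely_locked T"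
proof -
  interpret T: C2_circle T d' by fact
  interpret A: adapted_lift T H d' lam' W c by (rule adapted_of_deriv[OF T expT lam'(1)])
  have \<delta>0: "\<delta> \<ge> 0" using cl(1)[of 0] by linarith
  \<comment> \<open>Under \<open>T\<close> the orbit of \<open>S\<close> is a pseudo-orbit with
    jumps of at most \<open>W * \<delta>\<close>; the last step also takes back the translation
    \<open>l\<close>.\<close>
  define x where "x t = (if t < N then p t else q)" for t
  define k where "k t = (if Suc t = N then - l else 0)" for t
  have jump: "\<bar>H (T (x t) + of_int (k t)) - H (x (Suc t))\<bar> \<le> W * \<delta>" if t: "t < N" for t
  proof -
    have "x (Suc t) = S (x t) + of_int (k t)"
      using t q S_orbit[OF t] by (cases "Suc t = N") (auto simp: x_def k_def)
    then have "\<bar>H (T (x t) + of_int (k t)) - H (x (Suc t))\<bar> \<le> W * \<bar>T (x t) - S (x t)\<bar>"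
      using H_up[of "T (x t) + of_int (k t)" "x (Suc t)"] by simp
    also have "\<dots> \<le> W * \<delta>" using cl W1 by (intro mult_left_mono) auto
    finally show ?thesis .
  qed
  have "x N = x 0" using N by (simp add: x_def)
  from A.closing[OF N this jump] obtain q' l' a where
    q': "(T ^^ N) q' = q' + of_int l'" and
    sum: "(lam' - 1) * (\<Sum>t<N. \<bar>H ((T ^^ t) q') - H (x t + of_int (a t))\<bar>) \<le> real N * (W * \<delta>)"
    by auto
  have near: "\<bar>H ((T ^^ t) q') - H (p t + of_int (a t))\<bar> \<le> \<zeta>" if t: "t < N" for t
  proof -
    have "\<bar>H ((T ^^ t) q') - H (x t + of_int (a t))\<bar> \<le> (\<Sum>t<N. \<bar>H ((T ^^ t) q') - H (x t + of_int (a t))\<bar>)"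
      by (rule member_le_sum) (use t in auto)
    also have "\<dots> \<le> \<zeta>" using sum \<zeta>(1) lam' by (smt (verit) mult_le_cancel_left_pos)
    finally show ?thesis using t by (simp add: x_def)
  qed
  have near_int: "\<bar>H ((T ^^ t) q' + of_int j) - H (p t + of_int (a t + j))\<bar> \<le> \<zeta>" if t: "t < N" for t j
    using near[OF t] A.H_int_diff[of "(T ^^ t) q'" j "p t + of_int (a t)"] by (simp add: add.assoc)
  have plip: "\<bar>psi T x - psi T y\<bar> \<le> M' * \<bar>H x - H y\<bar>" for x y
    by (rule psi_lip[OF T low(1) up1 up2])
  have uT: "pot.u (T (x + 1)) = pot.u (T x)" for x
    unfolding T.Fper by (rule periodic_of_int[of pot.u, OF pot.u_per])
  have pper: "psi T (x + 1) = psi T x" for x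
    unfolding psi_def by (simp add: T.per1 uT pot.u_per)
  have pclose: "\<bar>psi T x - psi S x\<bar> \<le> (2 / m0 + KW) * \<delta>" for x
    by (rule psi_close[OF low cl])
  have \<zeta>0: "0 \<le> \<zeta>" using near[of 0] N by linarith
  have "M' * \<zeta> \<ge> 0" using M'_nonneg \<zeta>0 by simp
  have "(2 / m0 + KW) * \<delta> \<ge> 0" using m0 KW_nonneg \<delta>0 by simp
  have ptau: "psi T x \<ge> psi S x - \<tau>" for x using pclose[of x] \<tau>(1) \<open>M' * \<zeta> \<ge> 0\<close> by linarith
  have orb: "\<bar>psi T ((T ^^ i) q') - psi S (p i)\<bar> \<le> \<tau>" if i: "i < N" for i
  proof -
    have "\<bar>psi T ((T ^^ i) q') - psi T (p i + of_int (a i))\<bar> \<le> M' * \<zeta>"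
      using plip[of "(T ^^ i) q'" "p i + of_int (a i)"] mult_left_mono[OF near[OF i] M'_nonneg] by linarith
    then show ?thesis using pclose[of "p i"] \<tau>(1) periodic_of_int[of "psi T" "p i" "a i", OF pper] by linarith
  qed
  have \<tau>0: "\<tau> \<ge> 0" using \<tau>(1) \<open>M' * \<zeta> \<ge> 0\<close> \<open>(2 / m0 + KW) * \<delta> \<ge> 0\<close> by linarith
  define av where "av = (\<Sum>i<N. psi T ((T ^^ i) q')) / real N"
  have avN: "real N * av = (\<Sum>i<N. psi T ((T ^^ i) q'))" using N unfolding av_def by simp
  have "real N * av \<le> (\<Sum>i<N. \<beta> + \<tau> + pot.fbar (p i))"
    unfolding avN using orb psi_S_orbit by (intro sum_mono) (smt (verit) lessThan_iff)
  also have "\<dots> \<le> real N * (\<beta> + \<tau>) + \<eta>" using fsum by (simp add: sum.distrib)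
  finally have avN': "real N * av \<le> real N * (\<beta> + \<tau>) + \<eta>" .
  have \<eta>0: "\<eta> \<ge> 0" using fsum sum_nonneg[of "{..<N}" "\<lambda>i. pot.fbar (p i)"] pot.fbar_nonneg by fastforce
  have av_le: "av \<le> \<beta> + \<tau> + \<eta>"
  proof -
    have "1 * \<eta> \<le> real N * \<eta>" using N \<eta>0 by (intro mult_right_mono) auto
    then have "real N * av \<le> real N * (\<beta> + \<tau> + \<eta>)" using avN' by (simp add: distrib_left)
    then show ?thesis using N by (simp add: mult_le_cancel_left)
  qed
  \<comment> \<open>\<open>\<eta> + 2 * real N * \<tau>\<close> covers an incomplete period: the
    mean exceeds \<open>\<beta>\<close> by at most \<open>\<tau> + \<eta> / real N\<close>, and
    single values fall below \<open>\<beta>\<close> by at most \<open>\<tau>\<close>. Of the gain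
    \<open>\<epsilon> * s * \<kappa>\<^sup>2 / 4\<close> outside the outer radius, two sixteenths of
    \<open>\<epsilon> * s * \<kappa>\<^sup>2\<close> pay for \<open>\<eta>\<close>, in
    \<open>av_le\<close> and in \<open>E\<close>, one for the shadowing term, and the last is shared
    by \<open>b\<close> and the errors in \<open>\<tau>\<close>.\<close>
  define E where "E = \<eta> + 2 * real N * \<tau> + M' * (\<theta> * D * lam' / (lam' - 1))"
  define b where "b = \<epsilon> * s * \<theta>\<^sup>2 / 32"
  have \<theta>\<kappa>: "\<theta>\<^sup>2 \<le> \<kappa>\<^sup>2" "\<theta> \<le> 1" "\<theta> < \<kappa>" "\<kappa> \<le> 1" using \<theta> \<kappa> by (auto intro!: power_mono)
  have es: "0 < \<epsilon> * s" using \<epsilon> s by simp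
  have es0: "0 \<le> \<epsilon> * s * \<theta>\<^sup>2" using es by simp
  have es\<theta>: "\<epsilon> * s * \<theta>\<^sup>2 \<le> \<epsilon> * s * \<kappa>\<^sup>2" using \<theta>\<kappa> es by (intro mult_left_mono) auto
  have N\<tau>: "2 * \<tau> + 2 * real N * \<tau> \<le> \<epsilon> * s * \<theta>\<^sup>2 / 32" using \<tau>(2) by (simp add: algebra_simps)
  have N\<tau>0: "0 \<le> 2 * real N * \<tau>" using \<tau>0 by simp
  have sinfar: "v * s \<le> \<bar>sin (pi * (x - p i))\<bar>"
    if h: "\<And>i k. i < N \<Longrightarrow> v * D \<le> \<bar>H x - H ((T ^^ i) q' + of_int k)\<bar>" and i: "i < N" and v: "\<theta> \<le> v" for v x i
  proof -
    \<comment> \<open>Half of the distance \<open>v * D\<close> is given up in passing from the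
      orbit of \<open>T\<close> to that of \<open>S\<close>.\<close>
    have "2 * (v / 2) * s \<le> \<bar>sin (pi * (x - p i))\<bar>"
    proof (rule sin_far)
      fix k :: int
      have "\<bar>H ((T ^^ i) q' + of_int (k - a i)) - H (p i + of_int k)\<bar> \<le> \<zeta>"
        using near_int[OF i, of "k - a i"] by simp
      moreover have "v * D \<le> \<bar>H x - H ((T ^^ i) q' + of_int (k - a i))\<bar>" by (rule h[OF i])
      moreover have "\<zeta> \<le> v * D / 2" using \<zeta>(2) v D mult_right_mono[of \<theta> v D] by linarith
      ultimately show "v / 2 * (2 * W * s) \<le> \<bar>H x - H (p i + of_int k)\<bar>" unfolding s(3) by linarith
    qed
    then show ?thesis by simp
  qed
  have "locked_lyap T H d' lam' W c (psi T) M' L av b (\<theta> * D) (\<kappa> * D) (D / 2) E q' N l' pot.u"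
  proof
    show "psi T (x + 1) = psi T x" for x by (rule pper)
    show "\<bar>psi T x - psi T y\<bar> \<le> M' * \<bar>H x - H y\<bar>" for x y by (rule plip)
    show "\<bar>H (T x) - H (T y)\<bar> \<le> L * \<bar>H x - H y\<bar>" for x y by (rule H_lip_of_deriv[OF T up1])
    show "1 \<le> N" by (rule N)
    show "(T ^^ N) q' = q' + of_int l'" by (rule q')
    show "D / 2 \<le> \<bar>H ((T ^^ i) q' + of_int k) - H ((T ^^ j) q')\<bar>"
      if ij: "i < N" "j < N" "i \<noteq> j \<or> k \<noteq> 0" for i j k
    proof -
      have "D \<le> \<bar>H (p i + of_int (a i + k - a j)) - H (p j)\<bar>"
        using ij by (intro sepH) auto
      also have "\<dots> = \<bar>H (p i + of_int (a i + k)) - H (p j + of_int (a j))\<bar>"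
        unfolding pot.H_int by (simp add: algebra_simps)
      finally have "D \<le> \<bar>H (p i + of_int (a i + k)) - H (p j + of_int (a j))\<bar>" .
      moreover have "\<zeta> \<le> D / 4" using \<zeta>(2) \<theta> \<kappa> D mult_right_mono[of \<theta> "1 / 2" D] by linarith
      ultimately show ?thesis using near[OF ij(2)] near_int[OF ij(1), of k] by linarith
    qed
    show "0 < \<theta> * D" "\<theta> * D < \<kappa> * D" using \<theta> \<theta>\<kappa> D by auto
    have "L * (\<kappa> * D) + \<theta> * D \<le> (L + 1) * \<kappa> * D"
      using \<theta>\<kappa> D mult_right_mono[of \<theta> \<kappa> D] by (simp add: algebra_simps)
    then show "L * (\<kappa> * D) + \<theta> * D \<le> D / 2" unfolding \<kappa>(3) using D by linarith
    show "(\<Sum>i<N. psi T ((T ^^ i) q')) = real N * av" by (simp add: avN)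
    show "0 < b" unfolding b_def using es \<theta> by simp
    show "av + b \<le> psi T x" if h: "\<And>i k. i < N \<Longrightarrow> \<theta> * D \<le> \<bar>H x - H ((T ^^ i) q' + of_int k)\<bar>" for x
    proof -
      have "psi S x \<ge> \<beta> + \<epsilon> * s * \<theta>\<^sup>2 / 4"
        by (rule psi_S_far) (use sinfar[of \<theta> x] h \<theta>\<kappa> in auto)
      then show ?thesis using ptau[of x] av_le \<eta> es0 N\<tau> N\<tau>0 unfolding b_def by linarith
    qed
    show "av + b + E \<le> psi T x" if h: "\<And>i k. i < N \<Longrightarrow> \<kappa> * D \<le> \<bar>H x - H ((T ^^ i) q' + of_int k)\<bar>" for x
    proof -
      have "psi S x \<ge> \<beta> + \<epsilon> * s * \<kappa>\<^sup>2 / 4"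
        by (rule psi_S_far) (use sinfar[of \<kappa> x] h \<theta>\<kappa> in auto)
      then show ?thesis using ptau[of x] av_le \<eta> es0 N\<tau> N\<tau>0 es\<theta> shadow unfolding b_def E_def by linarith
    qed
    show "real N * (av - psi T ((T ^^ i) q')) + M' * (\<theta> * D * lam' / (lam' - 1)) \<le> E" if i: "i < N" for i
    proof -
      have "psi T ((T ^^ i) q') \<ge> \<beta> - \<tau>"
        using orb[OF i] psi_S_orbit[OF i] pot.fbar_nonneg[of "p i"] by linarith
      then have "real N * (\<beta> - \<tau>) \<le> real N * psi T ((T ^^ i) q')" by (intro mult_left_mono) auto
      then show ?thesis using avN' unfolding E_def by (simp add: algebra_simps)
    qed
    show "continuous_on UNIV pot.u" by (rule u_cont)
    show "pot.u (x + 1) = pot.u x" for x by (rule pot.u_per)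
    show "ln \<bar>deriv T x\<bar> = psi T x + pot.u (T x) - pot.u x" for x by (simp add: psi_def)
  qed
  then interpret K: locked_lyap T H d' lam' W c "psi T" M' L av b "\<theta> * D" "\<kappa> * D" "D / 2" E q' N l' pot.u .
  show ?thesis unfolding uniquely_locked_def by (rule K.unique_periodic_minimizer)
qed

end

section \<open>Choice of the constants\<close>

context C2_expanding
begin

lemma expanding_of_deriv:
  assumes T: "C2_circle T d'" and low: "\<And>x. lam' * w x \<le> \<sigma> * deriv T x * w (T x)"
  shows "expanding_lift T"
proof -
  interpret T: C2_circle T d' by fact
  have w0: "w y \<ge> 0" for y using w_bounds(1)[of y] by linarith
  have low': "lam' * w x \<le> \<bar>deriv T x\<bar> * w (T x)" for x
  proof -
    have "\<sigma> * deriv T x \<le> \<bar>deriv T x\<bar>" using \<sigma> by auto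
    then have "\<sigma> * deriv T x * w (T x) \<le> \<bar>deriv T x\<bar> * w (T x)" using w0 by (intro mult_right_mono)
    then show ?thesis using low[of x] by linarith
  qed
  have iter: "lam' ^ n * w x \<le> \<bar>T.Pn n x\<bar> * w ((T ^^ n) x)" for n x
  proof (induction n)
    case 0
    then show ?case by (simp add: T.Pn_def)
  next
    case (Suc n)
    have "lam' ^ Suc n * w x = lam' * (lam' ^ n * w x)" by simp
    also have "\<dots> \<le> lam' * (\<bar>T.Pn n x\<bar> * w ((T ^^ n) x))" using Suc lam' by (intro mult_left_mono) auto
    also have "\<dots> = \<bar>T.Pn n x\<bar> * (lam' * w ((T ^^ n) x))" by simp
    also have "\<dots> \<le> \<bar>T.Pn n x\<bar> * (\<bar>deriv T ((T ^^ n) x)\<bar> * w (T ((T ^^ n) x)))"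
      using low' by (intro mult_left_mono) auto
    also have "\<dots> = \<bar>T.Pn (Suc n) x\<bar> * w ((T ^^ Suc n) x)" by (simp add: T.Pn_def abs_mult)
    finally show ?case .
  qed
  have "1 / W * lam' ^ n \<le> \<bar>deriv (T ^^ n) x\<bar>" for n x
  proof -
    have "lam' ^ n * 1 \<le> lam' ^ n * w x" using w_bounds(1) lam' by (intro mult_left_mono) auto
    also have "\<dots> \<le> \<bar>T.Pn n x\<bar> * w ((T ^^ n) x)" by (rule iter)
    also have "\<dots> \<le> \<bar>T.Pn n x\<bar> * W" using w_bounds(2) by (intro mult_left_mono) auto
    finally show ?thesis unfolding T.deriv_iter using W1 by (simp add: field_simps)
  qed
  then show ?thesis unfolding expanding_lift_def using W1 lam' by (intro exI[of _ "1 / W"] conjI exI[of _ lam']) auto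
qed

text \<open>The order of choices matters. The prescribed closeness gives \<open>\<epsilon>\<close>;
  then \<open>\<theta>\<close> is chosen, possible because both sides of the shadowing condition are
  linear in \<open>D\<close>; then the accuracy \<open>\<epsilon>'\<close> and the bound
  \<open>D0\<close>. Only now is the orbit taken, and the tolerance \<open>\<delta>\<close>, which
  depends on its period, comes last.\<close>

lemma locking_nearby:
  assumes e0: "e0 > 0"
  shows "\<exists>S. C2_circle S d \<and> expanding_lift S \<and>
    (\<forall>x. \<bar>S x - F x\<bar> \<le> e0 \<and> \<bar>deriv S x - deriv F x\<bar> \<le> e0 \<and> \<bar>deriv (deriv S) x - deriv (deriv F) x\<bar> \<le> e0) \<and>
    (\<exists>\<delta>>0. \<forall>T d'. C2_circle T d' \<longrightarrow>
      (\<forall>x. \<bar>T x - S x\<bar> \<le> \<delta> \<and> \<bar>deriv T x - deriv S x\<bar> \<le> \<delta> \<and> \<bar>deriv (deriv T) x - deriv (deriv S) x\<bar> \<le> \<delta>) \<longrightarrow>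
      uniquely_locked T)"
proof -
  obtain \<eta>0 where \<eta>0: "\<eta>0 > 0" and exp\<eta>: "\<And>T x. (\<forall>x. \<bar>T x - F x\<bar> \<le> \<eta>0) \<Longrightarrow>
      (\<forall>x. \<bar>deriv T x - deriv F x\<bar> \<le> \<eta>0) \<Longrightarrow> lam' * w x \<le> \<sigma> * deriv T x * w (T x)"
    using perturbed_expansion[OF lam'(2) \<sigma> exp1 B1] by blast
  \<comment> \<open>Two errors add up, one from \<open>F\<close> to \<open>S\<close> and one from
    \<open>S\<close> to \<open>T\<close>, so the requirements concern \<open>2 * e\<close>.\<close>
  define e where "e = min (min \<eta>0 (m0 / 2)) 1 / 2"
  have e: "e > 0" "2 * e \<le> \<eta>0" "2 * e \<le> m0 / 2" "2 * e \<le> 1" using \<eta>0 m0 unfolding e_def by auto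
  define e1 where "e1 = min e0 e"
  have e1: "e1 > 0" "e1 \<le> e0" "e1 \<le> e" using e e0 unfolding e1_def by auto
  obtain \<epsilon>0 where \<epsilon>0: "\<epsilon>0 > 0" and close: "\<And>\<epsilon> h h1 h2 x. 0 < \<epsilon> \<Longrightarrow> \<epsilon> \<le> \<epsilon>0 \<Longrightarrow>
    (\<forall>x. (h has_real_derivative h1 x) (at x)) \<Longrightarrow> (\<forall>x. (h1 has_real_derivative h2 x) (at x)) \<Longrightarrow>
    (\<forall>x. \<bar>h x\<bar> \<le> \<epsilon> \<and> \<bar>h1 x\<bar> \<le> 7 * \<epsilon> \<and> \<bar>h2 x\<bar> \<le> 200 * \<epsilon>) \<Longrightarrow>
    \<bar>F (x + h x) - F x\<bar> \<le> e1 \<and> \<bar>deriv (\<lambda>x. F (x + h x)) x - deriv F x\<bar> \<le> e1 \<and>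
      \<bar>deriv (deriv (\<lambda>x. F (x + h x))) x - deriv (deriv F) x\<bar> \<le> e1"
    using compose_close[OF e1(1)] by blast
  define \<epsilon> where "\<epsilon> = min \<epsilon>0 (1 / 14)"
  have \<epsilon>: "0 < \<epsilon>" "\<epsilon> \<le> 1 / 14" "\<epsilon> \<le> \<epsilon>0" using \<epsilon>0 unfolding \<epsilon>_def by auto
  have cancel: "b * (x / (a * b)) = x / a" if "b \<noteq> 0" for x a b :: real using that by simp
  define Q where "Q = M' * (2 * W) * (lam' / (lam' - 1))"
  have Q: "Q \<ge> 0" unfolding Q_def using M'_nonneg W1 lam' by simp
  define \<theta> where "\<theta> = min (\<kappa> / 2) (\<epsilon> * \<kappa>\<^sup>2 / (16 * (Q + 1)))"
  have \<theta>: "0 < \<theta>" "\<theta> \<le> \<kappa> / 2" "\<theta> \<le> \<epsilon> * \<kappa>\<^sup>2 / (16 * (Q + 1))"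
  proof -
    have "0 < \<epsilon> * \<kappa>\<^sup>2 / (16 * (Q + 1))" using \<kappa> \<epsilon> Q by simp
    then show "0 < \<theta>" using \<kappa>(1) unfolding \<theta>_def by simp
    show "\<theta> \<le> \<kappa> / 2" "\<theta> \<le> \<epsilon> * \<kappa>\<^sup>2 / (16 * (Q + 1))"
      unfolding \<theta>_def by (rule min.cobounded1, rule min.cobounded2)
  qed
  have Q\<theta>: "Q * \<theta> \<le> \<epsilon> * \<kappa>\<^sup>2 / 16"
  proof -
    have "Q * \<theta> \<le> (Q + 1) * \<theta>" using \<theta> by simp
    also have "\<dots> \<le> (Q + 1) * (\<epsilon> * \<kappa>\<^sup>2 / (16 * (Q + 1)))" using \<theta> Q by (intro mult_left_mono) auto
    also have "\<dots> = \<epsilon> * \<kappa>\<^sup>2 / 16" using Q by (intro cancel) simp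
    finally show ?thesis .
  qed
  \<comment> \<open>Since \<open>D = 2 * W * s\<close>, this makes
    \<open>pot.M0 * (\<epsilon>' * D)\<close> at most
    \<open>\<epsilon> * s * \<theta>\<^sup>2 / 16\<close>.\<close>
  define \<epsilon>' where "\<epsilon>' = \<epsilon> * \<theta>\<^sup>2 / (32 * W * (pot.M0 + 1))"
  have M01: "pot.M0 + 1 > 0" using pot.M0_nonneg by linarith
  have \<epsilon>': "\<epsilon>' > 0" unfolding \<epsilon>'_def using \<epsilon> \<theta> W1 M01 by simp
  define D0 where "D0 = min 1 (\<theta> / (4 * (KW + 1)))"
  have D0: "D0 > 0" unfolding D0_def using \<theta> KW_nonneg by simp
  obtain N q l D where N: "N \<ge> 1" and q: "(F ^^ N) q = q + of_int l" and D: "0 < D" "D \<le> D0" and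
    sum: "(\<Sum>t<N. inv.DA ((F ^^ t) q)) \<le> \<epsilon>' * D" and
    sep: "\<And>i j k. i < N \<Longrightarrow> j < N \<Longrightarrow> i \<noteq> j \<or> k \<noteq> 0 \<Longrightarrow> D \<le> \<bar>H ((F ^^ i) q + of_int k) - H ((F ^^ j) q)\<bar>"
    using inv.well_separated_orbit[OF \<epsilon>' D0] by metis
  define s where "s = D / (2 * W)"
  have s: "0 < s" "2 * W * s = D" "s \<le> D" using D W1 unfolding s_def
    by (auto simp: field_simps)
  define \<eta> where "\<eta> = pot.M0 * (\<epsilon>' * D)"
  have fle: "pot.fbar x \<le> pot.M0 * inv.DA x" for x
  proof (cases "pot.M0 = 0")
    case True
    obtain z where "z \<in> pot.Z" using pot.Z_nonempty by blast
    then have "pot.fbar ((F ^^ 0) z) = 0" unfolding pot.Z_def by blast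
    then show ?thesis using pot.fbar_lip[of x z] True by simp
  next
    case False
    then have pos: "pot.M0 > 0" using pot.M0_nonneg by simp
    have "pot.fbar x / pot.M0 \<le> dist (H x) v" if v: "v \<in> H ` pot.Z" for v
    proof -
      obtain z where z: "z \<in> pot.Z" "v = H z" using v by auto
      have "pot.fbar ((F ^^ 0) z) = 0" using z unfolding pot.Z_def by blast
      then have "pot.fbar x \<le> pot.M0 * \<bar>H x - H z\<bar>" using pot.fbar_lip[of x z] by simp
      then show ?thesis using pos by (simp add: z dist_real_def field_simps)
    qed
    then have "pot.fbar x / pot.M0 \<le> inv.DA x"
      unfolding inv.DA_def using pot.Z_nonempty by (auto simp: infdist_notempty intro!: cINF_greatest)
    then show ?thesis using pos by (simp add: field_simps)
  qed
  have fsum: "(\<Sum>i<N. pot.fbar ((F ^^ i) q)) \<le> \<eta>"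
  proof -
    have "(\<Sum>i<N. pot.fbar ((F ^^ i) q)) \<le> (\<Sum>i<N. pot.M0 * inv.DA ((F ^^ i) q))" by (intro sum_mono fle)
    also have "\<dots> \<le> \<eta>" unfolding sum_distrib_left[symmetric] \<eta>_def
      by (intro mult_left_mono sum pot.M0_nonneg)
    finally show ?thesis .
  qed
  have \<eta>le: "\<eta> \<le> \<epsilon> * s * \<theta>\<^sup>2 / 16"
  proof -
    have "\<eta> \<le> (pot.M0 + 1) * (\<epsilon>' * D)" unfolding \<eta>_def using \<epsilon>' D by (intro mult_right_mono) auto
    also have "\<dots> = \<epsilon> * \<theta>\<^sup>2 * s / 16"
    proof -
      have "m * (x / (32 * W * m) * (2 * W * s)) = x * s / 16" if "m \<noteq> 0" for m x
        using that W1 by (simp add: field_simps)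
      moreover have "pot.M0 + 1 \<noteq> 0" using M01 by linarith
      ultimately show ?thesis unfolding \<epsilon>'_def s(2)[symmetric] by blast
    qed
    finally show ?thesis by (simp add: mult_ac)
  qed
  have KWs: "KW * s \<le> \<theta> / 4"
  proof -
    have "KW * s \<le> (KW + 1) * (\<theta> / (4 * (KW + 1)))"
      using s D KW_nonneg unfolding D0_def by (intro mult_mono) auto
    also have "\<dots> = \<theta> / 4" using KW_nonneg by (intro cancel) simp
    finally show ?thesis .
  qed
  have sh: "M' * (\<theta> * D * lam' / (lam' - 1)) \<le> \<epsilon> * s * \<kappa>\<^sup>2 / 16"
  proof -
    have "M' * (\<theta> * D * lam' / (lam' - 1)) = s * (Q * \<theta>)" unfolding Q_def s(2)[symmetric] by simp
    also have "\<dots> \<le> s * (\<epsilon> * \<kappa>\<^sup>2 / 16)" using Q\<theta> s by (intro mult_left_mono) auto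
    finally show ?thesis by (simp add: mult_ac)
  qed
  interpret K: locking_setup F d H w W c \<sigma> lam m0 B1 B2 N q D \<epsilon> \<theta> \<eta> s l
  proof
    show "s = D / (2 * W)" by (rule s_def)
    show "D \<le> 1" using D unfolding D0_def by simp
  qed (use N q D sep fsum \<epsilon> \<theta> \<eta>le KWs sh in auto)
  have clS: "\<bar>K.S x - F x\<bar> \<le> e1 \<and> \<bar>deriv K.S x - deriv F x\<bar> \<le> e1 \<and> \<bar>deriv (deriv K.S) x - deriv (deriv F) x\<bar> \<le> e1" for x
    using close[OF \<epsilon>(1,3), of K.B.g K.B.g1 K.B.g2 x] K.B.g_deriv K.B.g1_deriv K.B.g_bound K.B.g1_bounds(3) K.B.g2_bound
    unfolding K.S_eq by blast
  have S\<eta>: "\<bar>K.S x - F x\<bar> \<le> \<eta>0" "\<bar>deriv K.S x - deriv F x\<bar> \<le> \<eta>0" for x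
    using clS[of x] e e1 by linarith+
  have expS: "expanding_lift K.S"
    by (rule expanding_of_deriv[OF K.S_C2 exp\<eta>]) (use S\<eta> in blast)+
  define CN where "CN = M' * (real N * W / (lam' - 1)) + (2 / m0 + KW)"
  have CN: "CN \<ge> 0" unfolding CN_def using M'_nonneg W1 lam' m0 KW_nonneg by simp
  define \<tau>m where "\<tau>m = \<epsilon> * s * \<theta>\<^sup>2 / 32 / (2 + 2 * real N)"
  have \<tau>m: "\<tau>m > 0" unfolding \<tau>m_def using \<epsilon> s \<theta> by simp
  \<comment> \<open>The three bounds keep \<open>T\<close> in the range of the relaxed constants,
    the change of \<open>psi\<close> below \<open>\<tau>m\<close>, and the displacement
    \<open>\<zeta>\<close> of the orbit below \<open>\<theta> * D / 2\<close>.\<close>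
  define \<delta> where "\<delta> = min e (min (\<tau>m / (CN + 1)) (\<theta> * D / 2 * (lam' - 1) / (real N * W)))"
  have \<delta>: "\<delta> > 0" "\<delta> \<le> e" "\<delta> \<le> \<tau>m / (CN + 1)" "\<delta> \<le> \<theta> * D / 2 * (lam' - 1) / (real N * W)"
    unfolding \<delta>_def using e \<tau>m CN \<theta> D lam' N W1 by auto
  define \<zeta> where "\<zeta> = real N * (W * \<delta>) / (lam' - 1)"
  have \<zeta>1: "real N * (W * \<delta>) \<le> (lam' - 1) * \<zeta>" unfolding \<zeta>_def using lam' by simp
  have \<zeta>2: "\<zeta> \<le> \<theta> * D / 2"
  proof -
    have "\<delta> * (real N * W) \<le> \<theta> * D / 2 * (lam' - 1)"
      using \<delta>(4) N W1 by (simp add: pos_le_divide_eq)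
    then show ?thesis unfolding \<zeta>_def using lam' by (simp add: pos_divide_le_eq mult_ac)
  qed
  have \<tau>1: "M' * \<zeta> + (2 / m0 + KW) * \<delta> \<le> \<tau>m"
  proof -
    have "M' * \<zeta> + (2 / m0 + KW) * \<delta> = CN * \<delta>" unfolding CN_def \<zeta>_def by (simp add: distrib_right)
    also have "\<dots> \<le> (CN + 1) * (\<tau>m / (CN + 1))" using \<delta> CN by (intro mult_mono) auto
    also have "\<dots> = \<tau>m" using CN by simp
    finally show ?thesis .
  qed
  have \<tau>2: "(2 + 2 * real N) * \<tau>m \<le> \<epsilon> * s * \<theta>\<^sup>2 / 32"
  proof -
    have "2 + 2 * real N > 0" by simp
    then have "(2 + 2 * real N) * \<tau>m = \<epsilon> * s * \<theta>\<^sup>2 / 32"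
      unfolding \<tau>m_def by (metis mult.commute nonzero_eq_divide_eq less_irrefl)
    then show ?thesis by simp
  qed
  have main: "uniquely_locked T" if T: "C2_circle T d'" and
    cl: "\<And>x. \<bar>T x - K.S x\<bar> \<le> \<delta> \<and> \<bar>deriv T x - deriv K.S x\<bar> \<le> \<delta> \<and> \<bar>deriv (deriv T) x - deriv (deriv K.S) x\<bar> \<le> \<delta>" for T d'
  proof (rule K.locked_perturbation[OF T])
    have tot: "\<bar>T x - F x\<bar> \<le> 2 * e" "\<bar>deriv T x - deriv F x\<bar> \<le> 2 * e" "\<bar>deriv (deriv T) x - deriv (deriv F) x\<bar> \<le> 2 * e" for x
      using cl[of x] clS[of x] \<delta>(2) e1(3) by linarith+
    have t\<eta>: "\<forall>x. \<bar>T x - F x\<bar> \<le> \<eta>0" "\<forall>x. \<bar>deriv T x - deriv F x\<bar> \<le> \<eta>0" using tot e(2) order_trans by blast+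
    show "lam' * w x \<le> \<sigma> * deriv T x * w (T x)" for x by (rule exp\<eta>[OF t\<eta>])
    show "m0 / 2 \<le> \<bar>deriv T x\<bar>" for x using tot(2)[of x] e(3) F_low_abs[of x] by linarith
    show "m0 / 2 \<le> \<bar>deriv K.S x\<bar>" for x using clS[of x] e e1 F_low_abs[of x] by linarith
    show "\<bar>deriv T x\<bar> \<le> B1 + 1" for x using tot(2)[of x] e(4) B1[of x] by linarith
    show "\<bar>deriv (deriv T) x\<bar> \<le> B2 + 1" for x using tot(3)[of x] e(4) B2[of x] by linarith
    show "\<bar>T x - K.S x\<bar> \<le> \<delta>" "\<bar>deriv T x - deriv K.S x\<bar> \<le> \<delta>" for x using cl[of x] by auto
  qed (fact \<zeta>1 \<zeta>2 \<tau>1 \<tau>2)+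
  show ?thesis
  proof (intro exI[of _ K.S] conjI allI)
    show "C2_circle K.S d" by (rule K.S_C2)
    show "expanding_lift K.S" by (rule expS)
    show "\<bar>K.S x - F x\<bar> \<le> e0" "\<bar>deriv K.S x - deriv F x\<bar> \<le> e0"
      "\<bar>deriv (deriv K.S) x - deriv (deriv F) x\<bar> \<le> e0" for x
      using clS[of x] e1(2) by linarith+
    show "\<exists>\<delta>>0. \<forall>T d'. C2_circle T d' \<longrightarrow>
      (\<forall>x. \<bar>T x - K.S x\<bar> \<le> \<delta> \<and> \<bar>deriv T x - deriv K.S x\<bar> \<le> \<delta> \<and> \<bar>deriv (deriv T) x - deriv (deriv K.S) x\<bar> \<le> \<delta>) \<longrightarrow>
      uniquely_locked T"
      using \<delta>(1) main by blast
  qed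
qed

end

section \<open>The distance on the space of circle maps\<close>

lemma E2_C2_circle: "T \<in> E2 \<Longrightarrow> \<exists>d. C2_circle T d"
  using C2_lift_locale by (auto simp: E2_def)

lemma C2_circle_E2:
  assumes "C2_circle T d" "expanding_lift T"
  shows "T \<in> E2"
  using assms unfolding E2_def C2_lift_def C2_circle_def by blast

lemma cdist_le: "cdist a b \<le> \<bar>a - b - of_int k\<bar>"
  unfolding cdist_def using round_diff_minimal[of "a - b" k] by simp

lemma cdist_triangle: "cdist a c \<le> cdist a b + cdist b c"
  using cdist_le[of a c "round (a - b) + round (b - c)"] unfolding cdist_def by linarith

lemma cdist_bdd: "bdd_above (range (\<lambda>x. cdist (S x) (T x)))"
proof (rule bdd_aboveI)
  show "v \<le> 1" if v: "v \<in> range (\<lambda>x. cdist (S x) (T x))" for v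
  proof -
    obtain x where "v = cdist (S x) (T x)" using v by blast
    then show ?thesis using of_int_round_abs_le[of "S x - T x"] unfolding cdist_def by linarith
  qed
qed

lemma deriv_bdd:
  assumes "C2_circle S d" "C2_circle T d'"
  shows "bdd_above (range (\<lambda>x. \<bar>deriv S x - deriv T x\<bar>))"
    and "bdd_above (range (\<lambda>x. \<bar>deriv (deriv S) x - deriv (deriv T) x\<bar>))"
proof -
  interpret S: C2_circle S d by fact
  interpret T: C2_circle T d' by fact
  have *: "bdd_above (range (\<lambda>x. \<bar>h x\<bar>))" if h: "continuous_on UNIV h" "\<And>x. h (x + 1) = h x" for h :: "real \<Rightarrow> real"
  proof -
    obtain B where "\<And>x. \<bar>h x\<bar> \<le> B" using continuous_periodic_bounded[OF h] by blast
    then show ?thesis by (intro bdd_aboveI2[of _ _ B])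
  qed
  show "bdd_above (range (\<lambda>x. \<bar>deriv S x - deriv T x\<bar>))"
    by (rule *) (auto intro!: continuous_intros S.cont1 T.cont1 simp: S.per1 T.per1)
  show "bdd_above (range (\<lambda>x. \<bar>deriv (deriv S) x - deriv (deriv T) x\<bar>))"
    by (rule *) (auto intro!: continuous_intros S.cont2 T.cont2 simp: S.per2 T.per2)
qed

lemma dC2_pointwise:
  assumes "C2_circle S d" "C2_circle T d'"
  shows "cdist (S x) (T x) \<le> dC2 S T" "\<bar>deriv S x - deriv T x\<bar> \<le> dC2 S T"
    "\<bar>deriv (deriv S) x - deriv (deriv T) x\<bar> \<le> dC2 S T"
proof -
  note b = cSUP_upper[OF UNIV_I cdist_bdd[of S T], of x]
    cSUP_upper[OF UNIV_I deriv_bdd(1)[OF assms], of x] cSUP_upper[OF UNIV_I deriv_bdd(2)[OF assms], of x]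
  have "cdist (S x) (T x) \<ge> 0" by (simp add: cdist_def)
  then show "cdist (S x) (T x) \<le> dC2 S T" "\<bar>deriv S x - deriv T x\<bar> \<le> dC2 S T"
    "\<bar>deriv (deriv S) x - deriv (deriv T) x\<bar> \<le> dC2 S T"
    using b unfolding dC2_def by linarith+
qed

lemma dC2_le:
  assumes "\<And>x. cdist (S x) (T x) \<le> a" "\<And>x. \<bar>deriv S x - deriv T x\<bar> \<le> b"
    "\<And>x. \<bar>deriv (deriv S) x - deriv (deriv T) x\<bar> \<le> c"
  shows "dC2 S T \<le> a + b + c"
  unfolding dC2_def using assms by (intro add_mono cSUP_least) auto

lemma dC2_triangle:
  assumes "C2_circle R d" "C2_circle S d'" "C2_circle T d''"
  shows "dC2 R T \<le> dC2 R S + dC2 S T"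
proof -
  note RS = cSUP_upper[OF UNIV_I cdist_bdd[of R S]]
    cSUP_upper[OF UNIV_I deriv_bdd(1)[OF assms(1,2)]] cSUP_upper[OF UNIV_I deriv_bdd(2)[OF assms(1,2)]]
  note ST = cSUP_upper[OF UNIV_I cdist_bdd[of S T]]
    cSUP_upper[OF UNIV_I deriv_bdd(1)[OF assms(2,3)]] cSUP_upper[OF UNIV_I deriv_bdd(2)[OF assms(2,3)]]
  have "dC2 R T \<le> ((SUP x. cdist (R x) (S x)) + (SUP x. cdist (S x) (T x)))
     + ((SUP x. \<bar>deriv R x - deriv S x\<bar>) + (SUP x. \<bar>deriv S x - deriv T x\<bar>))
     + ((SUP x. \<bar>deriv (deriv R) x - deriv (deriv S) x\<bar>) + (SUP x. \<bar>deriv (deriv S) x - deriv (deriv T) x\<bar>))"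
  proof (rule dC2_le)
    show "cdist (R x) (T x) \<le> (SUP x. cdist (R x) (S x)) + (SUP x. cdist (S x) (T x))" for x
      using RS(1)[of x] ST(1)[of x] cdist_triangle[of "R x" "T x" "S x"] by linarith
    show "\<bar>deriv R x - deriv T x\<bar> \<le> (SUP x. \<bar>deriv R x - deriv S x\<bar>) + (SUP x. \<bar>deriv S x - deriv T x\<bar>)" for x
      using RS(2)[of x] ST(2)[of x] by linarith
    show "\<bar>deriv (deriv R) x - deriv (deriv T) x\<bar> \<le> (SUP x. \<bar>deriv (deriv R) x - deriv (deriv S) x\<bar>)
        + (SUP x. \<bar>deriv (deriv S) x - deriv (deriv T) x\<bar>)" for x
      using RS(3)[of x] ST(3)[of x] by linarith
  qed
  then show ?thesis unfolding dC2_def by linarith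
qed

lemma dC2_self: "dC2 T T = 0"
  unfolding dC2_def cdist_def by simp

text \<open>The integer nearest to \<open>S x - T x\<close> cannot change with \<open>x\<close>: the
  distance of \<open>S x - T x\<close> to the integer chosen at 0 is continuous and starts below
  \<open>1 / 4\<close>, and it would have to take the value \<open>1 / 4\<close>, which closeness to
  some integer excludes.\<close>

lemma cdist_close_lift:
  fixes S T :: "real \<Rightarrow> real"
  assumes cont: "continuous_on UNIV S" "continuous_on UNIV T" and \<delta>: "\<delta> < 1 / 4"
    and cl: "\<And>x. cdist (S x) (T x) \<le> \<delta>"
  shows "\<exists>j::int. \<forall>x. \<bar>S x - of_int j - T x\<bar> \<le> \<delta>"
proof -
  define j where "j = round (S 0 - T 0)"
  define t where "t x = \<bar>S x - T x - of_int j\<bar>" for x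
  have tc: "continuous_on UNIV t" unfolding t_def[abs_def] using cont by (intro continuous_intros) auto
  have t0: "t 0 < 1 / 4" using cl[of 0] \<delta> unfolding t_def j_def cdist_def by linarith
  have int: "\<bar>of_int k - of_int j\<bar> < (1::real) \<Longrightarrow> k = j" for k by linarith
  have near: "t x < 1 / 4" for x
  proof (rule ccontr)
    assume "\<not> t x < 1 / 4"
    then have "1 / 4 \<in> {t 0..t x}" using t0 by simp
    moreover have "connected (t ` UNIV)" using tc by (intro connected_continuous_image) auto
    ultimately have "1 / 4 \<in> t ` UNIV"
      by (meson connected_contains_Icc UNIV_I imageI subsetD)
    then obtain y where y: "t y = 1 / 4" by auto
    have c: "\<bar>S y - T y - of_int (round (S y - T y))\<bar> \<le> \<delta>" using cl[of y] by (simp add: cdist_def)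
    then have "round (S y - T y) = j" using y \<delta> unfolding t_def by (intro int) linarith
    then show False using c y \<delta> unfolding t_def by simp
  qed
  have "\<bar>S x - of_int j - T x\<bar> \<le> \<delta>" for x
  proof -
    have c: "\<bar>S x - T x - of_int (round (S x - T x))\<bar> \<le> \<delta>" using cl[of x] by (simp add: cdist_def)
    then have "round (S x - T x) = j" using near[of x] \<delta> unfolding t_def by (intro int) linarith
    then show ?thesis using c by simp
  qed
  then show ?thesis by blast
qed

lemma uniquely_locked_shift:
  assumes "C2_circle T d"
  shows "uniquely_locked (\<lambda>x. T x - of_int j) \<longleftrightarrow> uniquely_locked T"
    and "C2_circle (\<lambda>x. T x - of_int j) d" and "deriv (\<lambda>x. T x - of_int j) = deriv T"
proof -
  interpret C2_circle T d by fact
  have D: "((\<lambda>x. T x - of_int j) has_real_derivative deriv T x) (at x)" for x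
    using DERIV_diff[OF D1 DERIV_const[of "of_int j"]] by simp
  show der: "deriv (\<lambda>x. T x - of_int j) = deriv T"
    by (rule ext) (rule DERIV_imp_deriv[OF D])
  have circ: "circ_map (\<lambda>x. T x - of_int j) = circ_map T"
  proof
    show "circ_map (\<lambda>x. T x - of_int j) x = circ_map T x" for x
      using frac_add_of_int_right[of "T x - of_int j" j] by (simp add: circ_map_def)
  qed
  show "uniquely_locked (\<lambda>x. T x - of_int j) \<longleftrightarrow> uniquely_locked T"
    unfolding uniquely_locked_def lyap_minimizing_def alpha_def invariant_measure_def lyap_def
      periodic_orbit_def circ der ..
  show "C2_circle (\<lambda>x. T x - of_int j) d"
    by unfold_locales (use D diff2 cont2 Fper in \<open>auto simp: der real_differentiable_def\<close>)
qed

text \<open>\<open>cdist\<close> sees lifts only up to integers, whereas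
  \<open>locking_nearby\<close> compares the lifts themselves. Below distance \<open>1 / 4\<close>
  one integer translation reconciles the two, and it changes neither the circle map nor its
  derivative.\<close>

lemma dense_locking:
  assumes T: "T \<in> E2" and \<epsilon>: "\<epsilon> > 0"
  shows "\<exists>S\<in>E2. dC2 S T < \<epsilon> \<and> (\<exists>\<delta>>0. \<forall>R\<in>E2. dC2 R S < \<delta> \<longrightarrow> uniquely_locked R)"
proof -
  obtain d where C2: "C2_circle T d" using E2_C2_circle[OF T] by blast
  have ex: "expanding_lift T" using T by (simp add: E2_def)
  interpret C2_circle T d by fact
  obtain \<sigma> H w W c lam m0 where ad: "\<sigma> = 1 \<or> \<sigma> = (- 1 :: real)" "lam > 1" "m0 > 0"
    "\<And>x. (H has_real_derivative w x) (at x)" "continuous_on UNIV w" "\<And>x. w (x + 1) = w x"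
    "\<And>x. 1 \<le> w x \<and> w x \<le> W" "\<And>x. H (x + 1) = H x + c"
    "\<And>x. m0 \<le> \<sigma> * deriv T x" "\<And>x. lam * w x \<le> \<sigma> * deriv T x * w (T x)"
    using adapted_coordinate[OF C2 ex] by blast
  obtain B1 B2 where B: "\<And>x. \<bar>deriv T x\<bar> \<le> B1" "\<And>x. \<bar>deriv (deriv T) x\<bar> \<le> B2" using bounds12 by blast
  interpret X: C2_expanding T d H w W c \<sigma> lam m0 B1 B2
    by unfold_locales (use ad B in auto)
  have "\<epsilon> / 6 > 0" using \<epsilon> by simp
  from X.locking_nearby[OF this]
  obtain S where S: "C2_circle S d" "expanding_lift S" and
    cl: "\<And>x. \<bar>S x - T x\<bar> \<le> \<epsilon> / 6 \<and> \<bar>deriv S x - deriv T x\<bar> \<le> \<epsilon> / 6 \<and> \<bar>deriv (deriv S) x - deriv (deriv T) x\<bar> \<le> \<epsilon> / 6"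
    and loc: "\<exists>\<delta>>0. \<forall>R d'. C2_circle R d' \<longrightarrow>
      (\<forall>x. \<bar>R x - S x\<bar> \<le> \<delta> \<and> \<bar>deriv R x - deriv S x\<bar> \<le> \<delta> \<and> \<bar>deriv (deriv R) x - deriv (deriv S) x\<bar> \<le> \<delta>) \<longrightarrow>
      uniquely_locked R"
    by blast
  obtain \<delta> where \<delta>: "\<delta> > 0" and lock: "\<And>R d'. C2_circle R d' \<Longrightarrow>
      (\<forall>x. \<bar>R x - S x\<bar> \<le> \<delta> \<and> \<bar>deriv R x - deriv S x\<bar> \<le> \<delta> \<and> \<bar>deriv (deriv R) x - deriv (deriv S) x\<bar> \<le> \<delta>) \<Longrightarrow>
      uniquely_locked R"
    using loc by blast
  have "dC2 S T \<le> \<epsilon> / 6 + \<epsilon> / 6 + \<epsilon> / 6"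
  proof (rule dC2_le)
    show "cdist (S x) (T x) \<le> \<epsilon> / 6" for x
      using cl[of x] cdist_le[of "S x" "T x" 0] by simp
  qed (use cl in auto)
  then have "dC2 S T < \<epsilon>" using \<epsilon> by linarith
  moreover have "uniquely_locked R" if R: "R \<in> E2" and dR: "dC2 R S < min \<delta> (1 / 8)" for R
  proof -
    obtain d' where R2: "C2_circle R d'" using E2_C2_circle[OF R] by blast
    note pw = dC2_pointwise[OF R2 S(1)]
    have "\<And>x. cdist (R x) (S x) \<le> min \<delta> (1 / 8)" using pw(1) dR by (smt (verit))
    note cd = this
    have "min \<delta> (1 / 8) < 1 / 4" by (simp add: min_def)
    from cdist_close_lift[OF C2_circle.cont0[OF R2] C2_circle.cont0[OF S(1)] this cd]
    obtain j where j: "\<And>x. \<bar>R x - of_int j - S x\<bar> \<le> min \<delta> (1 / 8)" by blast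
    note sh = uniquely_locked_shift[OF R2, of j]
    have "uniquely_locked (\<lambda>x. R x - of_int j)"
    proof (rule lock[OF sh(2)])
      show "\<forall>x. \<bar>R x - of_int j - S x\<bar> \<le> \<delta> \<and> \<bar>deriv (\<lambda>x. R x - of_int j) x - deriv S x\<bar> \<le> \<delta> \<and>
          \<bar>deriv (deriv (\<lambda>x. R x - of_int j)) x - deriv (deriv S) x\<bar> \<le> \<delta>"
        unfolding sh(3)
      proof
        fix x
        show "\<bar>R x - of_int j - S x\<bar> \<le> \<delta> \<and> \<bar>deriv R x - deriv S x\<bar> \<le> \<delta> \<and> \<bar>deriv (deriv R) x - deriv (deriv S) x\<bar> \<le> \<delta>"
          using j[of x] pw(2)[of x] pw(3)[of x] dR by auto
      qed
    qed
    then show ?thesis using sh(1) by blast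
  qed
  then have "\<exists>\<delta>>0. \<forall>R\<in>E2. dC2 R S < \<delta> \<longrightarrow> uniquely_locked R"
    using \<delta> by (intro exI[of _ "min \<delta> (1 / 8)"]) auto
  ultimately show ?thesis using C2_circle_E2[OF S] by blast
qed

theorem theoremA:
  shows "\<exists>U \<subseteq> E2.
    (\<forall>T\<in>U. \<exists>\<epsilon>>0. \<forall>S\<in>E2. dC2 S T < \<epsilon> \<longrightarrow> S \<in> U) \<and>
    (\<forall>T\<in>E2. \<forall>\<epsilon>>0. \<exists>S\<in>U. dC2 S T < \<epsilon>) \<and>
    (\<forall>T\<in>U. (\<exists>!\<mu>. lyap_minimizing T \<mu>) \<and>
       (\<forall>\<mu>. lyap_minimizing T \<mu> \<longrightarrow> (\<exists>\<Gamma>. periodic_orbit T \<Gamma> \<and> is_orbit_measure \<Gamma> \<mu>)))"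
proof -
  \<comment> \<open>The interior, relative to \<open>E2\<close>, of the uniquely locked maps:
    openness follows from the triangle inequality, and a member is itself locked because
    \<open>dC2 T T = 0\<close>.\<close>
  define U where "U = {S \<in> E2. \<exists>\<delta>>0. \<forall>R\<in>E2. dC2 R S < \<delta> \<longrightarrow> uniquely_locked R}"
  have open': "\<exists>\<epsilon>>0. \<forall>S\<in>E2. dC2 S T < \<epsilon> \<longrightarrow> S \<in> U" if T: "T \<in> U" for T
  proof -
    obtain \<delta> where \<delta>: "\<delta> > 0" "\<And>R. R \<in> E2 \<Longrightarrow> dC2 R T < \<delta> \<Longrightarrow> uniquely_locked R" and TE: "T \<in> E2"
      using T unfolding U_def by blast
    have "S \<in> U" if S: "S \<in> E2" "dC2 S T < \<delta> / 2" for S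
    proof -
      have "uniquely_locked R" if R: "R \<in> E2" "dC2 R S < \<delta> / 2" for R
      proof -
        obtain d1 d2 d3 where "C2_circle R d1" "C2_circle S d2" "C2_circle T d3"
          using E2_C2_circle R(1) S(1) TE by metis
        then have "dC2 R T \<le> dC2 R S + dC2 S T" by (rule dC2_triangle)
        then show ?thesis using \<delta>(2)[OF R(1)] R S by linarith
      qed
      then show ?thesis unfolding U_def using S(1) \<delta>(1) by (auto intro!: exI[of _ "\<delta> / 2"])
    qed
    then show ?thesis using \<delta>(1) by (intro exI[of _ "\<delta> / 2"]) auto
  qed
  have dense: "\<exists>S\<in>U. dC2 S T < \<epsilon>" if "T \<in> E2" "\<epsilon> > 0" for T \<epsilon>
    using dense_locking[OF that] unfolding U_def by blast
  have locked: "uniquely_locked T" if "T \<in> U" for T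
    using that dC2_self[of T] unfolding U_def by auto
  show ?thesis
    using open' dense locked unfolding uniquely_locked_def
    by (intro exI[of _ U]) (auto simp: U_def)
qed

end
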